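(* Let $2<p<\infty$. For every ordinal $\alpha$ with $\omega\le\alpha<\omega_1$ and every $k\in\mathbb N$, the space $R_p^{\alpha+k}$ is $(p,2)$-isomorphic to $R_p^{\alpha}$.
   Context: All spaces are real. Two subspaces of $L_p$ of probability measures are $(p,2)$-isomorphic if there is a linear bijection between them which, together with its inverse, is bounded both for the $L_p$ norms and for the $L_2$ norms. For $n\ge 0$, $L_p^n$ is the subspace of $L_p[0,1]$ of functions constant on each interval $[k2^{-n},(k+1)2^{-n})$, $0\le k<2^n$. For subspaces $X\subset L_p(\Omega_1,\mu_1)$, $Y\subset L_p(\Omega_2,\mu_2)$ ($\mu_i$ probability measures), $X\otimes Y$ is the closed linear span in $L_p(\mu_1\times\mu_2)$ of the functions $x(s)y(t)$, $x\in X$, $y\in Y$. For subspaces $X_n\subset L_p(\Omega_n,\mu_n)$, $n\in\mathbb N$, $\mu_n$ probability measures, let $\Omega=\prod_n\Omega_n$ with product measure $\mu$, $p_n:\Omega\to\Omega_n$ the coordinate map, $j_n(f)=f\circ p_n$; the complete independent sum $(\sum X_n)_I$ is the closed linear span in $L_p(\Omega,\mu)$ of the constants together with $\bigcup_{n\ge1}j_n(X_n)$. By transfinite recursion: $R_p^0=L_p^0$ (constants); $R_p^{\alpha+1}=L_p^1\otimes R_p^\alpha$; and for a limit ordinal $\beta<\omega_1$, $R_p^\beta=(\sum_{n=1}^\infty R_{p,0}^{\alpha_n})_I$, where $(\alpha_n)$ enumerates the ordinals $\gamma$ with $0<\gamma<\beta$ and $R_{p,0}^\gamma$ is the subspace of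 mean-zero functions in $R_p^\gamma$. *)

theory Defs
  imports "HOL-Probability.Probability" "HOL-Library.Countable_Set_Type"
begin

section \<open>Countable ordinals\<close>

text \<open>
  \<^const>\<open>cardSuc\<close> \<^const>\<open>natLeq\<close> is the initial well-order of cardinality $\aleph_1$, so
  its field, ordered by it, is a copy of the set $[0,\omega_1)$ of all countable ordinals.
\<close>

lemma Card_order_cardSuc_natLeq: "Card_order (cardSuc natLeq)"
  by (simp add: cardSuc_Card_order natLeq_Card_order)

lemma infinite_Field_cardSuc_natLeq: "infinite (Field (cardSuc natLeq))"
  using cardSuc_finite[OF natLeq_Card_order] by (simp add: Field_natLeq)

typedef countable_ordinal = "Field (cardSuc natLeq)"
  using infinite_Field_cardSuc_natLeq by (metis ex_in_conv finite.emptyI)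

instantiation countable_ordinal :: wellorder
begin

definition less_eq_countable_ordinal :: "countable_ordinal \<Rightarrow> countable_ordinal \<Rightarrow> bool" where
  "a \<le> b \<longleftrightarrow> (Rep_countable_ordinal a, Rep_countable_ordinal b) \<in> cardSuc natLeq"

definition less_countable_ordinal :: "countable_ordinal \<Rightarrow> countable_ordinal \<Rightarrow> bool" where
  "(a :: countable_ordinal) < b \<longleftrightarrow> a \<le> b \<and> a \<noteq> b"

instance
proof -
  have wo: "Well_order (cardSuc natLeq)"
    using Card_order_cardSuc_natLeq by (simp add: card_order_on_def)
  then have refl: "refl_on (Field (cardSuc natLeq)) (cardSuc natLeq)"
    and trans: "trans (cardSuc natLeq)" and antisym: "antisym (cardSuc natLeq)"
    and total: "total_on (Field (cardSuc natLeq)) (cardSuc natLeq)"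
    and wf: "wf (cardSuc natLeq - Id)"
    unfolding order_on_defs by auto
  have le_refl: "a \<le> a" for a :: countable_ordinal
    using refl Rep_countable_ordinal unfolding less_eq_countable_ordinal_def refl_on_def by blast
  have le_antisym: "a = b" if "a \<le> b" "b \<le> a" for a b :: countable_ordinal
    using that antisym unfolding less_eq_countable_ordinal_def antisym_def
    by (metis Rep_countable_ordinal_inject)
  have le_trans: "a \<le> c" if "a \<le> b" "b \<le> c" for a b c :: countable_ordinal
    using that trans unfolding less_eq_countable_ordinal_def by (metis transD)
  have le_total: "a \<le> b \<or> b \<le> a" for a b :: countable_ordinal
    using total le_refl Rep_countable_ordinal
    unfolding less_eq_countable_ordinal_def total_on_def by metis
  have "wf (inv_image (cardSuc natLeq - Id) Rep_countable_ordinal)"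
    using wf by (rule wf_inv_image)
  moreover have "{(a, b). a < (b :: countable_ordinal)}
      \<subseteq> inv_image (cardSuc natLeq - Id) Rep_countable_ordinal"
    by (auto simp: less_countable_ordinal_def less_eq_countable_ordinal_def inv_image_def
        Rep_countable_ordinal_inject)
  ultimately have wf_less: "wf {(a, b). a < (b :: countable_ordinal)}"
    by (rule wf_subset)
  show "OFCLASS(countable_ordinal, wellorder_class)"
  proof
    fix a b c :: countable_ordinal
    show "a < b \<longleftrightarrow> a \<le> b \<and> \<not> b \<le> a"
      using le_antisym le_refl by (auto simp: less_countable_ordinal_def)
    show "a \<le> a" by (rule le_refl)
    show "a \<le> b \<Longrightarrow> b \<le> c \<Longrightarrow> a \<le> c" by (rule le_trans)
    show "a \<le> b \<Longrightarrow> b \<le> a \<Longrightarrow> a = b" by (rule le_antisym)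
    show "a \<le> b \<or> b \<le> a" by (rule le_total)
  next
    fix P :: "countable_ordinal \<Rightarrow> bool" and a :: countable_ordinal
    assume "\<And>x. (\<And>y. y < x \<Longrightarrow> P y) \<Longrightarrow> P x"
    then show "P a" using wf_less by (metis (mono_tags, lifting) case_prodI mem_Collect_eq wf_induct_rule)
  qed
qed

end

instantiation countable_ordinal :: zero
begin

definition zero_countable_ordinal :: countable_ordinal where
  "0 = (LEAST a :: countable_ordinal. True)"

instance ..

end

text \<open>Successor: $\alpha + k$ for finite $k$ is \<open>(osucc ^^ k) \<alpha>\<close>.\<close>

definition osucc :: "countable_ordinal \<Rightarrow> countable_ordinal" where
  "osucc a = (LEAST b. a < b)"

definition opred :: "countable_ordinal \<Rightarrow> countable_ordinal" where
  "opred a = (THE b. a = osucc b)"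

definition is_limit :: "countable_ordinal \<Rightarrow> bool" where
  "is_limit b \<longleftrightarrow> b \<noteq> 0 \<and> (\<nexists>a. b = osucc a)"

definition omega :: countable_ordinal where
  "omega = (LEAST b. is_limit b)"

lemma countable_below:
  includes cardinal_syntax
  shows "countable {b :: countable_ordinal. b < a}"
proof -
  let ?r = "cardSuc natLeq"
  have "|underS ?r (Rep_countable_ordinal a)| <o ?r"
    using Card_order_cardSuc_natLeq Rep_countable_ordinal by (rule card_of_underS)
  then have "|underS ?r (Rep_countable_ordinal a)| \<le>o natLeq"
    using cardSuc_ordLeq_ordLess card_of_Card_order natLeq_Card_order by blast
  then have "countable (underS ?r (Rep_countable_ordinal a))"
    by (simp add: countable_card_le_natLeq)
  moreover have "Rep_countable_ordinal ` {b. b < a} \<subseteq> underS ?r (Rep_countable_ordinal a)"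
    by (auto simp: underS_def less_countable_ordinal_def less_eq_countable_ordinal_def
        Rep_countable_ordinal_inject)
  ultimately show ?thesis
    by (metis countable_subset countable_image_inj_on inj_onI Rep_countable_ordinal_inject)
qed

lemma uncountable_countable_ordinal:
  includes cardinal_syntax
  shows "uncountable (UNIV :: countable_ordinal set)"
proof
  assume "countable (UNIV :: countable_ordinal set)"
  then have "countable (range Rep_countable_ordinal)" by simp
  then have "countable (Field (cardSuc natLeq))"
    using type_definition.Rep_range[OF type_definition_countable_ordinal] by simp
  then have "|Field (cardSuc natLeq)| \<le>o natLeq" by (simp add: countable_card_le_natLeq)
  then have "cardSuc natLeq \<le>o natLeq"
    using card_of_Field_ordIso[OF Card_order_cardSuc_natLeq] ordIso_ordLeq_trans ordIso_symmetric
    by blast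
  then show False
    using cardSuc_greater[OF natLeq_Card_order] not_ordLess_ordLeq by blast
qed

lemma countable_bounded:
  fixes A :: "countable_ordinal set"
  assumes "countable A"
  shows "\<exists>b. \<forall>a\<in>A. a < b"
proof (rule ccontr)
  assume "\<not> ?thesis"
  then have "UNIV = (\<Union>a\<in>A. insert a {b. b < a})"
    by (force simp: not_less le_less)
  moreover have "countable (\<Union>a\<in>A. insert a {b. b < a})"
    using assms countable_below by auto
  ultimately show False using uncountable_countable_ordinal by simp
qed

lemma zero_le_countable_ordinal [simp]: "0 \<le> (a :: countable_ordinal)"
  unfolding zero_countable_ordinal_def by (rule Least_le) simp

lemma less_osucc [simp]: "a < osucc a"
proof -
  obtain b where "a < b" using countable_bounded[of "{a}"] by auto
  then show ?thesis unfolding osucc_def by (rule LeastI)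
qed

lemma osucc_le: "a < b \<Longrightarrow> osucc a \<le> b"
  unfolding osucc_def by (rule Least_le)

lemma osucc_inject [simp]: "osucc a = osucc b \<longleftrightarrow> a = b"
  by (metis less_osucc osucc_le leD neqE)

lemma opred_osucc [simp]: "opred (osucc a) = a"
  by (auto simp: opred_def)

lemma osucc_neq_0 [simp]: "osucc a \<noteq> 0"
  by (metis less_osucc leD zero_le_countable_ordinal)

lemma is_limit_omega: "is_limit omega"
proof -
  let ?A = "range (\<lambda>n. (osucc ^^ n) 0)"
  have "\<exists>b. \<forall>a\<in>?A. a < b" by (rule countable_bounded) simp
  define b where "b = (LEAST b. \<forall>a\<in>?A. a < b)"
  have b: "\<forall>a\<in>?A. a < b"
    unfolding b_def using \<open>\<exists>b. \<forall>a\<in>?A. a < b\<close> by (rule LeastI_ex)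
  have "is_limit b"
    unfolding is_limit_def
  proof (intro conjI notI)
    assume "b = 0" then show False using b by (metis leD rangeI zero_le_countable_ordinal)
  next
    assume "\<exists>a. b = osucc a"
    then obtain a where a: "b = osucc a" by blast
    have "\<forall>c\<in>?A. c < a"
    proof
      fix c assume "c \<in> ?A"
      then obtain n where n: "c = (osucc ^^ n) 0" by blast
      then have "osucc c = (osucc ^^ Suc n) 0" by simp
      then have "osucc c < osucc a" using b a by (metis rangeI)
      then show "c < a" by (metis less_le_trans less_osucc not_less osucc_le)
    qed
    then have "b \<le> a" unfolding b_def by (rule Least_le)
    then show False using a less_osucc leD by blast
  qed
  then show ?thesis unfolding omega_def by (rule LeastI)
qed


section \<open>Subspaces of $L_p$\<close>

text \<open>
  A subspace of $L_p(\mu)$ is represented by the set of all measurable functions whose classes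
  modulo almost everywhere equality belong to it.
\<close>

definition Lp :: "real \<Rightarrow> 'a measure \<Rightarrow> ('a \<Rightarrow> real) set" where
  "Lp p M = {f \<in> borel_measurable M. integrable M (\<lambda>x. \<bar>f x\<bar> powr p)}"

definition Lp_norm :: "real \<Rightarrow> 'a measure \<Rightarrow> ('a \<Rightarrow> real) \<Rightarrow> real" where
  "Lp_norm p M f = (\<integral>x. \<bar>f x\<bar> powr p \<partial>M) powr (1 / p)"

definition lin_span :: "('a \<Rightarrow> real) set \<Rightarrow> ('a \<Rightarrow> real) set" where
  "lin_span G = {h. \<exists>(n::nat) c g. (\<forall>i<n. g i \<in> G) \<and> h = (\<lambda>x. \<Sum>i<n. c i * g i x)}"

definition closed_span :: "real \<Rightarrow> 'a measure \<Rightarrow> ('a \<Rightarrow> real) set \<Rightarrow> ('a \<Rightarrow> real) set" where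
  "closed_span p M G =
    {f \<in> Lp p M. \<forall>\<epsilon>>0. \<exists>h\<in>lin_span G. Lp_norm p M (\<lambda>x. f x - h x) < \<epsilon>}"

definition unit_interval :: "real measure" where
  "unit_interval = restrict_space lborel {0..1}"

definition Lp_dyadic :: "real \<Rightarrow> nat \<Rightarrow> (real \<Rightarrow> real) set" where
  "Lp_dyadic p n = {f \<in> Lp p unit_interval. \<forall>k<2 ^ n. \<exists>c.
     AE x in unit_interval. x \<in> {real k / 2 ^ n ..< (real k + 1) / 2 ^ n} \<longrightarrow> f x = c}"

definition tensor ::
  "real \<Rightarrow> 'a measure \<Rightarrow> ('a \<Rightarrow> real) set \<Rightarrow> 'b measure \<Rightarrow> ('b \<Rightarrow> real) set \<Rightarrow> ('a \<times> 'b \<Rightarrow> real) set"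
  where
  "tensor p M X N Y =
    closed_span p (M \<Otimes>\<^sub>M N) {\<lambda>(s, t). x s * y t | x y. x \<in> X \<and> y \<in> Y}"

definition indep_sum ::
  "real \<Rightarrow> (nat \<Rightarrow> 'a measure) \<Rightarrow> (nat \<Rightarrow> ('a \<Rightarrow> real) set) \<Rightarrow> ((nat \<Rightarrow> 'a) \<Rightarrow> real) set" where
  "indep_sum p M X =
    closed_span p (PiM UNIV M) (range (\<lambda>c _. c) \<union> (\<Union>n. {\<lambda>\<omega>. f (\<omega> n) | f. f \<in> X n}))"

definition mean_zero :: "'a measure \<Rightarrow> ('a \<Rightarrow> real) set \<Rightarrow> ('a \<Rightarrow> real) set" where
  "mean_zero M X = {f \<in> X. (\<integral>x. f x \<partial>M) = 0}"

text \<open>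
  Linear maps between the spaces of classes are given on representatives. The integrals in
  \<^const>\<open>Lp_norm\<close> \<open>2\<close> are finite for $p \ge 2$ and probability measures, the only case in which
  the notion is used.
\<close>

definition linear_mod_AE ::
  "'a measure \<Rightarrow> ('a \<Rightarrow> real) set \<Rightarrow> 'b measure \<Rightarrow> ('b \<Rightarrow> real) set \<Rightarrow> (('a \<Rightarrow> real) \<Rightarrow> 'b \<Rightarrow> real) \<Rightarrow> bool"
  where
  "linear_mod_AE M X N Y T \<longleftrightarrow>
     T \<in> X \<rightarrow> Y \<and>
     (\<forall>f\<in>X. \<forall>g\<in>X. (AE x in M. f x = g x) \<longrightarrow> (AE y in N. T f y = T g y)) \<and>
     (\<forall>f\<in>X. \<forall>g\<in>X. \<forall>a b. AE y in N. T (\<lambda>x. a * f x + b * g x) y = a * T f y + b * T g y)"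

definition Lp_bounded ::
  "real \<Rightarrow> 'a measure \<Rightarrow> ('a \<Rightarrow> real) set \<Rightarrow> 'b measure \<Rightarrow> (('a \<Rightarrow> real) \<Rightarrow> 'b \<Rightarrow> real) \<Rightarrow> bool"
  where
  "Lp_bounded q M X N T \<longleftrightarrow> (\<exists>C. \<forall>f\<in>X. Lp_norm q N (T f) \<le> C * Lp_norm q M f)"

definition p2_isomorphic ::
  "real \<Rightarrow> 'a measure \<Rightarrow> ('a \<Rightarrow> real) set \<Rightarrow> 'b measure \<Rightarrow> ('b \<Rightarrow> real) set \<Rightarrow> bool" where
  "p2_isomorphic p M X N Y \<longleftrightarrow> (\<exists>T S.
     linear_mod_AE M X N Y T \<and> linear_mod_AE N Y M X S \<and>
     (\<forall>f\<in>X. AE x in M. S (T f) x = f x) \<and> (\<forall>g\<in>Y. AE y in N. T (S g) y = g y) \<and>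
     Lp_bounded p M X N T \<and> Lp_bounded 2 M X N T \<and>
     Lp_bounded p N Y M S \<and> Lp_bounded 2 N Y M S)"


section \<open>The spaces $R_p^\alpha$\<close>

text \<open>
  The space $R_p^\alpha$ lives on a probability space depending on $\alpha$: on $[0,1]$ for
  $\alpha = 0$, on $[0,1] \times \Omega_\alpha$ for $\alpha + 1$ and on
  $\prod_n \Omega_{\alpha_n}$ for a limit ordinal. The injective constructors of the following
  datatype allow all of these to be realised, up to relabelling of points, in one type.
\<close>

datatype point = Base real | Extend "real \<times> point" | Seq "nat \<Rightarrow> point"

definition relabel :: "('a \<Rightarrow> 'b) \<Rightarrow> ('a \<Rightarrow> real) set \<Rightarrow> ('b \<Rightarrow> real) set" where
  "relabel j X = {f. (\<lambda>x. f (j x)) \<in> X}"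

text \<open>
  The parameter \<open>e\<close> chooses, for every limit ordinal \<open>\<beta>\<close>, an enumeration \<open>e \<beta>\<close> (indexed from 0)
  of the ordinals strictly between 0 and \<open>\<beta>\<close>. The test \<open>e a n < a\<close> serves only to make the
  recursion terminate.
\<close>

definition enumerates_below_limits :: "(countable_ordinal \<Rightarrow> nat \<Rightarrow> countable_ordinal) \<Rightarrow> bool" where
  "enumerates_below_limits e \<longleftrightarrow>
     (\<forall>b. is_limit b \<longrightarrow> bij_betw (e b) UNIV {c. 0 < c \<and> c < b})"

function R_measure ::
  "(countable_ordinal \<Rightarrow> nat \<Rightarrow> countable_ordinal) \<Rightarrow> countable_ordinal \<Rightarrow> point measure" where
  "R_measure e a =
    (if a = 0 then embed_measure unit_interval Base
     else if \<exists>b. a = osucc b then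
       embed_measure (unit_interval \<Otimes>\<^sub>M R_measure e (opred a)) Extend
     else
       embed_measure (PiM UNIV (\<lambda>n. if e a n < a then R_measure e (e a n) else undefined)) Seq)"
  by auto
termination
  by (relation "{((e, a), (e', a')). a < a'}")
     (auto intro!: wf_subset[OF wf_inv_image[OF wf, of snd]] simp: inv_image_def)

function R_space ::
  "real \<Rightarrow> (countable_ordinal \<Rightarrow> nat \<Rightarrow> countable_ordinal) \<Rightarrow> countable_ordinal \<Rightarrow> (point \<Rightarrow> real) set" where
  "R_space p e a =
    (if a = 0 then relabel Base (Lp_dyadic p 0)
     else if \<exists>b. a = osucc b then
       relabel Extend
         (tensor p unit_interval (Lp_dyadic p 1) (R_measure e (opred a)) (R_space p e (opred a)))
     else
       relabel Seq
         (indep_sum p (\<lambda>n. R_measure e (e a n))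
           (\<lambda>n. if e a n < a then mean_zero (R_measure e (e a n)) (R_space p e (e a n))
                else undefined)))"
  by auto
termination
  by (relation "{((p, e, a), (p', e', a')). a < a'}")
     (auto intro!: wf_subset[OF wf_inv_image[OF wf, of "\<lambda>(p, e, a). a"]] simp: inv_image_def)

declare R_measure.simps [simp del] R_space.simps [simp del]

lemma R_measure_0: "R_measure e 0 = embed_measure unit_interval Base"
  by (subst R_measure.simps) simp

lemma R_measure_osucc:
  "R_measure e (osucc a) = embed_measure (unit_interval \<Otimes>\<^sub>M R_measure e a) Extend"
  by (subst R_measure.simps) simp

lemma R_measure_limit:
  assumes "enumerates_below_limits e" and "is_limit b"
  shows "R_measure e b = embed_measure (PiM UNIV (\<lambda>n. R_measure e (e b n))) Seq"
proof -
  have "e b n < b" for n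
    using assms by (auto simp: enumerates_below_limits_def dest!: bij_betwE)
  then show ?thesis using assms(2) by (subst R_measure.simps) (simp add: is_limit_def)
qed

lemma R_space_0: "R_space p e 0 = relabel Base (Lp_dyadic p 0)"
  by (subst R_space.simps) simp

lemma R_space_osucc:
  "R_space p e (osucc a) =
     relabel Extend (tensor p unit_interval (Lp_dyadic p 1) (R_measure e a) (R_space p e a))"
  by (subst R_space.simps) simp

lemma R_space_limit:
  assumes "enumerates_below_limits e" and "is_limit b"
  shows "R_space p e b =
     relabel Seq (indep_sum p (\<lambda>n. R_measure e (e b n))
       (\<lambda>n. mean_zero (R_measure e (e b n)) (R_space p e (e b n))))"
proof -
  have "e b n < b" for n
    using assms by (auto simp: enumerates_below_limits_def dest!: bij_betwE)
  then show ?thesis using assms(2) by (subst R_space.simps) (simp add: is_limit_def)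
qed

lemma enumerates_below_limits_exists: "\<exists>e. enumerates_below_limits e"
proof -
  have "\<exists>f :: nat \<Rightarrow> _. bij_betw f UNIV {c. 0 < c \<and> c < b}" if b: "is_limit b" for b
  proof -
    have step: "osucc c < b" if "c < b" for c
      using osucc_le[OF that] b by (auto simp: is_limit_def order_less_le)
    have "0 < b" using b by (simp add: is_limit_def order_less_le)
    have "infinite {c. 0 < c \<and> c < b}"
    proof
      assume fin: "finite {c. 0 < c \<and> c < b}"
      have ne: "osucc 0 \<in> {c. 0 < c \<and> c < b}" using step[OF \<open>0 < b\<close>] less_osucc by blast
      define m where "m = Max {c. 0 < c \<and> c < b}"
      have "m \<in> {c. 0 < c \<and> c < b}" unfolding m_def using fin ne by (intro Max_in) blast+
      then have "osucc m \<in> {c. 0 < c \<and> c < b}"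
        using step less_osucc[of m] by (auto intro: less_trans)
      then have "osucc m \<le> m" unfolding m_def using fin by (intro Max_ge)
      then show False using less_osucc leD by blast
    qed
    moreover have "countable {c. 0 < c \<and> c < b}"
      by (rule countable_subset[OF _ countable_below[of b]]) auto
    ultimately show ?thesis using bij_betw_from_nat_into by blast
  qed
  then have "\<exists>e. \<forall>b. is_limit b \<longrightarrow> bij_betw (e b) (UNIV :: nat set) {c. 0 < c \<and> c < b}"
    by (intro choice) blast
  then show ?thesis by (simp add: enumerates_below_limits_def)
qed

lemma prob_space_unit_interval: "prob_space unit_interval"
  unfolding unit_interval_def by (rule prob_space_restrict_space) auto

lemma prob_space_embed_measure:
  assumes "prob_space M" and "inj j"
  shows "prob_space (embed_measure M j)"
proof -
  have "embed_measure M j = distr M (embed_measure M j) j"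
    by (rule embed_measure_eq_distr) (rule assms)
  then show ?thesis
    by (metis assms prob_space.prob_space_distr measurable_embed_measure2)
qed

lemma prob_space_R_measure:
  assumes e: "enumerates_below_limits e"
  shows "prob_space (R_measure e a)"
proof (induction a rule: less_induct)
  case (less a)
  consider "a = 0" | b where "a = osucc b" | "is_limit a" by (auto simp: is_limit_def)
  then show ?case
  proof cases
    case 1
    then show ?thesis
      by (simp add: R_measure_0 prob_space_embed_measure prob_space_unit_interval inj_def)
  next
    case 2
    then interpret B: prob_space "R_measure e b" using less by simp
    interpret U: prob_space unit_interval by (rule prob_space_unit_interval)
    interpret pair_prob_space unit_interval "R_measure e b" ..
    show ?thesis
      unfolding 2 R_measure_osucc
      by (intro prob_space_embed_measure prob_space_axioms) (simp add: inj_def)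
  next
    case 3
    then have "e a n < a" for n
      using e by (auto simp: enumerates_below_limits_def dest!: bij_betwE)
    then show ?thesis
      unfolding R_measure_limit[OF e 3]
      by (intro prob_space_embed_measure prob_space_PiM less) (auto simp: inj_def)
  qed
qed

end

theory Submission
  imports Defs "HOL-Library.Equipollence" "HOL-Library.Function_Algebras"
begin

text \<open>
  Write $X_\alpha$ for the mean-zero part of $R_p^\alpha$. Sums of independent mean-zero functions
  satisfy Rosenthal's inequality: the norm $\|\sum x_n\|_p^p$ is equivalent to
  $\sum \|x_n\|_p^p + (\sum \|x_n\|_2^2)^{p/2}$. Hence, with constants depending on $p$ only, $X_\beta$
  is the $(p,2)$-direct sum of the $X_\gamma$, $0 < \gamma < \beta$, for a limit ordinal $\beta$, while
  $X_{\gamma+1}$ is $X_\gamma \oplus X_\gamma \oplus \mathbb R$ and $R_p^\gamma$ is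
  $X_\gamma \oplus \mathbb R$. The constants being uniform, these rules may be applied to all summands
  of an infinite sum at once, so that the problem becomes one about multiplicities of summands:
  for $\alpha \ge \omega$ the space $X_\alpha$ absorbs $X_\alpha$ and $\mathbb R$, and therefore
  $X_{\alpha+1}$ is isomorphic to $X_\alpha$.

  If the limit ordinals are unbounded in the limit ordinal $\beta$, expanding the summands $X_\gamma$ of
  $X_\beta$ with $\gamma$ a limit yields infinitely many copies of every summand. Otherwise
  $\beta = \gamma_0 + \omega$ with $\gamma_0$ zero or a limit, and expanding every summand $X_{\gamma_0+n}$,
  $n \ge 1$, of $Y = \bigoplus_{n\ge1} X_{\gamma_0+n}$ once shows that $Y$ is isomorphic to
  $X_{\gamma_0} \oplus Y \oplus Y \oplus \ell_2$, which makes $Y$ absorbing by induction.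
\<close>

section \<open>Two-norm spaces up to isomorphism\<close>

text \<open>Two obstacles shape the proof. The L_p norm of a sum of independent mean-zero functions
  also involves the L_2 norms of the terms, so isomorphisms of the terms that are controlled in L_p
  alone cannot be added up; both norms have to travel together. And infinitely many isomorphisms can
  be added up only if one constant serves them all. Constants multiply along a chain of expansions:
  reducing X_(g+n) all the way down to X_g takes n steps, and the constant obtained grows with n. So
  every summand of an infinite sum is expanded just once, simultaneously with the others, and what
  follows is finite arithmetic with multiplicities in {0, 1, 2, ..., \<infinity>}. An infinite
  multiplicity does not change when something is added to it, and absorption ultimately comes from
  there. Below \<omega> there is no such source: X_n is finite-dimensional for finite n, and X_0 =
  0, X_1 = \<real>.\<close>

lemma powr_add_le:
  fixes x y r :: real
  assumes "0 \<le> x" "0 \<le> y" "0 \<le> r"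
  shows "(x + y) powr r \<le> 2 powr r * (x powr r + y powr r)"
proof -
  have "(x + y) powr r \<le> (2 * max x y) powr r"
    using assms by (intro powr_mono2) auto
  also have "\<dots> = 2 powr r * max x y powr r"
    using assms by (simp add: powr_mult)
  also have "\<dots> \<le> 2 powr r * (x powr r + y powr r)"
    by (intro mult_left_mono) (auto simp: max_def)
  finally show ?thesis .
qed

text \<open>
  The functionals \<open>pw\<close> and \<open>sq\<close> stand for $\|f\|_p^p$ and $\|f\|_2^2$; working with powers of the norms
  makes direct sums additive in both. As in the definitions, functions are representatives, and
  they count as equal when \<open>sq\<close> vanishes on their difference.
\<close>

record 'i two_normed =
  car :: "('i \<Rightarrow> real) set"
  pw :: "('i \<Rightarrow> real) \<Rightarrow> real"
  sq :: "('i \<Rightarrow> real) \<Rightarrow> real"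

locale exponent =
  fixes p :: real
  assumes p_gt_2: "2 < p"
begin

text \<open>The exponent p/2 turns a squared norm into a p-th power, so \<open>wt\<close> is
  homogeneous of degree p. Summed over independent terms it is the right-hand side of Rosenthal's
  inequality.\<close>

definition wt :: "'i two_normed \<Rightarrow> ('i \<Rightarrow> real) \<Rightarrow> real" where
  "wt A f = pw A f + sq A f powr (p / 2)"

text \<open>Powers of norms obey a triangle inequality only up to a factor. The factors 2 and 2^p
  are fixed here because they survive termwise summation, so that direct sums of any size satisfy
  the same axioms. The implication from \<open>sq\<close> to \<open>pw\<close> makes functions that
  count as equal indistinguishable for \<open>pw\<close> as well.\<close>

definition two_normed_space :: "'i two_normed \<Rightarrow> bool" where
  "two_normed_space A \<longleftrightarrow>
     (\<lambda>_. 0) \<in> car A \<and>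
     (\<forall>f\<in>car A. \<forall>g\<in>car A. \<forall>a b. (\<lambda>x. a * f x + b * g x) \<in> car A) \<and>
     (\<forall>f\<in>car A. 0 \<le> pw A f \<and> 0 \<le> sq A f \<and> (sq A f = 0 \<longrightarrow> pw A f = 0)) \<and>
     (\<forall>f\<in>car A. \<forall>g\<in>car A. \<forall>a b.
        sq A (\<lambda>x. a * f x + b * g x) \<le> 2 * (a\<^sup>2 * sq A f + b\<^sup>2 * sq A g) \<and>
        pw A (\<lambda>x. a * f x + b * g x)
          \<le> 2 powr p * (\<bar>a\<bar> powr p * pw A f + \<bar>b\<bar> powr p * pw A g))"

lemma zero_car: "two_normed_space A \<Longrightarrow> (\<lambda>_. 0) \<in> car A"
  and lc_car: "two_normed_space A \<Longrightarrow> f \<in> car A \<Longrightarrow> g \<in> car A \<Longrightarrow> (\<lambda>x. a * f x + b * g x) \<in> car A"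
  and pw_nonneg: "two_normed_space A \<Longrightarrow> f \<in> car A \<Longrightarrow> 0 \<le> pw A f"
  and sq_nonneg: "two_normed_space A \<Longrightarrow> f \<in> car A \<Longrightarrow> 0 \<le> sq A f"
  and pw_eq_0: "two_normed_space A \<Longrightarrow> f \<in> car A \<Longrightarrow> sq A f = 0 \<Longrightarrow> pw A f = 0"
  and sq_lc: "two_normed_space A \<Longrightarrow> f \<in> car A \<Longrightarrow> g \<in> car A \<Longrightarrow>
        sq A (\<lambda>x. a * f x + b * g x) \<le> 2 * (a\<^sup>2 * sq A f + b\<^sup>2 * sq A g)"
  and pw_lc: "two_normed_space A \<Longrightarrow> f \<in> car A \<Longrightarrow> g \<in> car A \<Longrightarrow>
        pw A (\<lambda>x. a * f x + b * g x) \<le> 2 powr p * (\<bar>a\<bar> powr p * pw A f + \<bar>b\<bar> powr p * pw A g)"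
  unfolding two_normed_space_def by blast+

lemma diff_car: "two_normed_space A \<Longrightarrow> f \<in> car A \<Longrightarrow> g \<in> car A \<Longrightarrow> (\<lambda>x. f x - g x) \<in> car A"
  using lc_car[of A f g 1 "-1"] by simp

lemma sq_zero: "two_normed_space A \<Longrightarrow> sq A (\<lambda>_. 0) = 0"
  using sq_lc[of A "\<lambda>_. 0" "\<lambda>_. 0" 0 0] sq_nonneg[of A "\<lambda>_. 0"] zero_car[of A] by simp

lemma pw_zero: "two_normed_space A \<Longrightarrow> pw A (\<lambda>_. 0) = 0"
  by (simp add: pw_eq_0 sq_zero zero_car)

lemma wt_nonneg: "two_normed_space A \<Longrightarrow> f \<in> car A \<Longrightarrow> 0 \<le> wt A f"
  by (simp add: wt_def pw_nonneg)

text \<open>The \<open>sq\<close> part reproduces the constant 2^p of the \<open>pw\<close> part: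
  raising \<open>sq_lc\<close> to the power p/2 costs 2^(p/2), and separating the two terms by
  \<open>powr_add_le\<close> costs 2^(p/2) again.\<close>

lemma wt_lc:
  assumes "two_normed_space A" "f \<in> car A" "g \<in> car A"
  shows "wt A (\<lambda>x. a * f x + b * g x) \<le> 2 powr p * (\<bar>a\<bar> powr p * wt A f + \<bar>b\<bar> powr p * wt A g)"
proof -
  have nn: "0 \<le> sq A f" "0 \<le> sq A g" using assms sq_nonneg by auto
  have sqp: "(c\<^sup>2 * s) powr (p/2) = \<bar>c\<bar> powr p * s powr (p/2)" if "0 \<le> s" for c s :: real
  proof -
    have "(c\<^sup>2 * s) powr (p/2) = (\<bar>c\<bar> powr 2) powr (p/2) * s powr (p/2)"
      using that by (simp add: powr_mult)
    also have "(\<bar>c\<bar> powr 2) powr (p/2) = \<bar>c\<bar> powr p" unfolding powr_powr by simp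
    finally show ?thesis .
  qed
  have "sq A (\<lambda>x. a * f x + b * g x) powr (p/2) \<le> (2 * (a\<^sup>2 * sq A f + b\<^sup>2 * sq A g)) powr (p/2)"
    using sq_lc[OF assms] sq_nonneg[OF assms(1) lc_car[OF assms]] p_gt_2 by (intro powr_mono2) auto
  also have "\<dots> = 2 powr (p/2) * (a\<^sup>2 * sq A f + b\<^sup>2 * sq A g) powr (p/2)"
    by (rule powr_mult)
  also have "\<dots> \<le> 2 powr (p/2) * (2 powr (p/2) * ((a\<^sup>2 * sq A f) powr (p/2) + (b\<^sup>2 * sq A g) powr (p/2)))"
    using nn p_gt_2 by (intro mult_left_mono powr_add_le) auto
  also have "\<dots> = 2 powr p * (\<bar>a\<bar> powr p * sq A f powr (p/2) + \<bar>b\<bar> powr p * sq A g powr (p/2))"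
    using nn by (simp add: sqp powr_add[symmetric] mult.assoc[symmetric])
  finally show ?thesis
    using pw_lc[OF assms, of a b] unfolding wt_def by (simp add: algebra_simps)
qed

lemma sq_add:
  assumes "two_normed_space A" "f \<in> car A" "g \<in> car A"
  shows "sq A (\<lambda>x. f x + g x) \<le> 2 * (sq A f + sq A g)"
  using sq_lc[OF assms, of 1 1] by simp

lemma pw_add:
  assumes "two_normed_space A" "f \<in> car A" "g \<in> car A"
  shows "pw A (\<lambda>x. f x + g x) \<le> 2 powr p * (pw A f + pw A g)"
  using pw_lc[OF assms, of 1 1] by simp

lemma wt_add:
  assumes "two_normed_space A" "f \<in> car A" "g \<in> car A"
  shows "wt A (\<lambda>x. f x + g x) \<le> 2 powr p * (wt A f + wt A g)"
  using wt_lc[OF assms, of 1 1] by simp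

lemma wt_diff:
  assumes "two_normed_space A" "f \<in> car A" "g \<in> car A"
  shows "wt A (\<lambda>x. f x - g x) \<le> 2 powr p * (wt A f + wt A g)"
  using wt_lc[OF assms, of 1 "-1"] by simp

text \<open>Limits are taken with respect to \<open>wt\<close> only; this carries them over to
  \<open>sq\<close>.\<close>

lemma sq_le_wt:
  assumes "two_normed_space A" "f \<in> car A"
  shows "sq A f \<le> wt A f powr (2 / p)"
proof -
  have "sq A f = (sq A f powr (p/2)) powr (2/p)"
    unfolding powr_powr using p_gt_2 sq_nonneg[OF assms] by simp
  also have "\<dots> \<le> wt A f powr (2/p)"
    unfolding wt_def using p_gt_2 pw_nonneg[OF assms] by (intro powr_mono2) auto
  finally show ?thesis .
qed

definition converges :: "'i two_normed \<Rightarrow> (nat \<Rightarrow> 'i \<Rightarrow> real) \<Rightarrow> ('i \<Rightarrow> real) \<Rightarrow> bool" where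
  "converges A u f \<longleftrightarrow> (\<lambda>n. wt A (\<lambda>x. u n x - f x)) \<longlonglongrightarrow> 0"

definition is_cauchy :: "'i two_normed \<Rightarrow> (nat \<Rightarrow> 'i \<Rightarrow> real) \<Rightarrow> bool" where
  "is_cauchy A u \<longleftrightarrow> (\<forall>\<epsilon>>0. \<exists>N. \<forall>m\<ge>N. \<forall>n\<ge>N. wt A (\<lambda>x. u m x - u n x) < \<epsilon>)"

definition is_complete :: "'i two_normed \<Rightarrow> bool" where
  "is_complete A \<longleftrightarrow>
     (\<forall>u. (\<forall>n. u n \<in> car A) \<longrightarrow> is_cauchy A u \<longrightarrow> (\<exists>f\<in>car A. converges A u f))"

text \<open>
  An isomorphism is given by a relation instead of a map: it is only determined up to null
  functions, and for relations inverses come for free and no representatives need to be chosen.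
\<close>

definition comparable ::
  "real \<Rightarrow> 'i two_normed \<Rightarrow> 'j two_normed \<Rightarrow> ('i \<Rightarrow> real) \<Rightarrow> ('j \<Rightarrow> real) \<Rightarrow> bool" where
  "comparable K A B f F \<longleftrightarrow>
     sq B F \<le> K * sq A f \<and> sq A f \<le> K * sq B F \<and> wt B F \<le> K * wt A f \<and> wt A f \<le> K * wt B F"

definition linear_relation ::
  "real \<Rightarrow> 'i two_normed \<Rightarrow> 'j two_normed \<Rightarrow> (('i \<Rightarrow> real) \<Rightarrow> ('j \<Rightarrow> real) \<Rightarrow> bool) \<Rightarrow> bool" where
  "linear_relation K A B D \<longleftrightarrow> 1 \<le> K \<and>
     (\<forall>f F. D f F \<longrightarrow> f \<in> car A \<and> F \<in> car B \<and> comparable K A B f F) \<and>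
     (\<forall>f F g G a b. D f F \<longrightarrow> D g G \<longrightarrow> D (\<lambda>x. a * f x + b * g x) (\<lambda>x. a * F x + b * G x))"

definition isomorphic :: "real \<Rightarrow> 'i two_normed \<Rightarrow> 'j two_normed \<Rightarrow> bool" where
  "isomorphic K A B \<longleftrightarrow> (\<exists>D. linear_relation K A B D \<and>
     (\<forall>f\<in>car A. \<exists>F. D f F) \<and> (\<forall>F\<in>car B. \<exists>f. D f F))"

lemma linear_relationI:
  assumes "1 \<le> K"
    and "\<And>f F. D f F \<Longrightarrow> f \<in> car A"
    and "\<And>f F. D f F \<Longrightarrow> F \<in> car B"
    and "\<And>f F. D f F \<Longrightarrow> comparable K A B f F"
    and "\<And>f F g G a b. D f F \<Longrightarrow> D g G \<Longrightarrow> D (\<lambda>x. a * f x + b * g x) (\<lambda>x. a * F x + b * G x)"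
  shows "linear_relation K A B D"
  using assms unfolding linear_relation_def by blast

lemma isoI:
  assumes "linear_relation K A B D" "\<And>f. f \<in> car A \<Longrightarrow> \<exists>F. D f F" "\<And>F. F \<in> car B \<Longrightarrow> \<exists>f. D f F"
  shows "isomorphic K A B"
  using assms unfolding isomorphic_def by blast

lemma isoE:
  assumes "isomorphic K A B"
  obtains D where "linear_relation K A B D" "\<And>f. f \<in> car A \<Longrightarrow> \<exists>F. D f F"
    "\<And>F. F \<in> car B \<Longrightarrow> \<exists>f. D f F"
  using assms unfolding isomorphic_def by blast

lemma iso_ge_1: "isomorphic K A B \<Longrightarrow> 1 \<le> K"
  unfolding isomorphic_def linear_relation_def by blast

text \<open>\<open>P\<close> may relate functions outside the carriers and may be many-to-many:
  functions on a direct sum are free to take any values off the index set, so the natural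
  correspondences are not bijective on functions. Agreement of membership and of both functionals
  along \<open>P\<close> is what counts.\<close>

lemma isometric_iso:
  assumes A: "two_normed_space A" and B: "two_normed_space B"
    and car: "\<And>f F. P f F \<Longrightarrow> f \<in> car A \<longleftrightarrow> F \<in> car B"
    and norms: "\<And>f F. P f F \<Longrightarrow> f \<in> car A \<Longrightarrow> pw A f = pw B F \<and> sq A f = sq B F"
    and lin: "\<And>f F g G a b. P f F \<Longrightarrow> P g G \<Longrightarrow> P (\<lambda>x. a * f x + b * g x) (\<lambda>x. a * F x + b * G x)"
    and total: "\<And>f. f \<in> car A \<Longrightarrow> \<exists>F. P f F" and onto: "\<And>F. F \<in> car B \<Longrightarrow> \<exists>f. P f F"
  shows "isomorphic 1 A B"
proof (rule isoI[where D = "\<lambda>f F. P f F \<and> f \<in> car A"])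
  show "linear_relation 1 A B (\<lambda>f F. P f F \<and> f \<in> car A)"
    using car norms lin lc_car[OF A]
    by (intro linear_relationI) (auto simp: comparable_def wt_def)
qed (use car total onto in blast)+

lemma iso_refl: "two_normed_space A \<Longrightarrow> isomorphic 1 A A"
  by (rule isometric_iso[where P = "(=)"]) auto

lemma iso_sym:
  assumes "isomorphic K A B" shows "isomorphic K B A"
proof -
  obtain D where "linear_relation K A B D" "\<And>f. f \<in> car A \<Longrightarrow> \<exists>F. D f F" "\<And>F. F \<in> car B \<Longrightarrow> \<exists>f. D f F"
    using assms by (rule isoE) blast
  then show ?thesis
    by (intro isoI[where D = "\<lambda>F f. D f F"])
      (auto simp: linear_relation_def comparable_def)
qed

lemma iso_trans:
  assumes "isomorphic K A B" "isomorphic L B C" shows "isomorphic (K * L) A C"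
proof -
  obtain D where D: "linear_relation K A B D" "\<And>f. f \<in> car A \<Longrightarrow> \<exists>F. D f F" "\<And>F. F \<in> car B \<Longrightarrow> \<exists>f. D f F"
    using assms(1) by (rule isoE) blast
  obtain E where E: "linear_relation L B C E" "\<And>f. f \<in> car B \<Longrightarrow> \<exists>F. E f F" "\<And>F. F \<in> car C \<Longrightarrow> \<exists>f. E f F"
    using assms(2) by (rule isoE) blast
  have KL: "1 \<le> K" "1 \<le> L" using D(1) E(1) by (auto simp: linear_relation_def)
  have chain: "z \<le> K * L * x" if "z \<le> L * y" "y \<le> K * x" for x y z :: real
    using order_trans[OF that(1) mult_left_mono[OF that(2), of L]] KL by (simp add: mult_ac)
  have chain': "z \<le> K * L * x" if "z \<le> K * y" "y \<le> L * x" for x y z :: real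
    using order_trans[OF that(1) mult_left_mono[OF that(2), of K]] KL by (simp add: mult_ac)
  show ?thesis
  proof (rule isoI[where D = "\<lambda>f H. \<exists>g. D f g \<and> E g H"])
    show "linear_relation (K * L) A C (\<lambda>f H. \<exists>g. D f g \<and> E g H)"
    proof (rule linear_relationI)
      show "1 \<le> K * L" using KL mult_mono[of 1 K 1 L] by simp
    next
      fix f H assume "\<exists>g. D f g \<and> E g H"
      then obtain g where "D f g" "E g H" by blast
      then have "comparable K A B f g" "comparable L B C g H" "f \<in> car A" "H \<in> car C"
        using D(1) E(1) unfolding linear_relation_def by blast+
      then show "comparable (K * L) A C f H" "f \<in> car A" "H \<in> car C"
        unfolding comparable_def by (auto intro: chain chain')
    next
      fix f H g G a b assume "\<exists>h. D f h \<and> E h H" "\<exists>h. D g h \<and> E h G"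
      then show "\<exists>h. D (\<lambda>x. a * f x + b * g x) h \<and> E h (\<lambda>x. a * H x + b * G x)"
        using D(1) E(1) unfolding linear_relation_def by blast
    qed
  next
    fix f assume "f \<in> car A"
    then obtain g where "D f g" using D by blast
    then have "g \<in> car B" using D(1) unfolding linear_relation_def by blast
    then show "\<exists>H g. D f g \<and> E g H" using E \<open>D f g\<close> by blast
  next
    fix H assume "H \<in> car C"
    then obtain g where "E g H" using E by blast
    then have "g \<in> car B" using E(1) unfolding linear_relation_def by blast
    then show "\<exists>f g. D f g \<and> E g H" using D \<open>E g H\<close> by blast
  qed
qed

subsection \<open>Extension by density\<close>

lemma converges_lc:
  assumes A: "two_normed_space A" and "\<And>n. u n \<in> car A" "\<And>n. v n \<in> car A" "f \<in> car A" "g \<in> car A"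
    and "converges A u f" "converges A v g"
  shows "converges A (\<lambda>n x. a * u n x + b * v n x) (\<lambda>x. a * f x + b * g x)"
  unfolding converges_def
proof (rule tendsto_sandwich)
  have d: "(\<lambda>x. u n x - f x) \<in> car A" "(\<lambda>x. v n x - g x) \<in> car A" for n
    using assms by (auto intro: diff_car)
  have eq: "(\<lambda>x. a * u n x + b * v n x - (a * f x + b * g x))
      = (\<lambda>x. a * (u n x - f x) + b * (v n x - g x))" for n
    by (auto simp: algebra_simps)
  show "\<forall>\<^sub>F n in sequentially. 0 \<le> wt A (\<lambda>x. a * u n x + b * v n x - (a * f x + b * g x))"
    unfolding eq using d by (intro always_eventually allI wt_nonneg A lc_car)
  show "\<forall>\<^sub>F n in sequentially. wt A (\<lambda>x. a * u n x + b * v n x - (a * f x + b * g x))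
     \<le> 2 powr p * (\<bar>a\<bar> powr p * wt A (\<lambda>x. u n x - f x) + \<bar>b\<bar> powr p * wt A (\<lambda>x. v n x - g x))"
    unfolding eq using d by (intro always_eventually allI wt_lc A)
  have "(\<lambda>n. 2 powr p * (\<bar>a\<bar> powr p * wt A (\<lambda>x. u n x - f x) + \<bar>b\<bar> powr p * wt A (\<lambda>x. v n x - g x)))
     \<longlonglongrightarrow> 2 powr p * (\<bar>a\<bar> powr p * 0 + \<bar>b\<bar> powr p * 0)"
    using assms(6,7) unfolding converges_def by (intro tendsto_intros)
  then show "(\<lambda>n. 2 powr p * (\<bar>a\<bar> powr p * wt A (\<lambda>x. u n x - f x) + \<bar>b\<bar> powr p * wt A (\<lambda>x. v n x - g x)))
     \<longlonglongrightarrow> 0" by simp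
qed simp

lemma converges_sq:
  assumes A: "two_normed_space A" and "\<And>n. u n \<in> car A" "f \<in> car A" and "converges A u f"
  shows "(\<lambda>n. sq A (\<lambda>x. u n x - f x)) \<longlonglongrightarrow> 0"
proof (rule tendsto_sandwich)
  have d: "(\<lambda>x. u n x - f x) \<in> car A" for n
    using assms by (auto intro: diff_car)
  show "\<forall>\<^sub>F n in sequentially. 0 \<le> sq A (\<lambda>x. u n x - f x)"
    using d by (intro always_eventually allI sq_nonneg A)
  show "\<forall>\<^sub>F n in sequentially. sq A (\<lambda>x. u n x - f x) \<le> wt A (\<lambda>x. u n x - f x) powr (2 / p)"
    using d by (intro always_eventually allI sq_le_wt A)
  show "(\<lambda>n. wt A (\<lambda>x. u n x - f x) powr (2 / p)) \<longlonglongrightarrow> 0"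
    using assms(4) p_gt_2 wt_nonneg[OF A d] unfolding converges_def
    by (intro tendsto_zero_powrI) (auto intro!: tendsto_const)
qed simp

lemma converges_is_cauchy:
  assumes A: "two_normed_space A" and u: "\<And>n. u n \<in> car A" and f: "f \<in> car A" and "converges A u f"
  shows "is_cauchy A u"
  unfolding is_cauchy_def
proof (intro allI impI)
  fix \<epsilon> :: real assume "0 < \<epsilon>"
  define \<delta> where "\<delta> = \<epsilon> / (2 * 2 powr p)"
  have "0 < \<delta>" unfolding \<delta>_def using \<open>0 < \<epsilon>\<close> by simp
  have d: "(\<lambda>x. u n x - f x) \<in> car A" for n
    using assms by (auto intro: diff_car)
  from \<open>0 < \<delta>\<close> obtain N where N: "\<And>n. n \<ge> N \<Longrightarrow> wt A (\<lambda>x. u n x - f x) < \<delta>"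
    using assms(4) order_tendstoD(2)[of _ 0 sequentially \<delta>]
    unfolding converges_def eventually_sequentially by blast
  have "wt A (\<lambda>x. u m x - u n x) < \<epsilon>" if "m \<ge> N" "n \<ge> N" for m n
  proof -
    have "wt A (\<lambda>x. u m x - u n x) = wt A (\<lambda>x. (u m x - f x) - (u n x - f x))" by simp
    also have "\<dots> \<le> 2 powr p * (wt A (\<lambda>x. u m x - f x) + wt A (\<lambda>x. u n x - f x))"
      using d by (intro wt_diff A)
    also have "\<dots> < 2 powr p * (\<delta> + \<delta>)"
      using N that by (intro mult_strict_left_mono add_strict_mono) auto
    also have "\<dots> = \<epsilon>" unfolding \<delta>_def by (simp add: field_simps)
    finally show ?thesis .
  qed
  then show "\<exists>N. \<forall>m\<ge>N. \<forall>n\<ge>N. wt A (\<lambda>x. u m x - u n x) < \<epsilon>" by blast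
qed

text \<open>Passing from f to u_n and from v_n back to F each costs one quasi-triangle inequality,
  hence 2^p twice, which is the 4^p. For \<open>sq\<close> the cost is 2 * 2, which 4^p also
  covers.\<close>

lemma limit_comparison:
  assumes A: "two_normed_space A" and B: "two_normed_space B" and K: "1 \<le> K"
    and u: "\<And>n. u n \<in> car A" "f \<in> car A" "converges A u f"
    and v: "\<And>n. v n \<in> car B" "F \<in> car B" "converges B v F"
    and le: "\<And>n. sq A (u n) \<le> K * sq B (v n)" "\<And>n. wt A (u n) \<le> K * wt B (v n)"
  shows "sq A f \<le> (4 powr p * K) * sq B F" "wt A f \<le> (4 powr p * K) * wt B F"
proof -
  have d: "(\<lambda>x. u n x - f x) \<in> car A" "(\<lambda>x. v n x - F x) \<in> car B" for n
    using assms by (auto intro: diff_car)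
  have p2: "2 \<le> (2::real) powr p"
    using p_gt_2 powr_mono[of 1 p "2::real"] by simp
  have p4: "(4::real) powr p = 2 powr p * 2 powr p"
    by (simp add: powr_mult[symmetric])
  have *: "wt A f \<le> 2 powr p * (K * (2 powr p * (wt B (\<lambda>x. v n x - F x) + wt B F)) + wt A (\<lambda>x. u n x - f x))" for n
  proof -
    have "wt A f = wt A (\<lambda>x. u n x - (u n x - f x))" by simp
    also have "\<dots> \<le> 2 powr p * (wt A (u n) + wt A (\<lambda>x. u n x - f x))"
      using d u by (intro wt_diff A)
    also have "wt A (u n) \<le> K * wt B (v n)" by (rule le)
    also have "wt B (v n) = wt B (\<lambda>x. (v n x - F x) + F x)" by simp
    also have "\<dots> \<le> 2 powr p * (wt B (\<lambda>x. v n x - F x) + wt B F)"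
      using d v by (intro wt_add B)
    finally show ?thesis using K by (simp add: mult_left_mono)
  qed
  have "(\<lambda>n. 2 powr p * (K * (2 powr p * (wt B (\<lambda>x. v n x - F x) + wt B F)) + wt A (\<lambda>x. u n x - f x)))
     \<longlonglongrightarrow> 2 powr p * (K * (2 powr p * (0 + wt B F)) + 0)"
    using u(3) v(3) unfolding converges_def by (intro tendsto_intros)
  from LIMSEQ_le_const[OF this] show "wt A f \<le> (4 powr p * K) * wt B F"
    using * unfolding p4 by (auto simp: mult_ac)
  have *: "sq A f \<le> 2 * (K * (2 * (sq B (\<lambda>x. v n x - F x) + sq B F)) + sq A (\<lambda>x. u n x - f x))" for n
  proof -
    have "sq A f = sq A (\<lambda>x. 1 * u n x + (-1) * (u n x - f x))" by simp
    also have "\<dots> \<le> 2 * (1\<^sup>2 * sq A (u n) + (-1)\<^sup>2 * sq A (\<lambda>x. u n x - f x))"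
      using d u by (intro sq_lc A)
    also have "\<dots> = 2 * (sq A (u n) + sq A (\<lambda>x. u n x - f x))" by simp
    also have "sq A (u n) \<le> K * sq B (v n)" by (rule le)
    also have "sq B (v n) = sq B (\<lambda>x. (v n x - F x) + F x)" by simp
    also have "\<dots> \<le> 2 * (sq B (\<lambda>x. v n x - F x) + sq B F)"
      using d v by (intro sq_add B)
    finally show ?thesis using K by (simp add: mult_left_mono)
  qed
  have "(\<lambda>n. 2 * (K * (2 * (sq B (\<lambda>x. v n x - F x) + sq B F)) + sq A (\<lambda>x. u n x - f x)))
     \<longlonglongrightarrow> 2 * (K * (2 * (0 + sq B F)) + 0)"
    using converges_sq[OF A u] converges_sq[OF B v] by (intro tendsto_intros)
  from LIMSEQ_le_const[OF this] have "sq A f \<le> (2 * 2) * (K * sq B F)"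
    using * by (auto simp: mult_ac)
  also have "\<dots> \<le> (2 powr p * 2 powr p) * (K * sq B F)"
    using p2 K sq_nonneg[OF B v(2)] by (intro mult_right_mono mult_mono) auto
  finally show "sq A f \<le> (4 powr p * K) * sq B F" unfolding p4 by (simp add: mult_ac)
qed

lemma dense_sequence:
  assumes "\<And>\<epsilon>. 0 < \<epsilon> \<Longrightarrow> \<exists>g. Q g \<and> wt A (\<lambda>x. g x - f x) < \<epsilon>" "\<And>g. Q g \<Longrightarrow> 0 \<le> wt A (\<lambda>x. g x - f x)"
  obtains u where "\<And>n. Q (u n)" "converges A u f"
proof -
  have "\<forall>n. \<exists>g. Q g \<and> wt A (\<lambda>x. g x - f x) < inverse (real (Suc n))"
    using assms(1) by auto
  then obtain u where u: "\<And>n. Q (u n)" "\<And>n. wt A (\<lambda>x. u n x - f x) < inverse (real (Suc n))"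
    by metis
  have "converges A u f"
    unfolding converges_def
    by (rule tendsto_sandwich[OF _ _ tendsto_const LIMSEQ_inverse_real_of_nat])
      (use assms(2) u less_imp_le[OF u(2)] in \<open>auto intro!: always_eventually simp del: of_nat_Suc\<close>)
  then show thesis using that u by blast
qed

lemma cauchy_transfer:
  assumes D: "linear_relation K A B D" and uv: "\<And>n. D (u n) (v n)" and u: "is_cauchy A u"
  shows "is_cauchy B v"
  unfolding is_cauchy_def
proof (intro allI impI)
  fix \<epsilon> :: real assume "0 < \<epsilon>"
  have K: "1 \<le> K" using D by (simp add: linear_relation_def)
  obtain N where N: "\<And>m n. m \<ge> N \<Longrightarrow> n \<ge> N \<Longrightarrow> wt A (\<lambda>x. u m x - u n x) < \<epsilon> / K"
    using u K \<open>0 < \<epsilon>\<close> unfolding is_cauchy_def by (metis divide_pos_pos less_le_trans zero_less_one)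
  have "wt B (\<lambda>x. v m x - v n x) < \<epsilon>" if "m \<ge> N" "n \<ge> N" for m n
  proof -
    have "D (\<lambda>x. 1 * u m x + (-1) * u n x) (\<lambda>x. 1 * v m x + (-1) * v n x)"
      using D uv unfolding linear_relation_def by blast
    then have "wt B (\<lambda>x. v m x - v n x) \<le> K * wt A (\<lambda>x. u m x - u n x)"
      using D unfolding linear_relation_def comparable_def by simp
    also have "\<dots> < K * (\<epsilon> / K)" using N[OF that] K by (intro mult_strict_left_mono) auto
    finally show ?thesis using K by simp
  qed
  then show "\<exists>N. \<forall>m\<ge>N. \<forall>n\<ge>N. wt B (\<lambda>x. v m x - v n x) < \<epsilon>" by blast
qed

lemma linear_relation_converse:
  "linear_relation K A B D \<Longrightarrow> linear_relation K B A (\<lambda>F f. D f F)"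
  unfolding linear_relation_def comparable_def by blast

text \<open>The closure of the graph of \<open>D\<close> is the graph of the extension. A sequence
  approximating f is Cauchy, comparability makes its partners Cauchy, and completeness of the other
  space supplies the partner of f. With density on both sides the argument is symmetric, so
  surjectivity needs no separate idea.\<close>

lemma iso_from_dense:
  assumes A: "two_normed_space A" "is_complete A" and B: "two_normed_space B" "is_complete B"
    and D: "linear_relation K A B D"
    and dA: "\<And>f \<epsilon>. f \<in> car A \<Longrightarrow> 0 < \<epsilon> \<Longrightarrow> \<exists>g G. D g G \<and> wt A (\<lambda>x. g x - f x) < \<epsilon>"
    and dB: "\<And>F \<epsilon>. F \<in> car B \<Longrightarrow> 0 < \<epsilon> \<Longrightarrow> \<exists>g G. D g G \<and> wt B (\<lambda>x. G x - F x) < \<epsilon>"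
  shows "isomorphic (4 powr p * K) A B"
proof -
  define E where "E f F \<longleftrightarrow> f \<in> car A \<and> F \<in> car B \<and>
    (\<exists>u v. (\<forall>n. D (u n) (v n)) \<and> converges A u f \<and> converges B v F)" for f F
  have K: "1 \<le> K" using D by (simp add: linear_relation_def)
  have Dcar: "f \<in> car A" "F \<in> car B" if "D f F" for f F
    using D that unfolding linear_relation_def by blast+
  have Dcomp: "comparable K A B f F" if "D f F" for f F
    using D that unfolding linear_relation_def by blast
  show ?thesis
  proof (rule isoI[where D = E])
    show "linear_relation (4 powr p * K) A B E"
    proof (rule linear_relationI)
      show "1 \<le> 4 powr p * K"
        using K p_gt_2 mult_mono[of 1 "4 powr p" 1 K] ge_one_powr_ge_zero[of 4 p] by simp
    next
      fix f F assume "E f F"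
      then show "f \<in> car A" "F \<in> car B" by (auto simp: E_def)
      obtain u v where uv: "\<And>n. D (u n) (v n)" "converges A u f" "converges B v F"
        using \<open>E f F\<close> unfolding E_def by blast
      note c = Dcomp[OF uv(1), unfolded comparable_def]
      show "comparable (4 powr p * K) A B f F"
        unfolding comparable_def
        using limit_comparison[OF A(1) B(1) K Dcar(1)[OF uv(1)] \<open>f \<in> car A\<close> uv(2) Dcar(2)[OF uv(1)] \<open>F \<in> car B\<close> uv(3)]
          limit_comparison[OF B(1) A(1) K Dcar(2)[OF uv(1)] \<open>F \<in> car B\<close> uv(3) Dcar(1)[OF uv(1)] \<open>f \<in> car A\<close> uv(2)] c
        by blast
    next
      fix f F g G a b assume E: "E f F" "E g G"
      obtain u v where uv: "\<And>n. D (u n) (v n)" "converges A u f" "converges B v F"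
        using E(1) unfolding E_def by blast
      obtain u' v' where uv': "\<And>n. D (u' n) (v' n)" "converges A u' g" "converges B v' G"
        using E(2) unfolding E_def by blast
      have cars: "f \<in> car A" "g \<in> car A" "F \<in> car B" "G \<in> car B" using E by (auto simp: E_def)
      have "D (\<lambda>x. a * u n x + b * u' n x) (\<lambda>x. a * v n x + b * v' n x)" for n
        using D uv(1) uv'(1) unfolding linear_relation_def by blast
      moreover have "converges A (\<lambda>n x. a * u n x + b * u' n x) (\<lambda>x. a * f x + b * g x)"
        using cars uv uv' Dcar by (intro converges_lc A) blast+
      moreover have "converges B (\<lambda>n x. a * v n x + b * v' n x) (\<lambda>x. a * F x + b * G x)"
        using cars uv uv' Dcar by (intro converges_lc B) blast+
      moreover have "(\<lambda>x. a * f x + b * g x) \<in> car A" "(\<lambda>x. a * F x + b * G x) \<in> car B"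
        using cars A B by (auto intro: lc_car)
      ultimately show "E (\<lambda>x. a * f x + b * g x) (\<lambda>x. a * F x + b * G x)"
        unfolding E_def
        by (intro conjI exI[where x="\<lambda>n x. a * u n x + b * u' n x"]
            exI[where x="\<lambda>n x. a * v n x + b * v' n x"] allI)
    qed
  next
    fix f assume f: "f \<in> car A"
    obtain u where u: "\<And>n. \<exists>G. D (u n) G" "converges A u f"
      by (rule dense_sequence[of "\<lambda>g. \<exists>G. D g G" A f])
        (use dA[OF f] f Dcar A(1) in \<open>auto intro!: wt_nonneg diff_car\<close>)
    then obtain v where v: "\<And>n. D (u n) (v n)" by metis
    have "is_cauchy A u" using converges_is_cauchy[OF A(1) _ f u(2)] Dcar v by blast
    then have "is_cauchy B v" using cauchy_transfer[OF D] v by blast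
    then obtain F where "F \<in> car B" "converges B v F"
      using B(2) Dcar(2)[OF v] unfolding is_complete_def by blast
    then show "\<exists>F. E f F" unfolding E_def using f u(2) v by blast
  next
    fix F assume F: "F \<in> car B"
    have "\<exists>G. (\<exists>g. D g G) \<and> wt B (\<lambda>x. G x - F x) < \<epsilon>" if "0 < \<epsilon>" for \<epsilon>
      using dB[OF F that] by blast
    then obtain v where v: "\<And>n. \<exists>g. D g (v n)" "converges B v F"
      by (rule dense_sequence[of "\<lambda>G. \<exists>g. D g G" B F])
        (use F Dcar B(1) in \<open>auto intro!: wt_nonneg diff_car\<close>)
    then obtain u where u: "\<And>n. D (u n) (v n)" by metis
    have "is_cauchy B v" using converges_is_cauchy[OF B(1) _ F v(2)] Dcar u by blast
    then have "is_cauchy A u" using cauchy_transfer[OF linear_relation_converse[OF D]] u by blast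
    then obtain f where "f \<in> car A" "converges A u f"
      using A(2) Dcar(1)[OF u] unfolding is_complete_def by blast
    then show "\<exists>f. E f F" unfolding E_def using F v(2) u by blast
  qed
qed

end

section \<open>Direct sums\<close>

lemma nonneg_summable_on_comparison:
  fixes f g :: "'a \<Rightarrow> real"
  assumes "g summable_on A" "\<And>x. x \<in> A \<Longrightarrow> 0 \<le> f x" "\<And>x. x \<in> A \<Longrightarrow> f x \<le> g x"
  shows "f summable_on A"
proof (rule nonneg_bdd_above_summable_on)
  show "bdd_above (sum f ` {F. F \<subseteq> A \<and> finite F})"
  proof (rule bdd_aboveI2)
    fix F assume F: "F \<in> {F. F \<subseteq> A \<and> finite F}"
    then have "sum f F \<le> sum g F" using assms by (intro sum_mono) auto
    also have "\<dots> \<le> infsum g A"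
      using F assms order_trans by (intro finite_sum_le_infsum) (auto intro: order_trans)
    finally show "sum f F \<le> infsum g A" .
  qed
qed (use assms in auto)

lemma nonneg_infsum_bound:
  fixes f :: "'a \<Rightarrow> real"
  assumes "\<And>x. x \<in> A \<Longrightarrow> 0 \<le> f x" "\<And>F. finite F \<Longrightarrow> F \<subseteq> A \<Longrightarrow> sum f F \<le> C"
  shows "f summable_on A" "infsum f A \<le> C"
proof -
  show "f summable_on A"
    using assms by (intro nonneg_bdd_above_summable_on bdd_aboveI2[where M = C]) auto
  then show "infsum f A \<le> C"
    using assms(2) by (rule infsum_le_finite_sums)
qed

text \<open>Each term is at most the total S, so f(x)^r is at most f(x) * S^(r-1), and this sums to
  S^r.\<close>

lemma infsum_powr_le:
  fixes f :: "'a \<Rightarrow> real"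
  assumes "f summable_on A" "\<And>x. x \<in> A \<Longrightarrow> 0 \<le> f x" "1 \<le> r"
  shows "(\<lambda>x. f x powr r) summable_on A" "(\<Sum>\<^sub>\<infinity>x\<in>A. f x powr r) \<le> infsum f A powr r"
proof -
  let ?S = "infsum f A"
  have S: "0 \<le> ?S" using assms by (auto intro: infsum_nonneg)
  have split: "s powr r = s * s powr (r - 1)" if "0 \<le> s" for s
    using that powr_add[of s 1 "r - 1"] by simp
  have le: "f x powr r \<le> f x * ?S powr (r - 1)" if x: "x \<in> A" for x
  proof -
    have "sum f {x} \<le> ?S" using assms x by (intro finite_sum_le_infsum) auto
    then show ?thesis using assms x by (auto simp: split intro!: mult_left_mono powr_mono2)
  qed
  have sm: "(\<lambda>x. f x * ?S powr (r - 1)) summable_on A"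
    using assms(1) by (rule summable_on_cmult_left)
  show 1: "(\<lambda>x. f x powr r) summable_on A"
    using sm by (rule nonneg_summable_on_comparison) (use le in auto)
  have "(\<Sum>\<^sub>\<infinity>x\<in>A. f x powr r) \<le> (\<Sum>\<^sub>\<infinity>x\<in>A. f x * ?S powr (r - 1))"
    using 1 sm le by (intro infsum_mono)
  also have "\<dots> = ?S powr r" using assms(1) S by (simp add: infsum_cmult_left split)
  finally show "(\<Sum>\<^sub>\<infinity>x\<in>A. f x powr r) \<le> ?S powr r" .
qed

text \<open>The bound is claimed for every larger set G so that the finite sets found for two
  different families can be united.\<close>

lemma infsum_remainder_small:
  fixes f :: "'a \<Rightarrow> real"
  assumes f: "f summable_on A" and nn: "\<And>x. x \<in> A \<Longrightarrow> 0 \<le> f x" and "0 < \<epsilon>"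
  obtains F where "finite F" "F \<subseteq> A"
    "\<And>G. F \<subseteq> G \<Longrightarrow> G \<subseteq> A \<Longrightarrow> f summable_on (A - G) \<and> infsum f (A - G) < \<epsilon>"
proof -
  obtain F where F: "finite F" "F \<subseteq> A" "dist (sum f F) (infsum f A) \<le> \<epsilon> / 2"
    using infsum_finite_approximation[OF f, of "\<epsilon> / 2"] \<open>0 < \<epsilon>\<close> by auto
  have "f summable_on (A - G) \<and> infsum f (A - G) < \<epsilon>" if "F \<subseteq> G" "G \<subseteq> A" for G
  proof
    show s: "f summable_on (A - G)" by (rule summable_on_subset_banach[OF f]) auto
    have "infsum f (A - G) \<le> infsum f (A - F)"
      using that nn s summable_on_subset_banach[OF f, of "A - F"]
      by (intro infsum_mono2) auto
    also have "infsum f (A - F) = infsum f A - sum f F"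
      using infsum_Un_disjoint[of f F "A - F"] F summable_on_subset_banach[OF f, of "A - F"]
      by (simp add: Un_absorb1)
    also have "\<dots> < \<epsilon>" using F(3) \<open>0 < \<epsilon>\<close> unfolding dist_real_def by linarith
    finally show "infsum f (A - G) < \<epsilon>" .
  qed
  then show thesis using that F by blast
qed

lemma infsum_nonneg_Sigma:
  fixes f :: "'a \<times> 'b \<Rightarrow> real"
  assumes nn: "\<And>i j. i \<in> I \<Longrightarrow> j \<in> J i \<Longrightarrow> 0 \<le> f (i, j)"
  shows "f summable_on (Sigma I J) \<longleftrightarrow>
      (\<forall>i\<in>I. (\<lambda>j. f (i, j)) summable_on J i) \<and> (\<lambda>i. \<Sum>\<^sub>\<infinity>j\<in>J i. f (i, j)) summable_on I"
    and "f summable_on (Sigma I J) \<Longrightarrow>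
      infsum f (Sigma I J) = (\<Sum>\<^sub>\<infinity>i\<in>I. \<Sum>\<^sub>\<infinity>j\<in>J i. f (i, j))"
proof -
  have abs1: "norm (f z) = f z" if "z \<in> Sigma I J" for z using that nn by auto
  have abs2: "norm (\<Sum>\<^sub>\<infinity>j\<in>J i. norm (f (i, j))) = (\<Sum>\<^sub>\<infinity>j\<in>J i. f (i, j))" if "i \<in> I" for i
    using that nn by (auto simp: infsum_nonneg cong: infsum_cong)
  have "f summable_on (Sigma I J) \<longleftrightarrow> (\<lambda>z. norm (f z)) summable_on (Sigma I J)"
    by (rule summable_on_cong) (use abs1 in auto)
  also have "\<dots> \<longleftrightarrow> (\<forall>i\<in>I. (\<lambda>j. norm (f (i, j))) summable_on J i) \<and>
      (\<lambda>i. norm (\<Sum>\<^sub>\<infinity>j\<in>J i. norm (f (i, j)))) summable_on I"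
    by (rule Infinite_Sum.abs_summable_on_Sigma_iff[where f = f and A = I and B = J])
  also have "\<dots> \<longleftrightarrow> (\<forall>i\<in>I. (\<lambda>j. f (i, j)) summable_on J i) \<and> (\<lambda>i. \<Sum>\<^sub>\<infinity>j\<in>J i. f (i, j)) summable_on I"
    using abs2 nn by (intro conj_cong ball_cong summable_on_cong) (auto intro!: summable_on_cong)
  finally show "f summable_on (Sigma I J) \<longleftrightarrow>
      (\<forall>i\<in>I. (\<lambda>j. f (i, j)) summable_on J i) \<and> (\<lambda>i. \<Sum>\<^sub>\<infinity>j\<in>J i. f (i, j)) summable_on I" .
  show "infsum f (Sigma I J) = (\<Sum>\<^sub>\<infinity>i\<in>I. \<Sum>\<^sub>\<infinity>j\<in>J i. f (i, j))" if "f summable_on (Sigma I J)"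
    by (rule infsum_Sigma_banach[OF that, symmetric])
qed

context exponent
begin

text \<open>The p-sum for the L_p norms and, at the same time, the 2-sum for the L_2 norms. The
  values of f at indices outside \<open>I\<close> are arbitrary and ignored, so one element has many
  representing functions.\<close>

definition dsum :: "'k set \<Rightarrow> ('k \<Rightarrow> 'i two_normed) \<Rightarrow> ('k \<times> 'i) two_normed" where
  "dsum I X =
    \<lparr>car = {f. (\<forall>i\<in>I. (\<lambda>x. f (i, x)) \<in> car (X i)) \<and>
        (\<lambda>i. pw (X i) (\<lambda>x. f (i, x))) summable_on I \<and>
        (\<lambda>i. sq (X i) (\<lambda>x. f (i, x))) summable_on I},
     pw = (\<lambda>f. \<Sum>\<^sub>\<infinity>i\<in>I. pw (X i) (\<lambda>x. f (i, x))),
     sq = (\<lambda>f. \<Sum>\<^sub>\<infinity>i\<in>I. sq (X i) (\<lambda>x. f (i, x)))\<rparr>"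

lemma in_dsum: "f \<in> car (dsum I X) \<longleftrightarrow> (\<forall>i\<in>I. (\<lambda>x. f (i, x)) \<in> car (X i)) \<and>
        (\<lambda>i. pw (X i) (\<lambda>x. f (i, x))) summable_on I \<and>
        (\<lambda>i. sq (X i) (\<lambda>x. f (i, x))) summable_on I"
  and pw_dsum: "pw (dsum I X) f = (\<Sum>\<^sub>\<infinity>i\<in>I. pw (X i) (\<lambda>x. f (i, x)))"
  and sq_dsum: "sq (dsum I X) f = (\<Sum>\<^sub>\<infinity>i\<in>I. sq (X i) (\<lambda>x. f (i, x)))"
  by (simp_all add: dsum_def)

lemma in_dsum_finite:
  "finite I \<Longrightarrow> f \<in> car (dsum I X) \<longleftrightarrow> (\<forall>i\<in>I. (\<lambda>x. f (i, x)) \<in> car (X i))"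
  by (simp add: in_dsum)

lemma two_normed_space_dsum:
  assumes X: "\<And>i. i \<in> I \<Longrightarrow> two_normed_space (X i)"
  shows "two_normed_space (dsum I X)"
proof -
  have lc: "(\<lambda>x. a * f x + b * g x) \<in> car (dsum I X) \<and>
      sq (dsum I X) (\<lambda>x. a * f x + b * g x) \<le> 2 * (a\<^sup>2 * sq (dsum I X) f + b\<^sup>2 * sq (dsum I X) g) \<and>
      pw (dsum I X) (\<lambda>x. a * f x + b * g x)
        \<le> 2 powr p * (\<bar>a\<bar> powr p * pw (dsum I X) f + \<bar>b\<bar> powr p * pw (dsum I X) g)"
    if f: "f \<in> car (dsum I X)" and g: "g \<in> car (dsum I X)" for f g a b
  proof -
    let ?h = "\<lambda>i x. a * f (i, x) + b * g (i, x)"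
    have fi: "(\<lambda>x. f (i, x)) \<in> car (X i)" and gi: "(\<lambda>x. g (i, x)) \<in> car (X i)" if "i \<in> I" for i
      using that f g by (auto simp: in_dsum)
    have hi: "?h i \<in> car (X i)" if "i \<in> I" for i
      by (intro lc_car X fi gi that)
    have sums: "(\<lambda>i. pw (X i) (\<lambda>x. f (i, x))) summable_on I" "(\<lambda>i. sq (X i) (\<lambda>x. f (i, x))) summable_on I"
      "(\<lambda>i. pw (X i) (\<lambda>x. g (i, x))) summable_on I" "(\<lambda>i. sq (X i) (\<lambda>x. g (i, x))) summable_on I"
      using f g by (auto simp: in_dsum)
    have s1: "(\<lambda>i. 2 * (a\<^sup>2 * sq (X i) (\<lambda>x. f (i, x)) + b\<^sup>2 * sq (X i) (\<lambda>x. g (i, x)))) summable_on I"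
      by (intro summable_on_cmult_right summable_on_add sums)
    have e1: "(\<Sum>\<^sub>\<infinity>i\<in>I. 2 * (a\<^sup>2 * sq (X i) (\<lambda>x. f (i, x)) + b\<^sup>2 * sq (X i) (\<lambda>x. g (i, x))))
        = 2 * (a\<^sup>2 * sq (dsum I X) f + b\<^sup>2 * sq (dsum I X) g)"
      unfolding sq_dsum
      by (simp add: infsum_cmult_right sums summable_on_cmult_right summable_on_add infsum_add)
    have s2: "(\<lambda>i. 2 powr p * (\<bar>a\<bar> powr p * pw (X i) (\<lambda>x. f (i, x)) + \<bar>b\<bar> powr p * pw (X i) (\<lambda>x. g (i, x)))) summable_on I"
      by (intro summable_on_cmult_right summable_on_add sums)
    have e2: "(\<Sum>\<^sub>\<infinity>i\<in>I. 2 powr p * (\<bar>a\<bar> powr p * pw (X i) (\<lambda>x. f (i, x)) + \<bar>b\<bar> powr p * pw (X i) (\<lambda>x. g (i, x))))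
        = 2 powr p * (\<bar>a\<bar> powr p * pw (dsum I X) f + \<bar>b\<bar> powr p * pw (dsum I X) g)"
      unfolding pw_dsum
      by (simp add: infsum_cmult_right sums summable_on_cmult_right summable_on_add infsum_add)
    have l1: "sq (X i) (?h i) \<le> 2 * (a\<^sup>2 * sq (X i) (\<lambda>x. f (i, x)) + b\<^sup>2 * sq (X i) (\<lambda>x. g (i, x)))" if "i \<in> I" for i
      by (rule sq_lc[OF X[OF that] fi[OF that] gi[OF that]])
    have l2: "pw (X i) (?h i) \<le> 2 powr p * (\<bar>a\<bar> powr p * pw (X i) (\<lambda>x. f (i, x)) + \<bar>b\<bar> powr p * pw (X i) (\<lambda>x. g (i, x)))" if "i \<in> I" for i
      by (rule pw_lc[OF X[OF that] fi[OF that] gi[OF that]])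
    have t1: "(\<lambda>i. sq (X i) (?h i)) summable_on I"
      by (rule nonneg_summable_on_comparison[OF s1 sq_nonneg[OF X hi] l1])
    have t2: "(\<lambda>i. pw (X i) (?h i)) summable_on I"
      by (rule nonneg_summable_on_comparison[OF s2 pw_nonneg[OF X hi] l2])
    show ?thesis
      using hi t1 t2 infsum_mono[OF t1 s1 l1] infsum_mono[OF t2 s2 l2]
      unfolding e1 e2 in_dsum by (simp add: pw_dsum sq_dsum)
  qed
  have nn: "0 \<le> pw (dsum I X) f" "0 \<le> sq (dsum I X) f" if "f \<in> car (dsum I X)" for f
    using that X by (auto simp: in_dsum pw_dsum sq_dsum intro!: infsum_nonneg pw_nonneg sq_nonneg)
  have z: "pw (dsum I X) f = 0" if f: "f \<in> car (dsum I X)" and "sq (dsum I X) f = 0" for f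
  proof -
    have "sq (X i) (\<lambda>x. f (i, x)) = 0" if "i \<in> I" for i
      using nonneg_infsum_le_0D[of "\<lambda>i. sq (X i) (\<lambda>x. f (i, x))" I i]
        \<open>sq (dsum I X) f = 0\<close> f X that by (auto simp: in_dsum sq_dsum sq_nonneg)
    then show ?thesis
      using f X by (auto simp: in_dsum pw_dsum pw_eq_0 intro!: infsum_0)
  qed
  have 0: "(\<lambda>_. 0) \<in> car (dsum I X)"
    using X by (auto simp: in_dsum zero_car pw_zero sq_zero cong: summable_on_cong)
  show ?thesis
    unfolding two_normed_space_def using 0 lc nn z by blast
qed

text \<open>In each summand \<open>pw\<close> of the image is bounded only by \<open>wt\<close>,
  that is, with an extra term sq^(p/2). Since p/2 \<ge> 1, these extra terms add up to at most
  (\<Sum> sq)^(p/2), which is part of the \<open>wt\<close> of the whole sum. The constant collects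
  K from \<open>pw\<close> and K^(p/2) from raising the \<open>sq\<close> estimate to the power
  p/2.\<close>

lemma dsum_cong:
  assumes X: "\<And>i. i \<in> I \<Longrightarrow> two_normed_space (X i)" and Y: "\<And>i. i \<in> I \<Longrightarrow> two_normed_space (Y i)"
    and iso: "\<And>i. i \<in> I \<Longrightarrow> isomorphic K (X i) (Y i)" and K: "1 \<le> K"
  shows "isomorphic (K + K powr (p / 2)) (dsum I X) (dsum I Y)"
proof -
  define L where "L = K + K powr (p / 2)"
  have L: "1 \<le> L" "K \<le> L" unfolding L_def using K powr_ge_zero[of K "p / 2"] by linarith+
  have "\<forall>i\<in>I. \<exists>D. linear_relation K (X i) (Y i) D \<and>
     (\<forall>f\<in>car (X i). \<exists>F. D f F) \<and> (\<forall>F\<in>car (Y i). \<exists>f. D f F)"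
    using iso unfolding isomorphic_def by blast
  from bchoice[OF this] obtain D where D: "\<And>i. i \<in> I \<Longrightarrow> linear_relation K (X i) (Y i) (D i)"
    "\<And>i f. i \<in> I \<Longrightarrow> f \<in> car (X i) \<Longrightarrow> \<exists>F. D i f F" "\<And>i F. i \<in> I \<Longrightarrow> F \<in> car (Y i) \<Longrightarrow> \<exists>f. D i f F"
    by blast
  define E where "E f F \<longleftrightarrow> (\<forall>i\<in>I. D i (\<lambda>x. f (i, x)) (\<lambda>x. F (i, x)))" for f F
  \<comment> \<open>Stated for arbitrary families \<open>V\<close> and \<open>W\<close>, so that the
    same estimate serves for both directions of the isomorphism.\<close>
  have half: "F \<in> car (dsum I W) \<and> sq (dsum I W) F \<le> L * sq (dsum I V) f \<and> wt (dsum I W) F \<le> L * wt (dsum I V) f"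
    if f: "f \<in> car (dsum I V)" and V: "\<And>i. i \<in> I \<Longrightarrow> two_normed_space (V i)"
      and W: "\<And>i. i \<in> I \<Longrightarrow> two_normed_space (W i)"
      and Fi: "\<And>i. i \<in> I \<Longrightarrow> (\<lambda>x. F (i, x)) \<in> car (W i)"
      and le: "\<And>i. i \<in> I \<Longrightarrow> sq (W i) (\<lambda>x. F (i, x)) \<le> K * sq (V i) (\<lambda>x. f (i, x))"
        "\<And>i. i \<in> I \<Longrightarrow> wt (W i) (\<lambda>x. F (i, x)) \<le> K * wt (V i) (\<lambda>x. f (i, x))"
    for V :: "'a \<Rightarrow> 'd two_normed" and W :: "'a \<Rightarrow> 'e two_normed" and f F
  proof -
    have sf: "(\<lambda>i. pw (V i) (\<lambda>x. f (i, x))) summable_on I" "(\<lambda>i. sq (V i) (\<lambda>x. f (i, x))) summable_on I"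
      and fi: "\<And>i. i \<in> I \<Longrightarrow> (\<lambda>x. f (i, x)) \<in> car (V i)"
      using f by (auto simp: in_dsum)
    note nn = sq_nonneg[OF V fi] pw_nonneg[OF V fi] sq_nonneg[OF W Fi] pw_nonneg[OF W Fi]
    have r: "1 \<le> p / 2" using p_gt_2 by simp
    note pr = infsum_powr_le[OF sf(2) nn(1) r]
    have q1: "(\<lambda>i. sq (W i) (\<lambda>x. F (i, x))) summable_on I"
      by (rule nonneg_summable_on_comparison[OF summable_on_cmult_right[OF sf(2)] nn(3) le(1)])
    have "(\<Sum>\<^sub>\<infinity>i\<in>I. sq (W i) (\<lambda>x. F (i, x))) \<le> (\<Sum>\<^sub>\<infinity>i\<in>I. K * sq (V i) (\<lambda>x. f (i, x)))"
      by (intro infsum_mono q1 le summable_on_cmult_right sf)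
    then have q2: "sq (dsum I W) F \<le> K * sq (dsum I V) f"
      unfolding sq_dsum by (simp add: infsum_cmult_right sf)
    have le3: "pw (W i) (\<lambda>x. F (i, x)) \<le> K * (pw (V i) (\<lambda>x. f (i, x)) + sq (V i) (\<lambda>x. f (i, x)) powr (p / 2))"
      if "i \<in> I" for i
      using le(2)[OF that] unfolding wt_def by (smt (verit) powr_ge_zero)
    have s3: "(\<lambda>i. K * (pw (V i) (\<lambda>x. f (i, x)) + sq (V i) (\<lambda>x. f (i, x)) powr (p / 2))) summable_on I"
      by (intro summable_on_cmult_right summable_on_add sf pr)
    have p1: "(\<lambda>i. pw (W i) (\<lambda>x. F (i, x))) summable_on I"
      by (rule nonneg_summable_on_comparison[OF s3 nn(4) le3])
    have "pw (dsum I W) F \<le> (\<Sum>\<^sub>\<infinity>i\<in>I. K * (pw (V i) (\<lambda>x. f (i, x)) + sq (V i) (\<lambda>x. f (i, x)) powr (p / 2)))"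
      unfolding pw_dsum by (intro infsum_mono p1 s3 le3)
    also have "\<dots> = K * (pw (dsum I V) f + (\<Sum>\<^sub>\<infinity>i\<in>I. sq (V i) (\<lambda>x. f (i, x)) powr (p / 2)))"
      unfolding pw_dsum by (simp add: infsum_cmult_right infsum_add summable_on_add sf pr)
    also have "\<dots> \<le> K * wt (dsum I V) f"
      unfolding wt_def using pr(2) K by (intro mult_left_mono) (auto simp: sq_dsum)
    finally have p2: "pw (dsum I W) F \<le> K * wt (dsum I V) f" .
    have nnV: "0 \<le> sq (dsum I V) f" "0 \<le> pw (dsum I V) f" "0 \<le> sq (dsum I W) F"
      unfolding sq_dsum pw_dsum using nn by (auto intro: infsum_nonneg)
    have "sq (dsum I W) F powr (p / 2) \<le> (K * sq (dsum I V) f) powr (p / 2)"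
      using q2 nnV p_gt_2 by (intro powr_mono2) auto
    also have "\<dots> = K powr (p / 2) * sq (dsum I V) f powr (p / 2)"
      using K nnV by (simp add: powr_mult)
    also have "\<dots> \<le> K powr (p / 2) * wt (dsum I V) f"
      unfolding wt_def using nnV by (intro mult_left_mono) auto
    finally have "wt (dsum I W) F \<le> L * wt (dsum I V) f"
      using p2 unfolding L_def wt_def[of "dsum I W"] by (simp add: algebra_simps)
    moreover have "sq (dsum I W) F \<le> L * sq (dsum I V) f"
      using q2 L nnV(1) mult_right_mono[OF L(2) nnV(1)] by linarith
    ultimately show ?thesis using q1 p1 Fi by (auto simp: in_dsum)
  qed
  have Dc: "f \<in> car (X i)" "F \<in> car (Y i)" "comparable K (X i) (Y i) f F" if "i \<in> I" "D i f F" for i f F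
    using D(1)[OF that(1)] that(2) unfolding linear_relation_def by blast+
  have fwd: "F \<in> car (dsum I Y) \<and> sq (dsum I Y) F \<le> L * sq (dsum I X) f \<and> wt (dsum I Y) F \<le> L * wt (dsum I X) f"
    if "E f F" "f \<in> car (dsum I X)" for f F
    using that Dc X Y by (intro half) (auto simp: E_def comparable_def)
  have bwd: "f \<in> car (dsum I X) \<and> sq (dsum I X) f \<le> L * sq (dsum I Y) F \<and> wt (dsum I X) f \<le> L * wt (dsum I Y) F"
    if "E f F" "F \<in> car (dsum I Y)" for f F
    using that Dc X Y by (intro half) (auto simp: E_def comparable_def)
  show ?thesis
    unfolding L_def[symmetric]
  proof (rule isoI[where D = "\<lambda>f F. E f F \<and> f \<in> car (dsum I X)"])
    show "linear_relation L (dsum I X) (dsum I Y) (\<lambda>f F. E f F \<and> f \<in> car (dsum I X))"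
    proof (rule linear_relationI)
      fix f F g G a b
      assume "E f F \<and> f \<in> car (dsum I X)" "E g G \<and> g \<in> car (dsum I X)"
      then show "E (\<lambda>x. a * f x + b * g x) (\<lambda>x. a * F x + b * G x) \<and>
        (\<lambda>x. a * f x + b * g x) \<in> car (dsum I X)"
        using D(1) lc_car[OF two_normed_space_dsum[of I X, OF X]]
        unfolding E_def linear_relation_def by blast
    qed (use L fwd bwd in \<open>auto simp: comparable_def\<close>)
  next
    fix f assume f: "f \<in> car (dsum I X)"
    then have "\<forall>i\<in>I. \<exists>F. D i (\<lambda>x. f (i, x)) F" using D(2) by (auto simp: in_dsum)
    from bchoice[OF this] obtain F where "\<forall>i\<in>I. D i (\<lambda>x. f (i, x)) (F i)" ..
    then have "E f (\<lambda>(i, x). F i x)" by (simp add: E_def)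
    then show "\<exists>F. E f F \<and> f \<in> car (dsum I X)" using f by blast
  next
    fix F assume F: "F \<in> car (dsum I Y)"
    then have "\<forall>i\<in>I. \<exists>f. D i f (\<lambda>x. F (i, x))" using D(3) by (auto simp: in_dsum)
    from bchoice[OF this] obtain f where "\<forall>i\<in>I. D i (f i) (\<lambda>x. F (i, x))" ..
    then have "E (\<lambda>(i, x). f i x) F" by (simp add: E_def)
    then show "\<exists>f. E f F \<and> f \<in> car (dsum I X)" using F bwd by blast
  qed
qed

lemma dsum_reindex:
  assumes X: "\<And>i. i \<in> J \<Longrightarrow> two_normed_space (X i)" and bij: "bij_betw \<pi> I J"
  shows "isomorphic 1 (dsum I (\<lambda>i. X (\<pi> i))) (dsum J X)"
proof (rule isometric_iso[where P = "\<lambda>f F. \<forall>i\<in>I. \<forall>x. f (i, x) = F (\<pi> i, x)"])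
  have J: "\<pi> ` I = J" and inj: "inj_on \<pi> I" using bij by (auto simp: bij_betw_def)
  show "two_normed_space (dsum I (\<lambda>i. X (\<pi> i)))" "two_normed_space (dsum J X)"
    by (rule two_normed_space_dsum, rule X, use J in blast)+
  have sections: "(\<lambda>x. f (i, x)) = (\<lambda>x. F (\<pi> i, x))"
    if "\<forall>i\<in>I. \<forall>x. f (i, x) = F (\<pi> i, x)" "i \<in> I" for f F i
    using that by simp
  show "f \<in> car (dsum I (\<lambda>i. X (\<pi> i))) \<longleftrightarrow> F \<in> car (dsum J X)"
    if P: "\<forall>i\<in>I. \<forall>x. f (i, x) = F (\<pi> i, x)" for f F
  proof -
    have "(\<forall>i\<in>J. (\<lambda>x. F (i, x)) \<in> car (X i)) \<longleftrightarrow> (\<forall>i\<in>I. (\<lambda>x. f (i, x)) \<in> car (X (\<pi> i)))"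
      using sections[OF P] J by auto
    moreover have "(\<lambda>i. pw (X (\<pi> i)) (\<lambda>x. f (i, x))) summable_on I \<longleftrightarrow>
        (\<lambda>i. pw (X i) (\<lambda>x. F (i, x))) summable_on J"
      unfolding summable_on_reindex_bij_betw[OF bij, symmetric]
      by (rule summable_on_cong) (simp only: sections[OF P])
    moreover have "(\<lambda>i. sq (X (\<pi> i)) (\<lambda>x. f (i, x))) summable_on I \<longleftrightarrow>
        (\<lambda>i. sq (X i) (\<lambda>x. F (i, x))) summable_on J"
      unfolding summable_on_reindex_bij_betw[OF bij, symmetric]
      by (rule summable_on_cong) (simp only: sections[OF P])
    ultimately show ?thesis unfolding in_dsum by blast
  qed
  show "pw (dsum I (\<lambda>i. X (\<pi> i))) f = pw (dsum J X) F \<and> sq (dsum I (\<lambda>i. X (\<pi> i))) f = sq (dsum J X) F"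
    if P: "\<forall>i\<in>I. \<forall>x. f (i, x) = F (\<pi> i, x)" for f F
    unfolding pw_dsum sq_dsum infsum_reindex_bij_betw[OF bij, symmetric]
    by (intro conjI infsum_cong) (simp_all only: sections[OF P])
  show "\<exists>F. \<forall>i\<in>I. \<forall>x. f (i, x) = F (\<pi> i, x)" for f
    by (rule exI[of _ "\<lambda>(j, x). f (inv_into I \<pi> j, x)"]) (use inj in simp)
  show "\<exists>f. \<forall>i\<in>I. \<forall>x. f (i, x) = F (\<pi> i, x)" for F
    by (rule exI[of _ "\<lambda>(i, x). F (\<pi> i, x)"]) simp
qed simp

text \<open>Exactly isometric, because powers of the norms are summed and not norms: iterated sums
  of nonnegative terms equal the sum over all pairs.\<close>

lemma dsum_flatten:
  assumes X: "\<And>i j. i \<in> I \<Longrightarrow> j \<in> J i \<Longrightarrow> two_normed_space (X i j)"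
  shows "isomorphic 1 (dsum I (\<lambda>i. dsum (J i) (X i))) (dsum (Sigma I J) (\<lambda>(i, j). X i j))"
proof (rule isometric_iso[where P = "\<lambda>f F. \<forall>i\<in>I. \<forall>j\<in>J i. \<forall>x. f (i, j, x) = F ((i, j), x)"])
  let ?A = "dsum I (\<lambda>i. dsum (J i) (X i))" and ?B = "dsum (Sigma I J) (\<lambda>(i, j). X i j)"
  show "two_normed_space ?A" by (intro two_normed_space_dsum X)
  show "two_normed_space ?B" by (rule two_normed_space_dsum) (use X in auto)
  define pf where "pf F = (\<lambda>(i, j). pw (X i j) (\<lambda>x. F ((i, j), x)))" for F
  define sf where "sf F = (\<lambda>(i, j). sq (X i j) (\<lambda>x. F ((i, j), x)))" for F
  have B: "F \<in> car ?B \<longleftrightarrow> (\<forall>i\<in>I. \<forall>j\<in>J i. (\<lambda>x. F ((i, j), x)) \<in> car (X i j)) \<and>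
      pf F summable_on Sigma I J \<and> sf F summable_on Sigma I J"
    and pB: "pw ?B F = infsum (pf F) (Sigma I J)" and sB: "sq ?B F = infsum (sf F) (Sigma I J)" for F
    unfolding in_dsum pw_dsum sq_dsum pf_def sf_def case_prod_unfold
    by auto
  have A: "f \<in> car ?A \<longleftrightarrow> (\<forall>i\<in>I. \<forall>j\<in>J i. (\<lambda>x. F ((i, j), x)) \<in> car (X i j)) \<and>
      ((\<forall>i\<in>I. (\<lambda>j. pf F (i, j)) summable_on J i) \<and> (\<lambda>i. \<Sum>\<^sub>\<infinity>j\<in>J i. pf F (i, j)) summable_on I) \<and>
      ((\<forall>i\<in>I. (\<lambda>j. sf F (i, j)) summable_on J i) \<and> (\<lambda>i. \<Sum>\<^sub>\<infinity>j\<in>J i. sf F (i, j)) summable_on I)"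
    and pA: "pw ?A f = (\<Sum>\<^sub>\<infinity>i\<in>I. \<Sum>\<^sub>\<infinity>j\<in>J i. pf F (i, j))"
    and sA: "sq ?A f = (\<Sum>\<^sub>\<infinity>i\<in>I. \<Sum>\<^sub>\<infinity>j\<in>J i. sf F (i, j))"
    if P: "\<forall>i\<in>I. \<forall>j\<in>J i. \<forall>x. f (i, j, x) = F ((i, j), x)" for f F
  proof -
    have sec: "(\<lambda>x. f (i, j, x)) = (\<lambda>x. F ((i, j), x))" if "i \<in> I" "j \<in> J i" for i j
      using P that by simp
    have "(\<lambda>j. pw (X i j) (\<lambda>x. f (i, j, x))) summable_on J i \<longleftrightarrow> (\<lambda>j. pf F (i, j)) summable_on J i"
      "(\<lambda>j. sq (X i j) (\<lambda>x. f (i, j, x))) summable_on J i \<longleftrightarrow> (\<lambda>j. sf F (i, j)) summable_on J i"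
      if "i \<in> I" for i
      by (rule summable_on_cong, simp only: sec[OF that] pf_def sf_def prod.case)+
    then have inner: "(\<lambda>x. f (i, x)) \<in> car (dsum (J i) (X i)) \<longleftrightarrow>
        (\<forall>j\<in>J i. (\<lambda>x. F ((i, j), x)) \<in> car (X i j)) \<and>
        (\<lambda>j. pf F (i, j)) summable_on J i \<and> (\<lambda>j. sf F (i, j)) summable_on J i" if "i \<in> I" for i
      unfolding in_dsum using sec that by simp
    have pi: "pw (dsum (J i) (X i)) (\<lambda>x. f (i, x)) = (\<Sum>\<^sub>\<infinity>j\<in>J i. pf F (i, j))"
      "sq (dsum (J i) (X i)) (\<lambda>x. f (i, x)) = (\<Sum>\<^sub>\<infinity>j\<in>J i. sf F (i, j))" if "i \<in> I" for i
      unfolding pw_dsum sq_dsum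
      by (rule infsum_cong, simp only: sec[OF that] pf_def sf_def prod.case)+
    have "(\<lambda>i. pw (dsum (J i) (X i)) (\<lambda>x. f (i, x))) summable_on I \<longleftrightarrow>
        (\<lambda>i. \<Sum>\<^sub>\<infinity>j\<in>J i. pf F (i, j)) summable_on I"
      "(\<lambda>i. sq (dsum (J i) (X i)) (\<lambda>x. f (i, x))) summable_on I \<longleftrightarrow>
        (\<lambda>i. \<Sum>\<^sub>\<infinity>j\<in>J i. sf F (i, j)) summable_on I"
      by (rule summable_on_cong, simp only: pi)+
    then show "f \<in> car ?A \<longleftrightarrow> (\<forall>i\<in>I. \<forall>j\<in>J i. (\<lambda>x. F ((i, j), x)) \<in> car (X i j)) \<and>
      ((\<forall>i\<in>I. (\<lambda>j. pf F (i, j)) summable_on J i) \<and> (\<lambda>i. \<Sum>\<^sub>\<infinity>j\<in>J i. pf F (i, j)) summable_on I) \<and>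
      ((\<forall>i\<in>I. (\<lambda>j. sf F (i, j)) summable_on J i) \<and> (\<lambda>i. \<Sum>\<^sub>\<infinity>j\<in>J i. sf F (i, j)) summable_on I)"
      unfolding in_dsum[of f I] using inner by blast
    show "pw ?A f = (\<Sum>\<^sub>\<infinity>i\<in>I. \<Sum>\<^sub>\<infinity>j\<in>J i. pf F (i, j))"
      "sq ?A f = (\<Sum>\<^sub>\<infinity>i\<in>I. \<Sum>\<^sub>\<infinity>j\<in>J i. sf F (i, j))"
      unfolding pw_dsum[of I _ f] sq_dsum[of I _ f] by (rule infsum_cong, simp only: pi)+
  qed
  have nn: "0 \<le> pf F (i, j)" "0 \<le> sf F (i, j)"
    if "\<forall>i\<in>I. \<forall>j\<in>J i. (\<lambda>x. F ((i, j), x)) \<in> car (X i j)" "i \<in> I" "j \<in> J i" for F i j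
    using that X by (auto simp: pf_def sf_def intro!: pw_nonneg sq_nonneg)
  show car: "f \<in> car ?A \<longleftrightarrow> F \<in> car ?B" if P: "\<forall>i\<in>I. \<forall>j\<in>J i. \<forall>x. f (i, j, x) = F ((i, j), x)" for f F
    unfolding A[OF P] B
  proof (intro conj_cong refl)
    assume c: "\<forall>i\<in>I. \<forall>j\<in>J i. (\<lambda>x. F ((i, j), x)) \<in> car (X i j)"
    show "((\<forall>i\<in>I. (\<lambda>j. pf F (i, j)) summable_on J i) \<and> (\<lambda>i. \<Sum>\<^sub>\<infinity>j\<in>J i. pf F (i, j)) summable_on I) \<longleftrightarrow>
        pf F summable_on Sigma I J"
      by (rule infsum_nonneg_Sigma(1)[symmetric]) (rule nn(1)[OF c])
    show "((\<forall>i\<in>I. (\<lambda>j. sf F (i, j)) summable_on J i) \<and> (\<lambda>i. \<Sum>\<^sub>\<infinity>j\<in>J i. sf F (i, j)) summable_on I) \<longleftrightarrow>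
        sf F summable_on Sigma I J"
      by (rule infsum_nonneg_Sigma(1)[symmetric]) (rule nn(2)[OF c])
  qed
  show "pw ?A f = pw ?B F \<and> sq ?A f = sq ?B F"
    if P: "\<forall>i\<in>I. \<forall>j\<in>J i. \<forall>x. f (i, j, x) = F ((i, j), x)" and f: "f \<in> car ?A" for f F
  proof -
    have F: "F \<in> car ?B" using car[OF P] f by simp
    then have c: "\<forall>i\<in>I. \<forall>j\<in>J i. (\<lambda>x. F ((i, j), x)) \<in> car (X i j)" unfolding B by (rule conjunct1)
    show ?thesis
      unfolding pA[OF P] sA[OF P] pB sB
      using infsum_nonneg_Sigma(2)[of I J "pf F"] infsum_nonneg_Sigma(2)[of I J "sf F"] nn[OF c] F
      by (simp only: B)
  qed
  show "\<exists>F. \<forall>i\<in>I. \<forall>j\<in>J i. \<forall>x. f (i, j, x) = F ((i, j), x)" for f :: "'a \<times> 'b \<times> 'c \<Rightarrow> real"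
    by (rule exI[of _ "\<lambda>((i, j), x). f (i, j, x)"]) simp
  show "\<exists>f. \<forall>i\<in>I. \<forall>j\<in>J i. \<forall>x. f (i, j, x) = F ((i, j), x)" for F :: "('a \<times> 'b) \<times> 'c \<Rightarrow> real"
    by (rule exI[of _ "\<lambda>(i, j, x). F ((i, j), x)"]) simp
qed simp

lemma dsum_component:
  assumes X: "\<And>i. i \<in> I \<Longrightarrow> two_normed_space (X i)" and f: "f \<in> car (dsum I X)" and i: "i \<in> I"
  shows "(\<lambda>x. f (i, x)) \<in> car (X i)" "wt (X i) (\<lambda>x. f (i, x)) \<le> wt (dsum I X) f"
proof -
  show "(\<lambda>x. f (i, x)) \<in> car (X i)" using f i by (simp add: in_dsum)
  have nn: "0 \<le> pw (X j) (\<lambda>x. f (j, x))" "0 \<le> sq (X j) (\<lambda>x. f (j, x))" if "j \<in> I" for j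
    using that f X by (auto simp: in_dsum pw_nonneg sq_nonneg)
  have "(\<Sum>j\<in>{i}. pw (X j) (\<lambda>x. f (j, x))) \<le> pw (dsum I X) f"
    unfolding pw_dsum by (rule finite_sum_le_infsum) (use f i nn in \<open>auto simp: in_dsum\<close>)
  moreover have "(\<Sum>j\<in>{i}. sq (X j) (\<lambda>x. f (j, x))) \<le> sq (dsum I X) f"
    unfolding sq_dsum by (rule finite_sum_le_infsum) (use f i nn in \<open>auto simp: in_dsum\<close>)
  ultimately show "wt (X i) (\<lambda>x. f (i, x)) \<le> wt (dsum I X) f"
    unfolding wt_def using nn(2)[OF i] p_gt_2 by (intro add_mono powr_mono2) auto
qed

lemma pw_le_wt: "pw A f \<le> wt A f"
  by (simp add: wt_def)

text \<open>The usual argument for sequence spaces: take limits in each component, bound finite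
  partial sums uniformly, and only then let the finite set grow.\<close>

lemma is_complete_dsum:
  assumes X: "\<And>i. i \<in> I \<Longrightarrow> two_normed_space (X i)" and compl: "\<And>i. i \<in> I \<Longrightarrow> is_complete (X i)"
  shows "is_complete (dsum I X)"
  unfolding is_complete_def
proof (intro allI impI)
  fix u assume u: "\<forall>n. u n \<in> car (dsum I X)" and cauchy: "is_cauchy (dsum I X) u"
  have S: "two_normed_space (dsum I X)" using X by (rule two_normed_space_dsum)
  have d: "(\<lambda>x. u m x - u n x) \<in> car (dsum I X)" for m n
    using u S by (auto intro: diff_car)
  have ui: "(\<lambda>x. u n (i, x)) \<in> car (X i)" if "i \<in> I" for n i
    using u that by (auto simp: in_dsum)
  have "\<exists>g\<in>car (X i). converges (X i) (\<lambda>n x. u n (i, x)) g" if i: "i \<in> I" for i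
  proof -
    have "is_cauchy (X i) (\<lambda>n x. u n (i, x))"
      using cauchy dsum_component(2)[of I X, OF X d i] unfolding is_cauchy_def
      by (meson le_less_trans)
    then show ?thesis
      using compl[OF i, unfolded is_complete_def, rule_format, of "\<lambda>n x. u n (i, x)"] ui[OF i] by simp
  qed
  then have "\<forall>i\<in>I. \<exists>g. g \<in> car (X i) \<and> converges (X i) (\<lambda>n x. u n (i, x)) g" by blast
  from bchoice[OF this] obtain g where g: "\<And>i. i \<in> I \<Longrightarrow> g i \<in> car (X i)"
    "\<And>i. i \<in> I \<Longrightarrow> converges (X i) (\<lambda>n x. u n (i, x)) (g i)" by blast
  define G where "G = (\<lambda>(i, x). g i x)"
  have e: "(\<lambda>x. u n (i, x) - g i x) \<in> car (X i)" if "i \<in> I" for n i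
    using that ui g X by (auto intro: diff_car)
  note nn = pw_nonneg[OF X e] sq_nonneg[OF X e]
  have pw0: "(\<lambda>m. pw (X i) (\<lambda>x. u m (i, x) - g i x)) \<longlonglongrightarrow> 0" if "i \<in> I" for i
    by (rule tendsto_sandwich[OF _ _ tendsto_const g(2)[OF that, unfolded converges_def]])
      (use nn(1) that pw_le_wt in \<open>auto intro!: always_eventually\<close>)
  have sq0: "(\<lambda>m. sq (X i) (\<lambda>x. u m (i, x) - g i x)) \<longlonglongrightarrow> 0" if "i \<in> I" for i
    using converges_sq[OF X[OF that] ui[OF that] g(1)[OF that] g(2)[OF that]] .
  \<comment> \<open>Over a finite index set F the sums for u_n - u_m are at most \<epsilon> for
    \<open>pw\<close> and \<epsilon>^(2/p) for \<open>sq\<close>; m tends to infinity while F stays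
    fixed. The quasi-triangle inequalities contribute 2^p to the first bound and 2 to the second,
    which becomes 2^(p/2) * \<epsilon> after raising to the power p/2.\<close>
  have key: "(\<lambda>x. u n x - G x) \<in> car (dsum I X) \<and>
      wt (dsum I X) (\<lambda>x. u n x - G x) \<le> (2 powr p + 2 powr (p / 2)) * \<epsilon>"
    if "0 < \<epsilon>" and N: "\<And>m n. m \<ge> N \<Longrightarrow> n \<ge> N \<Longrightarrow> wt (dsum I X) (\<lambda>x. u m x - u n x) < \<epsilon>" and "n \<ge> N"
    for \<epsilon> N n
  proof -
    let ?dpw = "\<lambda>m i. pw (X i) (\<lambda>x. u n (i, x) - u m (i, x))"
    let ?dsq = "\<lambda>m i. sq (X i) (\<lambda>x. u n (i, x) - u m (i, x))"
    let ?epw = "\<lambda>m i. pw (X i) (\<lambda>x. u m (i, x) - g i x)"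
    let ?esq = "\<lambda>m i. sq (X i) (\<lambda>x. u m (i, x) - g i x)"
    have dd: "(\<lambda>x. u n (i, x) - u m (i, x)) \<in> car (X i)" if "i \<in> I" for m i
      using that ui X by (auto intro: diff_car)
    have bpw: "sum (?dpw m) F \<le> \<epsilon>" if "finite F" "F \<subseteq> I" "m \<ge> N" for F m
    proof -
      have "sum (?dpw m) F \<le> pw (dsum I X) (\<lambda>x. u n x - u m x)"
        unfolding pw_dsum using d[of n m] that pw_nonneg[OF X dd]
        by (intro finite_sum_le_infsum) (auto simp: in_dsum)
      also have "\<dots> \<le> wt (dsum I X) (\<lambda>x. u n x - u m x)" by (rule pw_le_wt)
      also have "\<dots> \<le> \<epsilon>" using N[of n m] that \<open>n \<ge> N\<close> by simp
      finally show ?thesis .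
    qed
    have bsq: "sum (?dsq m) F \<le> \<epsilon> powr (2 / p)" if "finite F" "F \<subseteq> I" "m \<ge> N" for F m
    proof -
      have "sum (?dsq m) F \<le> sq (dsum I X) (\<lambda>x. u n x - u m x)"
        unfolding sq_dsum using d[of n m] that sq_nonneg[OF X dd]
        by (intro finite_sum_le_infsum) (auto simp: in_dsum)
      also have "\<dots> \<le> wt (dsum I X) (\<lambda>x. u n x - u m x) powr (2 / p)" by (rule sq_le_wt[OF S d])
      also have "\<dots> \<le> \<epsilon> powr (2 / p)"
        using N[of n m] that \<open>n \<ge> N\<close> p_gt_2 wt_nonneg[OF S d] by (intro powr_mono2) auto
      finally show ?thesis .
    qed
    have split: "(\<lambda>x. u n (i, x) - g i x) = (\<lambda>x. (u n (i, x) - u m (i, x)) + (u m (i, x) - g i x))" for m i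
      by simp
    have cpw: "sum (?epw n) F \<le> 2 powr p * \<epsilon>" if F: "finite F" "F \<subseteq> I" for F
    proof (rule LIMSEQ_le_const)
      show "(\<lambda>m. 2 powr p * (\<epsilon> + (\<Sum>i\<in>F. ?epw m i))) \<longlonglongrightarrow> 2 powr p * \<epsilon>"
        using pw0 F by (auto intro!: tendsto_eq_intros tendsto_null_sum)
      have "sum (?epw n) F \<le> 2 powr p * (\<epsilon> + (\<Sum>i\<in>F. ?epw m i))" if "m \<ge> N" for m
      proof -
        have "sum (?epw n) F \<le> (\<Sum>i\<in>F. 2 powr p * (?dpw m i + ?epw m i))"
          unfolding split[of _ m] using F dd e by (intro sum_mono pw_add X) auto
        also have "\<dots> = 2 powr p * (sum (?dpw m) F + sum (?epw m) F)"
          by (simp add: sum_distrib_left sum.distrib distrib_left)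
        also have "\<dots> \<le> 2 powr p * (\<epsilon> + sum (?epw m) F)"
          using bpw[OF F that] by (intro mult_left_mono) auto
        finally show ?thesis .
      qed
      then show "\<exists>N. \<forall>m\<ge>N. sum (?epw n) F \<le> 2 powr p * (\<epsilon> + (\<Sum>i\<in>F. ?epw m i))" by blast
    qed
    have csq: "sum (?esq n) F \<le> 2 * \<epsilon> powr (2 / p)" if F: "finite F" "F \<subseteq> I" for F
    proof (rule LIMSEQ_le_const)
      show "(\<lambda>m. 2 * (\<epsilon> powr (2 / p) + (\<Sum>i\<in>F. ?esq m i))) \<longlonglongrightarrow> 2 * \<epsilon> powr (2 / p)"
        using sq0 F by (auto intro!: tendsto_eq_intros tendsto_null_sum)
      have "sum (?esq n) F \<le> 2 * (\<epsilon> powr (2 / p) + (\<Sum>i\<in>F. ?esq m i))" if "m \<ge> N" for m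
      proof -
        have "sum (?esq n) F \<le> (\<Sum>i\<in>F. 2 * (?dsq m i + ?esq m i))"
          unfolding split[of _ m] using F dd e by (intro sum_mono sq_add X) auto
        also have "\<dots> = 2 * (sum (?dsq m) F + sum (?esq m) F)"
          by (simp add: sum_distrib_left sum.distrib distrib_left)
        also have "\<dots> \<le> 2 * (\<epsilon> powr (2 / p) + sum (?esq m) F)"
          using bsq[OF F that] by (intro mult_left_mono) auto
        finally show ?thesis .
      qed
      then show "\<exists>N. \<forall>m\<ge>N. sum (?esq n) F \<le> 2 * (\<epsilon> powr (2 / p) + (\<Sum>i\<in>F. ?esq m i))" by blast
    qed
    note sp = nonneg_infsum_bound[of I "?epw n", OF nn(1) cpw]
    note ss = nonneg_infsum_bound[of I "?esq n", OF nn(2) csq]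
    have "sq (dsum I X) (\<lambda>x. u n x - G x) powr (p / 2) \<le> (2 * \<epsilon> powr (2 / p)) powr (p / 2)"
      unfolding sq_dsum G_def prod.case using ss p_gt_2 nn(2)
      by (intro powr_mono2) (auto intro: infsum_nonneg)
    also have "\<dots> = 2 powr (p / 2) * \<epsilon>"
      using p_gt_2 \<open>0 < \<epsilon>\<close> by (simp add: powr_mult powr_powr)
    finally show ?thesis
      using sp ss e by (simp add: in_dsum G_def wt_def pw_dsum algebra_simps)
  qed
  have Nex: "\<exists>N. \<forall>m\<ge>N. \<forall>n\<ge>N. wt (dsum I X) (\<lambda>x. u m x - u n x) < \<epsilon>" if "0 < \<epsilon>" for \<epsilon>
    using cauchy that unfolding is_cauchy_def by blast
  obtain N where "\<forall>m\<ge>N. \<forall>n\<ge>N. wt (dsum I X) (\<lambda>x. u m x - u n x) < 1" using Nex[of 1] by auto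
  then have dG: "(\<lambda>x. u N x - G x) \<in> car (dsum I X)"
    using key[of 1 N N] by simp
  \<comment> \<open>One value of \<epsilon> already places the limit in the carrier, as the
    difference of two of its elements.\<close>
  have "(\<lambda>x. u N x - (u N x - G x)) \<in> car (dsum I X)"
    using diff_car[OF S _ dG] u by blast
  then have G: "G \<in> car (dsum I X)" by simp
  have "converges (dsum I X) u G"
    unfolding converges_def
  proof (rule LIMSEQ_I)
    fix \<delta> :: real assume "0 < \<delta>"
    define C where "C = (2 powr p + 2 powr (p / 2) :: real)"
    have C: "0 < C" unfolding C_def by (intro add_pos_pos) auto
    obtain N where N: "\<forall>m\<ge>N. \<forall>n\<ge>N. wt (dsum I X) (\<lambda>x. u m x - u n x) < \<delta> / (2 * C)"
      using Nex[of "\<delta> / (2 * C)"] \<open>0 < \<delta>\<close> C by auto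
    have "norm (wt (dsum I X) (\<lambda>x. u n x - G x) - 0) < \<delta>" if "n \<ge> N" for n
    proof -
      have k: "(\<lambda>x. u n x - G x) \<in> car (dsum I X)" "wt (dsum I X) (\<lambda>x. u n x - G x) \<le> C * (\<delta> / (2 * C))"
        using key[of "\<delta> / (2 * C)" N n] N that \<open>0 < \<delta>\<close> C unfolding C_def[symmetric] by auto
      then show ?thesis using wt_nonneg[OF S k(1)] C \<open>0 < \<delta>\<close> by simp
    qed
    then show "\<exists>N. \<forall>n\<ge>N. norm (wt (dsum I X) (\<lambda>x. u n x - G x) - 0) < \<delta>" by blast
  qed
  then show "\<exists>f\<in>car (dsum I X). converges (dsum I X) u f" using G by blast
qed

lemma dsum_finite_support_dense:
  assumes X: "\<And>i. i \<in> I \<Longrightarrow> two_normed_space (X i)" and f: "f \<in> car (dsum I X)" and "0 < \<epsilon>"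
  obtains g F where "finite F" "F \<subseteq> I" "g \<in> car (dsum I X)" "\<And>i x. i \<notin> F \<Longrightarrow> g (i, x) = 0"
    "wt (dsum I X) (\<lambda>x. g x - f x) < \<epsilon>"
proof -
  let ?p = "\<lambda>i. pw (X i) (\<lambda>x. f (i, x))" and ?s = "\<lambda>i. sq (X i) (\<lambda>x. f (i, x))"
  have fi: "(\<lambda>x. f (i, x)) \<in> car (X i)" if "i \<in> I" for i using f that by (simp add: in_dsum)
  note nn = pw_nonneg[OF X fi] sq_nonneg[OF X fi]
  have sm: "?p summable_on I" "?s summable_on I" using f by (auto simp: in_dsum)
  \<comment> \<open>A remainder below \<eta> in \<open>sq\<close> contributes at most \<epsilon> / 2
    / 2^p to \<open>wt\<close>. The divisor 2^p prepares for the end of the proof, where f - g is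
    turned into g - f by \<open>wt_lc\<close> at the price of 2^p.\<close>
  define \<eta> where "\<eta> = (\<epsilon> / 2 / 2 powr p) powr (2 / p)"
  have \<eta>: "0 < \<eta>" "\<eta> powr (p / 2) = \<epsilon> / 2 / 2 powr p"
    unfolding \<eta>_def powr_powr using \<open>0 < \<epsilon>\<close> p_gt_2 by auto
  obtain F1 where F1: "finite F1" "F1 \<subseteq> I" "\<And>G. F1 \<subseteq> G \<Longrightarrow> G \<subseteq> I \<Longrightarrow> ?p summable_on (I - G) \<and> infsum ?p (I - G) < \<epsilon> / 2 / 2 powr p"
    using infsum_remainder_small[OF sm(1) nn(1), of "\<epsilon> / 2 / 2 powr p"] \<open>0 < \<epsilon>\<close> by auto
  obtain F2 where F2: "finite F2" "F2 \<subseteq> I" "\<And>G. F2 \<subseteq> G \<Longrightarrow> G \<subseteq> I \<Longrightarrow> ?s summable_on (I - G) \<and> infsum ?s (I - G) < \<eta>"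
    using infsum_remainder_small[OF sm(2) nn(2), of \<eta>] \<eta> by auto
  define F where "F = F1 \<union> F2"
  define g where "g = (\<lambda>(i, x). if i \<in> F then f (i, x) else 0)"
  have F: "finite F" "F \<subseteq> I" "infsum ?p (I - F) < \<epsilon> / 2 / 2 powr p" "infsum ?s (I - F) < \<eta>"
    using F1(1,2) F2(1,2) F1(3)[of F] F2(3)[of F] unfolding F_def by auto
  have gi: "(\<lambda>x. g (i, x)) = (if i \<in> F then (\<lambda>x. f (i, x)) else (\<lambda>_. 0))" for i
    by (auto simp: g_def)
  have hi: "(\<lambda>x. f (i, x) - g (i, x)) = (if i \<in> F then (\<lambda>_. 0) else (\<lambda>x. f (i, x)))" for i
    by (auto simp: g_def)
  have S: "two_normed_space (dsum I X)" using X by (rule two_normed_space_dsum)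
  have z: "pw (X i) (\<lambda>_. 0) = 0" "sq (X i) (\<lambda>_. 0) = 0" "(\<lambda>_. 0) \<in> car (X i)" if "i \<in> I" for i
    using X[OF that] by (auto simp: pw_zero sq_zero zero_car)
  have hp: "infsum (\<lambda>i. pw (X i) (\<lambda>x. f (i, x) - g (i, x))) I = infsum ?p (I - F)"
    by (rule infsum_cong_neutral) (auto simp: hi z)
  have hs: "infsum (\<lambda>i. sq (X i) (\<lambda>x. f (i, x) - g (i, x))) I = infsum ?s (I - F)"
    by (rule infsum_cong_neutral) (auto simp: hi z)
  have h: "(\<lambda>x. f x - g x) \<in> car (dsum I X)"
    unfolding in_dsum
  proof (intro conjI ballI)
    show "(\<lambda>i. pw (X i) (\<lambda>x. f (i, x) - g (i, x))) summable_on I"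
      by (rule nonneg_summable_on_comparison[OF sm(1)]) (auto simp: hi z nn)
    show "(\<lambda>i. sq (X i) (\<lambda>x. f (i, x) - g (i, x))) summable_on I"
      by (rule nonneg_summable_on_comparison[OF sm(2)]) (auto simp: hi z nn)
  qed (auto simp: hi z fi)
  have g: "g \<in> car (dsum I X)" using diff_car[OF S f h] by simp
  have "sq (dsum I X) (\<lambda>x. f x - g x) powr (p / 2) \<le> \<epsilon> / 2 / 2 powr p"
    unfolding \<eta>(2)[symmetric] using F(4) p_gt_2 sq_nonneg[OF S h]
    by (intro powr_mono2) (auto simp: sq_dsum hs)
  moreover have "pw (dsum I X) (\<lambda>x. f x - g x) < \<epsilon> / 2 / 2 powr p"
    using F(3) by (simp add: pw_dsum hp)
  ultimately have w: "wt (dsum I X) (\<lambda>x. f x - g x) < \<epsilon> / 2 powr p"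
    unfolding wt_def by simp
  have "wt (dsum I X) (\<lambda>x. 0 * f x + (-1) * (f x - g x))
      \<le> 2 powr p * (\<bar>0\<bar> powr p * wt (dsum I X) f + \<bar>-1\<bar> powr p * wt (dsum I X) (\<lambda>x. f x - g x))"
    by (rule wt_lc[OF S f h])
  also have "\<dots> < \<epsilon>" using w by (simp add: pos_less_divide_eq mult.commute)
  finally have "wt (dsum I X) (\<lambda>x. g x - f x) < \<epsilon>" by simp
  then show thesis using that[OF F(1,2) g] by (simp add: g_def)
qed

end

section \<open>Rosenthal's inequality\<close>

text \<open>Up to the factor $r+1$, the derivative of $|a|^{r+1}$.\<close>

definition signed_powr :: "real \<Rightarrow> real \<Rightarrow> real" where
  "signed_powr r a = sgn a * \<bar>a\<bar> powr r"

lemma signed_powr_borel [measurable]: "signed_powr r \<in> borel_measurable borel"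
  unfolding signed_powr_def[abs_def] by measurable

lemma abs_signed_powr: "\<bar>signed_powr r a\<bar> = (if a = 0 then 0 else \<bar>a\<bar> powr r)"
  by (auto simp: signed_powr_def abs_mult abs_sgn_eq)

lemma signed_powr_minus: "signed_powr r (- a) = - signed_powr r a"
  by (simp add: signed_powr_def sgn_minus)

lemma powr_young:
  fixes a b :: real
  assumes "0 \<le> a" "0 \<le> b" "1 < p"
  shows "p * (a powr (p - 1) * b) \<le> b powr p + (p - 1) * a powr p"
proof -
  have "b * a powr (p - 1) \<le> b powr p / p + (a powr (p - 1)) powr (p / (p - 1)) / (p / (p - 1))"
    using assms by (intro Youngs_inequality) (auto simp: field_simps)
  also have "(a powr (p - 1)) powr (p / (p - 1)) = a powr p"
    unfolding powr_powr using assms by simp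
  finally show ?thesis using assms by (simp add: field_simps)
qed

text \<open>Convexity of the p-th power. Because signed_powr(p-1, a) * a = |a|^p, the claim reduces
  to Young's inequality for |a|^(p-1) * |b|.\<close>

lemma abs_powr_above_tangent:
  assumes "1 < p"
  shows "\<bar>a\<bar> powr p + p * signed_powr (p - 1) a * (b - a) \<le> \<bar>b\<bar> powr p"
proof -
  have "signed_powr (p - 1) a * a = \<bar>a\<bar> powr p"
    using assms powr_add[of "\<bar>a\<bar>" "p - 1" 1] by (simp add: signed_powr_def sgn_if)
  moreover have "signed_powr (p - 1) a * b \<le> \<bar>a\<bar> powr (p - 1) * \<bar>b\<bar>"
    using abs_ge_self[of "signed_powr (p - 1) a * b"] unfolding abs_mult abs_signed_powr by (cases "a = 0") auto
  then have "p * (signed_powr (p - 1) a * b) \<le> \<bar>b\<bar> powr p + (p - 1) * \<bar>a\<bar> powr p"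
    by (intro order_trans[OF mult_left_mono powr_young]) (use assms in auto)
  ultimately show ?thesis by (simp add: algebra_simps)
qed

lemma powr_superadd:
  fixes x y r :: real
  assumes "0 \<le> x" "0 \<le> y" "1 \<le> r"
  shows "x powr r + y powr r \<le> (x + y) powr r"
proof -
  have split: "s powr r = s * s powr (r - 1)" if "0 \<le> s" for s
    using that powr_add[of s 1 "r - 1"] by simp
  have "x * x powr (r - 1) + y * y powr (r - 1) \<le> x * (x + y) powr (r - 1) + y * (x + y) powr (r - 1)"
    using assms by (intro add_mono mult_left_mono powr_mono2) auto
  then show ?thesis using assms by (simp add: split distrib_right)
qed

text \<open>One of Clarkson's inequalities. Put r = p/2 and m = x^2 + y^2. Superadditivity of t^r
  bounds |x|^p + |y|^p by m^r, and m is the mean of (x+y)^2 and (x-y)^2, so that convexity of t^r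
  finishes.\<close>

lemma powr_parallelogram:
  fixes x y p :: real
  assumes "2 \<le> p"
  shows "2 * (\<bar>x\<bar> powr p + \<bar>y\<bar> powr p) \<le> \<bar>x + y\<bar> powr p + \<bar>x - y\<bar> powr p"
proof (cases "p = 2")
  case True
  then show ?thesis by (simp add: power2_eq_square algebra_simps)
next
  case False
  define r where "r = p / 2"
  have r: "1 < r" using assms False by (simp add: r_def)
  have sq: "\<bar>t\<bar> powr p = \<bar>t\<^sup>2\<bar> powr r" for t :: real
  proof -
    have "\<bar>t\<^sup>2\<bar> powr r = (\<bar>t\<bar> powr 2) powr r" by simp
    also have "\<dots> = \<bar>t\<bar> powr p" unfolding powr_powr r_def by simp
    finally show ?thesis by simp
  qed
  define m where "m = x\<^sup>2 + y\<^sup>2"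
  have 1: "\<bar>x\<bar> powr p + \<bar>y\<bar> powr p \<le> \<bar>m\<bar> powr r"
    unfolding sq m_def using powr_superadd[of "x\<^sup>2" "y\<^sup>2" r] r by simp
  \<comment> \<open>The two first-order terms of the tangent at m cancel, since m is the
    midpoint.\<close>
  have 2: "r * signed_powr (r - 1) m * ((x + y)\<^sup>2 - m) + r * signed_powr (r - 1) m * ((x - y)\<^sup>2 - m) = 0"
    unfolding m_def by (simp add: power2_eq_square algebra_simps)
  have "2 * A \<le> P + Q" if "A \<le> B" "B + d \<le> P" "B + d' \<le> Q" "d + d' = 0" for A B P Q d d' :: real
    using that by simp
  from this[OF 1 abs_powr_above_tangent[OF r] abs_powr_above_tangent[OF r] 2]
  show ?thesis unfolding sq[of "x + y"] sq[of "x - y"] .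
qed

text \<open>The parallelogram inequality for a + b/2 and b/2, whose sum and difference are a + b and
  a, followed by the tangent at a. The gain 2^(1-p) is 2 * |b/2|^p. That |a|^p keeps the coefficient
  1 is what allows the inequality to be iterated.\<close>

lemma abs_powr_add_ge:
  assumes "2 \<le> p"
  shows "\<bar>a\<bar> powr p + p * signed_powr (p - 1) a * b + 2 powr (1 - p) * \<bar>b\<bar> powr p \<le> \<bar>a + b\<bar> powr p"
proof -
  have "2 * (\<bar>a + b / 2\<bar> powr p + \<bar>b / 2\<bar> powr p) \<le> \<bar>a + b\<bar> powr p + \<bar>a\<bar> powr p"
    using powr_parallelogram[OF assms, of "a + b / 2" "b / 2"] by (simp add: algebra_simps)
  moreover have "\<bar>a\<bar> powr p + p * signed_powr (p - 1) a * (b / 2) \<le> \<bar>a + b / 2\<bar> powr p"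
    using abs_powr_above_tangent[of p a "a + b / 2"] assms by simp
  moreover have "2 * \<bar>b / 2\<bar> powr p = 2 powr (1 - p) * \<bar>b\<bar> powr p"
    by (simp add: powr_divide powr_diff)
  ultimately show ?thesis by (simp add: algebra_simps)
qed

lemma powr_diff_le:
  fixes x y r :: real
  assumes "0 < x" "0 < y" "1 < r" "x \<le> m" "y \<le> m"
  shows "\<bar>x powr r - y powr r\<bar> \<le> r * m powr (r - 1) * \<bar>x - y\<bar>"
proof -
  have *: "x powr r - y powr r \<le> r * m powr (r - 1) * (x - y)" if "0 < y" "y \<le> x" "x \<le> m" for x y
  proof -
    have "x powr r + r * x powr (r - 1) * (y - x) \<le> y powr r"
      using abs_powr_above_tangent[OF \<open>1 < r\<close>, of x y] that by (simp add: signed_powr_def)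
    moreover have "r * x powr (r - 1) * (x - y) \<le> r * m powr (r - 1) * (x - y)"
      using that assms by (intro mult_right_mono mult_left_mono powr_mono2) auto
    ultimately show ?thesis by (simp add: algebra_simps)
  qed
  have mono: "y powr r \<le> x powr r" if "0 < y" "y \<le> x" for x y
    using that assms by (intro powr_mono2) auto
  show ?thesis
    using *[of x y] *[of y x] mono[of x y] mono[of y x] assms by (cases "y \<le> x") auto
qed

text \<open>If 0 \<le> a \<le> 2|b|, both values are bounded separately, by (3|b|)^r and (2|b|)^r.
  If a > 2|b|, then a and a + b are positive and at most 2a, and a mean value estimate applies.
  Negative a is reduced to this by oddness.\<close>

lemma signed_powr_diff_le:
  assumes "1 < r"
  shows "\<bar>signed_powr r (a + b) - signed_powr r a\<bar>
    \<le> (3 powr r + 2 powr r + r * 2 powr (r - 1)) * (\<bar>a\<bar> powr (r - 1) * \<bar>b\<bar> + \<bar>b\<bar> powr r)"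
proof -
  have pos: "\<bar>signed_powr r (a + b) - signed_powr r a\<bar>
    \<le> (3 powr r + 2 powr r + r * 2 powr (r - 1)) * (\<bar>a\<bar> powr (r - 1) * \<bar>b\<bar> + \<bar>b\<bar> powr r)" if "0 \<le> a" for a b
  proof (cases "a \<le> 2 * \<bar>b\<bar>")
    case True
    have "\<bar>signed_powr r (a + b)\<bar> \<le> (3 * \<bar>b\<bar>) powr r"
      unfolding abs_signed_powr using True that assms by (auto intro!: powr_mono2)
    moreover have "\<bar>signed_powr r a\<bar> \<le> (2 * \<bar>b\<bar>) powr r"
      unfolding abs_signed_powr using True that assms by (auto intro!: powr_mono2)
    ultimately have "\<bar>signed_powr r (a + b) - signed_powr r a\<bar> \<le> (3 powr r + 2 powr r) * \<bar>b\<bar> powr r"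
      by (simp add: powr_mult algebra_simps)
    also have "\<dots> \<le> (3 powr r + 2 powr r + r * 2 powr (r - 1)) * (\<bar>a\<bar> powr (r - 1) * \<bar>b\<bar> + \<bar>b\<bar> powr r)"
      using assms by (intro mult_mono) auto
    finally show ?thesis .
  next
    case False
    then have ab: "0 < a" "0 < a + b" "a \<le> 2 * a" "a + b \<le> 2 * a" by (auto simp: abs_if split: if_splits)
    have "\<bar>signed_powr r (a + b) - signed_powr r a\<bar> = \<bar>(a + b) powr r - a powr r\<bar>"
      using ab by (simp add: signed_powr_def)
    also have "\<dots> \<le> r * (2 * a) powr (r - 1) * \<bar>(a + b) - a\<bar>"
      using ab assms by (intro powr_diff_le)
    also have "\<dots> = (r * 2 powr (r - 1)) * (\<bar>a\<bar> powr (r - 1) * \<bar>b\<bar>)"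
      using ab by (simp add: powr_mult)
    also have "\<dots> \<le> (3 powr r + 2 powr r + r * 2 powr (r - 1)) * (\<bar>a\<bar> powr (r - 1) * \<bar>b\<bar> + \<bar>b\<bar> powr r)"
      using assms by (intro mult_mono) auto
    finally show ?thesis .
  qed
  show ?thesis
  proof (cases "0 \<le> a")
    case False
    have "signed_powr r (- a + - b) - signed_powr r (- a) = - (signed_powr r (a + b) - signed_powr r a)"
      using signed_powr_minus[of r "a + b"] signed_powr_minus[of r a] by simp
    then show ?thesis using pos[of "- a" "- b"] False by (simp only: abs_minus)
  qed (use pos in blast)
qed

text \<open>The tangent at a + b, evaluated at a, gives an upper bound for |a + b|^p with the slope
  at a + b; replacing it by the slope at a produces the error term. The part |a|^(p-2) * b^2 of the
  error is the origin of the L_2 norms in Rosenthal's inequality.\<close>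

lemma abs_powr_add_le:
  assumes "2 < p"
  obtains C where "0 < C"
    "\<And>a b :: real. \<bar>a + b\<bar> powr p \<le> \<bar>a\<bar> powr p + p * signed_powr (p - 1) a * b
      + C * (\<bar>a\<bar> powr (p - 2) * b\<^sup>2 + \<bar>b\<bar> powr p)"
proof
  define C1 where "C1 = (3 powr (p - 1) + 2 powr (p - 1) + (p - 1) * 2 powr (p - 1 - 1) :: real)"
  have C1: "0 < C1" unfolding C1_def using assms by (intro add_pos_pos mult_pos_pos) auto
  show "0 < p * C1" using C1 assms by simp
  fix a b :: real
  have "\<bar>a + b\<bar> powr p + p * signed_powr (p - 1) (a + b) * (a - (a + b)) \<le> \<bar>a\<bar> powr p"
    using assms by (intro abs_powr_above_tangent) auto
  then have "\<bar>a + b\<bar> powr p \<le> \<bar>a\<bar> powr p + p * signed_powr (p - 1) a * b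
      + p * ((signed_powr (p - 1) (a + b) - signed_powr (p - 1) a) * b)"
    by (simp add: algebra_simps)
  also have "(signed_powr (p - 1) (a + b) - signed_powr (p - 1) a) * b
      \<le> \<bar>signed_powr (p - 1) (a + b) - signed_powr (p - 1) a\<bar> * \<bar>b\<bar>"
    using abs_ge_self by (metis abs_mult)
  also have "\<dots> \<le> (C1 * (\<bar>a\<bar> powr (p - 1 - 1) * \<bar>b\<bar> + \<bar>b\<bar> powr (p - 1))) * \<bar>b\<bar>"
    unfolding C1_def using assms by (intro mult_right_mono signed_powr_diff_le) auto
  also have "\<dots> = C1 * (\<bar>a\<bar> powr (p - 2) * b\<^sup>2 + \<bar>b\<bar> powr p)"
    using powr_add[of "\<bar>b\<bar>" "p - 1" 1] by (simp add: algebra_simps power2_eq_square)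
  finally show "\<bar>a + b\<bar> powr p \<le> \<bar>a\<bar> powr p + p * signed_powr (p - 1) a * b
      + (p * C1) * (\<bar>a\<bar> powr (p - 2) * b\<^sup>2 + \<bar>b\<bar> powr p)"
    using assms by (simp add: mult_left_mono mult.assoc)
qed

lemma powr_le_one_plus:
  fixes x s p :: real
  assumes "0 \<le> x" "0 \<le> s" "s \<le> p"
  shows "x powr s \<le> 1 + x powr p"
proof (cases "x \<le> 1")
  case True
  then have "x powr s \<le> 1" using assms powr_mono2[of s x 1] by simp
  then show ?thesis using powr_ge_zero[of x p] by linarith
next
  case False
  then have "x powr s \<le> x powr p" using assms by (intro powr_mono) auto
  then show ?thesis by simp
qed

section \<open>Moments of sums of independent random variables\<close>

context prob_space
begin

lemma integrable_powr_le:
  fixes f :: "'a \<Rightarrow> real"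
  assumes [measurable]: "f \<in> borel_measurable M" and "integrable M (\<lambda>x. \<bar>f x\<bar> powr p)" "0 \<le> s" "s \<le> p"
  shows "integrable M (\<lambda>x. \<bar>f x\<bar> powr s)"
  by (rule Bochner_Integration.integrable_bound[of M "\<lambda>x. 1 + \<bar>f x\<bar> powr p"])
    (use assms powr_le_one_plus[of "\<bar>f _\<bar>" s p] in auto)

text \<open>Lyapunov's inequality: after normalisation by m, the L_p norm of f, Young's inequality
  with weights s/p and 1 - s/p holds pointwise and is integrated. A vanishing norm does not allow
  the normalisation and is treated apart.\<close>

lemma expectation_powr_le:
  fixes f :: "'a \<Rightarrow> real"
  assumes f: "f \<in> borel_measurable M" "integrable M (\<lambda>x. \<bar>f x\<bar> powr p)" and s: "0 < s" "s < p"
  shows "expectation (\<lambda>x. \<bar>f x\<bar> powr s) \<le> expectation (\<lambda>x. \<bar>f x\<bar> powr p) powr (s / p)"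
proof (cases "expectation (\<lambda>x. \<bar>f x\<bar> powr p) = 0")
  case True
  then have "AE x in M. \<bar>f x\<bar> powr p = 0"
    using integral_nonneg_eq_0_iff_AE[OF f(2)] by simp
  then have "AE x in M. \<bar>f x\<bar> powr s = 0" by auto
  then have "expectation (\<lambda>x. \<bar>f x\<bar> powr s) = 0" by (rule integral_eq_zero_AE)
  then show ?thesis by simp
next
  case False
  define m where "m = expectation (\<lambda>x. \<bar>f x\<bar> powr p) powr (1 / p)"
  have mp: "m powr p = expectation (\<lambda>x. \<bar>f x\<bar> powr p)"
    unfolding m_def powr_powr using s by (simp add: Bochner_Integration.integral_nonneg)
  have ms: "m powr s = expectation (\<lambda>x. \<bar>f x\<bar> powr p) powr (s / p)"
    unfolding m_def powr_powr by simp
  have m: "0 < m" using False s unfolding m_def by (simp add: Bochner_Integration.integral_nonneg order_less_le)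
  have le: "\<bar>f x\<bar> powr s \<le> m powr s * ((s / p) * (\<bar>f x\<bar> powr p / m powr p) + (1 - s / p))" for x
  proof (cases "f x = 0")
    case True
    have "0 \<le> m powr s * (1 - s / p)" using s by (intro mult_nonneg_nonneg) auto
    then show ?thesis using True by simp
  next
    case False
    have "(\<bar>f x / m\<bar> powr p) powr (s / p) * 1 powr (1 - s / p) \<le> s / p * \<bar>f x / m\<bar> powr p + (1 - s / p) * 1"
      using s False m by (intro Youngs_inequality_0) auto
    then have "(\<bar>f x\<bar> / m) powr s \<le> s / p * (\<bar>f x\<bar> powr p / m powr p) + (1 - s / p)"
      using m s unfolding powr_powr by (simp add: powr_divide)
    then show ?thesis using m by (simp add: powr_divide field_simps)
  qed
  have "expectation (\<lambda>x. \<bar>f x\<bar> powr s)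
      \<le> expectation (\<lambda>x. m powr s * ((s / p) * (\<bar>f x\<bar> powr p / m powr p) + (1 - s / p)))"
    using f s le by (intro integral_mono integrable_powr_le[OF f]) auto
  also have "\<dots> = m powr s * ((s / p) * (expectation (\<lambda>x. \<bar>f x\<bar> powr p) / m powr p) + (1 - s / p))"
    using f(2) by (simp add: prob_space)
  also have "\<dots> = m powr s" using False unfolding mp by simp
  finally show ?thesis by (simp add: ms)
qed

lemma integrable_of_powr:
  fixes f :: "'a \<Rightarrow> real"
  assumes f: "f \<in> borel_measurable M" "integrable M (\<lambda>x. \<bar>f x\<bar> powr p)" and "1 \<le> p"
  shows "integrable M f"
proof -
  have "integrable M (\<lambda>x. \<bar>f x\<bar> powr 1)" using assms by (intro integrable_powr_le[OF f]) auto
  then show ?thesis using f(1) by (simp add: integrable_abs_iff)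
qed

lemma integrable_square_of_powr:
  fixes f :: "'a \<Rightarrow> real"
  assumes f: "f \<in> borel_measurable M" "integrable M (\<lambda>x. \<bar>f x\<bar> powr p)" and "2 \<le> p"
  shows "integrable M (\<lambda>x. (f x)\<^sup>2)"
  using integrable_powr_le[OF f, of 2] assms(3) by simp

lemma integrable_powr_lc:
  fixes f g :: "'a \<Rightarrow> real"
  assumes [measurable]: "f \<in> borel_measurable M" "g \<in> borel_measurable M"
    and f: "integrable M (\<lambda>x. \<bar>f x\<bar> powr p)" and g: "integrable M (\<lambda>x. \<bar>g x\<bar> powr p)" and p: "0 \<le> p"
  shows "integrable M (\<lambda>x. \<bar>a * f x + b * g x\<bar> powr p)"
    and "expectation (\<lambda>x. \<bar>a * f x + b * g x\<bar> powr p) \<le>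
      2 powr p * (\<bar>a\<bar> powr p * expectation (\<lambda>x. \<bar>f x\<bar> powr p) + \<bar>b\<bar> powr p * expectation (\<lambda>x. \<bar>g x\<bar> powr p))"
proof -
  have le: "\<bar>a * f x + b * g x\<bar> powr p \<le> 2 powr p * (\<bar>a\<bar> powr p * \<bar>f x\<bar> powr p + \<bar>b\<bar> powr p * \<bar>g x\<bar> powr p)" for x
  proof -
    have "\<bar>a * f x + b * g x\<bar> powr p \<le> (2 * max \<bar>a * f x\<bar> \<bar>b * g x\<bar>) powr p"
      using p by (intro powr_mono2) auto
    also have "\<dots> = 2 powr p * max \<bar>a * f x\<bar> \<bar>b * g x\<bar> powr p"
      by (simp add: powr_mult)
    also have "\<dots> \<le> 2 powr p * (\<bar>a * f x\<bar> powr p + \<bar>b * g x\<bar> powr p)"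
      by (intro mult_left_mono) (auto simp: max_def)
    finally show ?thesis by (simp add: abs_mult powr_mult)
  qed
  have int: "integrable M (\<lambda>x. 2 powr p * (\<bar>a\<bar> powr p * \<bar>f x\<bar> powr p + \<bar>b\<bar> powr p * \<bar>g x\<bar> powr p))"
    using f g by auto
  show 1: "integrable M (\<lambda>x. \<bar>a * f x + b * g x\<bar> powr p)"
    by (rule Bochner_Integration.integrable_bound[OF int]) (use le in \<open>auto simp: abs_of_nonneg order_trans[OF powr_ge_zero le]\<close>)
  show "expectation (\<lambda>x. \<bar>a * f x + b * g x\<bar> powr p) \<le>
      2 powr p * (\<bar>a\<bar> powr p * expectation (\<lambda>x. \<bar>f x\<bar> powr p) + \<bar>b\<bar> powr p * expectation (\<lambda>x. \<bar>g x\<bar> powr p))"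
    using integral_mono[OF 1 int le] f g by simp
qed

text \<open>Expectations of the two pointwise expansions. Independence and E Y = 0 remove the
  first-order term and factorise the second-order one, where E|X|^(p-2) is bounded by Lyapunov's
  inequality with exponent (p-2)/p = 1 - 2/p. The constant \<open>C\<close> enters together with its
  pointwise inequality, so that one \<open>C\<close> serves for all terms of a sum.\<close>

lemma indep_powr_add:
  fixes X Y :: "'a \<Rightarrow> real"
  assumes indep: "indep_var borel Y borel X" and p: "2 < p"
    and X: "integrable M (\<lambda>x. \<bar>X x\<bar> powr p)" and Y: "integrable M (\<lambda>x. \<bar>Y x\<bar> powr p)"
    and EY: "expectation Y = 0"
  shows "expectation (\<lambda>x. \<bar>X x\<bar> powr p) + 2 powr (1 - p) * expectation (\<lambda>x. \<bar>Y x\<bar> powr p)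
      \<le> expectation (\<lambda>x. \<bar>X x + Y x\<bar> powr p)"
    and "(\<And>a b :: real. \<bar>a + b\<bar> powr p \<le> \<bar>a\<bar> powr p + p * signed_powr (p - 1) a * b
      + C * (\<bar>a\<bar> powr (p - 2) * b\<^sup>2 + \<bar>b\<bar> powr p)) \<Longrightarrow> 0 \<le> C \<Longrightarrow>
      expectation (\<lambda>x. \<bar>X x + Y x\<bar> powr p) \<le> expectation (\<lambda>x. \<bar>X x\<bar> powr p)
      + C * (expectation (\<lambda>x. \<bar>X x\<bar> powr p) powr (1 - 2 / p) * expectation (\<lambda>x. (Y x)\<^sup>2)
        + expectation (\<lambda>x. \<bar>Y x\<bar> powr p))"
    and "expectation (\<lambda>x. (X x + Y x)\<^sup>2) = expectation (\<lambda>x. (X x)\<^sup>2) + expectation (\<lambda>x. (Y x)\<^sup>2)"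
proof -
  have mX [measurable]: "X \<in> borel_measurable M" and mY [measurable]: "Y \<in> borel_measurable M"
    using indep_var_rv1[OF indep] indep_var_rv2[OF indep] by auto
  have iY: "integrable M Y" and iX: "integrable M X"
    using integrable_of_powr[OF mY Y] integrable_of_powr[OF mX X] p by auto
  have iY2: "integrable M (\<lambda>x. (Y x)\<^sup>2)" and iX2: "integrable M (\<lambda>x. (X x)\<^sup>2)"
    using integrable_square_of_powr[OF mY Y] integrable_square_of_powr[OF mX X] p by auto
  have iXY: "integrable M (\<lambda>x. \<bar>X x + Y x\<bar> powr p)"
    using integrable_powr_lc(1)[OF mX mY X Y, of 1 1] p by simp
  have "integrable M (\<lambda>x. \<bar>X x\<bar> powr (p - 1))"
    using p by (intro integrable_powr_le[OF mX X]) auto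
  then have iS: "integrable M (\<lambda>x. signed_powr (p - 1) (X x))"
    by (rule Bochner_Integration.integrable_bound) (auto simp: abs_signed_powr)
  have iX': "integrable M (\<lambda>x. \<bar>X x\<bar> powr (p - 2))"
    using p by (intro integrable_powr_le[OF mX X]) auto
  have ind1: "indep_var borel Y borel (\<lambda>x. signed_powr (p - 1) (X x))"
    using indep_var_compose[OF indep, of "\<lambda>y. y" borel "signed_powr (p - 1)" borel]
    by (simp add: comp_def)
  have ind2: "indep_var borel (\<lambda>x. (Y x)\<^sup>2) borel (\<lambda>x. \<bar>X x\<bar> powr (p - 2))"
    using indep_var_compose[OF indep, of "\<lambda>y. y\<^sup>2" borel "\<lambda>x. \<bar>x\<bar> powr (p - 2)" borel]
    by (simp add: comp_def)
  have i1: "integrable M (\<lambda>x. signed_powr (p - 1) (X x) * Y x)"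
    and e1: "expectation (\<lambda>x. signed_powr (p - 1) (X x) * Y x) = 0"
    using indep_var_integrable[OF ind1 iY iS] indep_var_lebesgue_integral[OF ind1 iY iS] EY
    by (simp_all add: mult.commute)
  have i2: "integrable M (\<lambda>x. \<bar>X x\<bar> powr (p - 2) * (Y x)\<^sup>2)"
    and e2: "expectation (\<lambda>x. \<bar>X x\<bar> powr (p - 2) * (Y x)\<^sup>2)
        = expectation (\<lambda>x. \<bar>X x\<bar> powr (p - 2)) * expectation (\<lambda>x. (Y x)\<^sup>2)"
    using indep_var_integrable[OF ind2 iY2 iX'] indep_var_lebesgue_integral[OF ind2 iY2 iX']
    by (simp_all add: mult.commute)
  have i3: "integrable M (\<lambda>x. X x * Y x)" and e3: "expectation (\<lambda>x. X x * Y x) = 0"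
    using indep_var_integrable[OF indep iY iX] indep_var_lebesgue_integral[OF indep iY iX] EY
    by (simp_all add: mult.commute)
  have "expectation (\<lambda>x. \<bar>X x\<bar> powr p + p * (signed_powr (p - 1) (X x) * Y x) + 2 powr (1 - p) * \<bar>Y x\<bar> powr p)
      \<le> expectation (\<lambda>x. \<bar>X x + Y x\<bar> powr p)"
  proof (rule integral_mono)
    show "\<bar>X x\<bar> powr p + p * (signed_powr (p - 1) (X x) * Y x) + 2 powr (1 - p) * \<bar>Y x\<bar> powr p
        \<le> \<bar>X x + Y x\<bar> powr p" for x
      using abs_powr_add_ge[of p "X x" "Y x"] p by (simp add: mult.assoc)
  qed (use X Y i1 iXY in auto)
  then show "expectation (\<lambda>x. \<bar>X x\<bar> powr p) + 2 powr (1 - p) * expectation (\<lambda>x. \<bar>Y x\<bar> powr p)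
      \<le> expectation (\<lambda>x. \<bar>X x + Y x\<bar> powr p)"
    using X Y i1 e1 by simp
  have "(\<lambda>x. (X x + Y x)\<^sup>2) = (\<lambda>x. (X x)\<^sup>2 + (Y x)\<^sup>2 + 2 * (X x * Y x))"
    by (auto simp: power2_eq_square algebra_simps)
  then show "expectation (\<lambda>x. (X x + Y x)\<^sup>2) = expectation (\<lambda>x. (X x)\<^sup>2) + expectation (\<lambda>x. (Y x)\<^sup>2)"
    using iX2 iY2 i3 e3 by simp
  assume C: "\<And>a b :: real. \<bar>a + b\<bar> powr p \<le> \<bar>a\<bar> powr p + p * signed_powr (p - 1) a * b
      + C * (\<bar>a\<bar> powr (p - 2) * b\<^sup>2 + \<bar>b\<bar> powr p)" "0 \<le> C"
  have "expectation (\<lambda>x. \<bar>X x + Y x\<bar> powr p)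
      \<le> expectation (\<lambda>x. \<bar>X x\<bar> powr p + p * (signed_powr (p - 1) (X x) * Y x)
        + C * (\<bar>X x\<bar> powr (p - 2) * (Y x)\<^sup>2 + \<bar>Y x\<bar> powr p))"
  proof (rule integral_mono)
    show "\<bar>X x + Y x\<bar> powr p \<le> \<bar>X x\<bar> powr p + p * (signed_powr (p - 1) (X x) * Y x)
        + C * (\<bar>X x\<bar> powr (p - 2) * (Y x)\<^sup>2 + \<bar>Y x\<bar> powr p)" for x
      using C(1)[of "X x" "Y x"] by (simp only: mult.assoc)
  qed (use X Y i1 i2 iXY in auto)
  also have "\<dots> = expectation (\<lambda>x. \<bar>X x\<bar> powr p)
      + C * (expectation (\<lambda>x. \<bar>X x\<bar> powr (p - 2)) * expectation (\<lambda>x. (Y x)\<^sup>2) + expectation (\<lambda>x. \<bar>Y x\<bar> powr p))"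
    using X Y i1 i2 e1 e2 by simp
  also have "\<dots> \<le> expectation (\<lambda>x. \<bar>X x\<bar> powr p)
      + C * (expectation (\<lambda>x. \<bar>X x\<bar> powr p) powr (1 - 2 / p) * expectation (\<lambda>x. (Y x)\<^sup>2) + expectation (\<lambda>x. \<bar>Y x\<bar> powr p))"
  proof -
    have "(p - 2) / p = 1 - 2 / p" using p by (simp add: field_simps)
    then have "expectation (\<lambda>x. \<bar>X x\<bar> powr (p - 2)) \<le> expectation (\<lambda>x. \<bar>X x\<bar> powr p) powr (1 - 2 / p)"
      using expectation_powr_le[OF mX X, of "p - 2"] p by simp
    then show ?thesis
      using C(2) by (intro add_left_mono mult_left_mono add_right_mono mult_right_mono) auto
  qed
  finally show "expectation (\<lambda>x. \<bar>X x + Y x\<bar> powr p) \<le> expectation (\<lambda>x. \<bar>X x\<bar> powr p)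
      + C * (expectation (\<lambda>x. \<bar>X x\<bar> powr p) powr (1 - 2 / p) * expectation (\<lambda>x. (Y x)\<^sup>2)
        + expectation (\<lambda>x. \<bar>Y x\<bar> powr p))" .
qed

lemma integrable_powr_sum:
  fixes X :: "'i \<Rightarrow> 'a \<Rightarrow> real"
  assumes "finite J" "\<And>i. i \<in> J \<Longrightarrow> X i \<in> borel_measurable M"
    "\<And>i. i \<in> J \<Longrightarrow> integrable M (\<lambda>x. \<bar>X i x\<bar> powr p)" "0 < p"
  shows "integrable M (\<lambda>x. \<bar>\<Sum>i\<in>J. X i x\<bar> powr p)"
  using assms
proof (induction J rule: finite_induct)
  case (insert i J)
  then show ?case
    using integrable_powr_lc(1)[of "X i" "\<lambda>x. \<Sum>j\<in>J. X j x" p 1 1] by auto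
qed simp

text \<open>Adding one variable leaves the moment of the partial sum with coefficient 1 and
  contributes 2^(1-p) times the moment of the new variable, so the constant does not deteriorate
  with the number of terms.\<close>

lemma rosenthal_lower_and_orthogonality:
  fixes X :: "'i \<Rightarrow> 'a \<Rightarrow> real"
  assumes "finite J" "indep_vars (\<lambda>_. borel) X J" "2 < p"
    "\<And>i. i \<in> J \<Longrightarrow> integrable M (\<lambda>x. \<bar>X i x\<bar> powr p)" "\<And>i. i \<in> J \<Longrightarrow> expectation (X i) = 0"
  shows "2 powr (1 - p) * (\<Sum>i\<in>J. expectation (\<lambda>x. \<bar>X i x\<bar> powr p)) \<le> expectation (\<lambda>x. \<bar>\<Sum>i\<in>J. X i x\<bar> powr p)
    \<and> expectation (\<lambda>x. (\<Sum>i\<in>J. X i x)\<^sup>2) = (\<Sum>i\<in>J. expectation (\<lambda>x. (X i x)\<^sup>2))"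
  using assms
proof (induction J rule: finite_induct)
  case empty
  show ?case by simp
next
  case (insert i J)
  have m: "X j \<in> borel_measurable M" if "j \<in> insert i J" for j
    using insert.prems(1) that unfolding indep_vars_def by blast
  have indJ: "indep_vars (\<lambda>_. borel) X J" using insert.prems(1) by (rule indep_vars_subset) auto
  have iS: "integrable M (\<lambda>x. \<bar>\<Sum>i\<in>J. X i x\<bar> powr p)"
    by (rule integrable_powr_sum[OF insert.hyps(1) m insert.prems(3)]) (use \<open>2 < p\<close> in auto)
  note step = indep_powr_add[OF indep_vars_sum[OF insert.hyps insert.prems(1)] \<open>2 < p\<close> iS
      insert.prems(3)[of i] insert.prems(4)[of i]]
  have eq: "(\<Sum>j\<in>insert i J. X j x) = (\<Sum>j\<in>J. X j x) + X i x" for x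
    using insert.hyps by (simp add: add.commute)
  have IH: "2 powr (1 - p) * (\<Sum>i\<in>J. expectation (\<lambda>x. \<bar>X i x\<bar> powr p)) \<le> expectation (\<lambda>x. \<bar>\<Sum>i\<in>J. X i x\<bar> powr p)
    \<and> expectation (\<lambda>x. (\<Sum>i\<in>J. X i x)\<^sup>2) = (\<Sum>i\<in>J. expectation (\<lambda>x. (X i x)\<^sup>2))"
    by (rule insert.IH[OF indJ \<open>2 < p\<close> insert.prems(3,4)[OF insertI2]])
  show ?case
    unfolding eq sum.insert[OF insert.hyps] distrib_left
  proof
    show "2 powr (1 - p) * expectation (\<lambda>x. \<bar>X i x\<bar> powr p) + 2 powr (1 - p) * (\<Sum>i\<in>J. expectation (\<lambda>x. \<bar>X i x\<bar> powr p))
        \<le> expectation (\<lambda>x. \<bar>(\<Sum>j\<in>J. X j x) + X i x\<bar> powr p)"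
      by (rule order_trans[OF add_left_mono[OF conjunct1[OF IH]]], subst add.commute)
        (rule step(1)[OF insertI1 insertI1])
    show "expectation (\<lambda>x. ((\<Sum>j\<in>J. X j x) + X i x)\<^sup>2)
        = expectation (\<lambda>x. (X i x)\<^sup>2) + (\<Sum>i\<in>J. expectation (\<lambda>x. (X i x)\<^sup>2))"
      unfolding step(3)[OF insertI1 insertI1] conjunct2[OF IH] by (rule add.commute)
  qed
qed

text \<open>
  The number \<open>A\<close> is a barrier: as long as the $p$-th moment of a partial sum is at most \<open>A\<close>, adding
  one more term increases it by a multiple of its share of \<open>Q\<close> and \<open>\<Phi>\<close>, and all shares together
  do not exceed \<open>A\<close>.
\<close>

lemma rosenthal_upper_aux:
  fixes X :: "'i \<Rightarrow> 'a \<Rightarrow> real"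
  assumes "finite J" "indep_vars (\<lambda>_. borel) X J" "2 < p"
    "\<And>i. i \<in> J \<Longrightarrow> integrable M (\<lambda>x. \<bar>X i x\<bar> powr p)" "\<And>i. i \<in> J \<Longrightarrow> expectation (X i) = 0"
    and C: "\<And>a b :: real. \<bar>a + b\<bar> powr p \<le> \<bar>a\<bar> powr p + p * signed_powr (p - 1) a * b
      + C * (\<bar>a\<bar> powr (p - 2) * b\<^sup>2 + \<bar>b\<bar> powr p)" "0 < C"
    and A: "C * (A powr (1 - 2 / p) * Q + \<Phi>) \<le> A"
    and Q: "(\<Sum>i\<in>J. expectation (\<lambda>x. (X i x)\<^sup>2)) \<le> Q"
    and \<Phi>: "(\<Sum>i\<in>J. expectation (\<lambda>x. \<bar>X i x\<bar> powr p)) \<le> \<Phi>"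
  shows "expectation (\<lambda>x. \<bar>\<Sum>i\<in>J. X i x\<bar> powr p) \<le>
    C * (A powr (1 - 2 / p) * (\<Sum>i\<in>J. expectation (\<lambda>x. (X i x)\<^sup>2)) + (\<Sum>i\<in>J. expectation (\<lambda>x. \<bar>X i x\<bar> powr p)))"
  using assms(1-5) Q \<Phi>
proof (induction J rule: finite_induct)
  case empty
  show ?case by simp
next
  case (insert i J)
  let ?q = "\<lambda>i. expectation (\<lambda>x. (X i x)\<^sup>2)" and ?f = "\<lambda>i. expectation (\<lambda>x. \<bar>X i x\<bar> powr p)"
  have m: "X j \<in> borel_measurable M" if "j \<in> insert i J" for j
    using insert.prems(1) that unfolding indep_vars_def by blast
  have indJ: "indep_vars (\<lambda>_. borel) X J" using insert.prems(1) by (rule indep_vars_subset) auto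
  have iS: "integrable M (\<lambda>x. \<bar>\<Sum>i\<in>J. X i x\<bar> powr p)"
    by (rule integrable_powr_sum[OF insert.hyps(1) m insert.prems(3)]) (use \<open>2 < p\<close> in auto)
  note step = indep_powr_add[OF indep_vars_sum[OF insert.hyps insert.prems(1)] \<open>2 < p\<close> iS
      insert.prems(3)[of i] insert.prems(4)[of i]]
  have eq: "(\<Sum>j\<in>insert i J. X j x) = (\<Sum>j\<in>J. X j x) + X i x" for x
    using insert.hyps by (simp add: add.commute)
  have q0: "0 \<le> ?q i" "0 \<le> ?f i" by (auto intro: Bochner_Integration.integral_nonneg)
  have QJ: "sum ?q J \<le> Q" "sum ?f J \<le> \<Phi>"
    by (rule order_trans[OF add_increasing[OF q0(1) order_refl]],
        rule insert.prems(5)[unfolded sum.insert[OF insert.hyps]])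
      (rule order_trans[OF add_increasing[OF q0(2) order_refl]],
        rule insert.prems(6)[unfolded sum.insert[OF insert.hyps]])
  have IH: "expectation (\<lambda>x. \<bar>\<Sum>i\<in>J. X i x\<bar> powr p) \<le> C * (A powr (1 - 2 / p) * sum ?q J + sum ?f J)"
    by (rule insert.IH[OF indJ \<open>2 < p\<close> insert.prems(3,4)[OF insertI2] QJ])
  also have "\<dots> \<le> C * (A powr (1 - 2 / p) * Q + \<Phi>)"
    using QJ C(2) by (intro mult_left_mono add_mono) auto
  also have "\<dots> \<le> A" by (rule A)
  finally have "expectation (\<lambda>x. \<bar>\<Sum>i\<in>J. X i x\<bar> powr p) powr (1 - 2 / p) \<le> A powr (1 - 2 / p)"
    using \<open>2 < p\<close> by (intro powr_mono2) (auto intro: Bochner_Integration.integral_nonneg)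
  then have *: "C * (expectation (\<lambda>x. \<bar>\<Sum>i\<in>J. X i x\<bar> powr p) powr (1 - 2 / p) * ?q i + ?f i)
      \<le> C * (A powr (1 - 2 / p) * ?q i + ?f i)"
    using q0 C(2) by (intro mult_left_mono add_right_mono mult_right_mono) auto
  have "expectation (\<lambda>x. \<bar>\<Sum>j\<in>insert i J. X j x\<bar> powr p)
      \<le> expectation (\<lambda>x. \<bar>\<Sum>i\<in>J. X i x\<bar> powr p)
        + C * (expectation (\<lambda>x. \<bar>\<Sum>i\<in>J. X i x\<bar> powr p) powr (1 - 2 / p) * ?q i + ?f i)"
    unfolding eq by (rule step(2)[OF insertI1 insertI1 C(1) less_imp_le[OF C(2)]])
  also have "\<dots> \<le> C * (A powr (1 - 2 / p) * sum ?q J + sum ?f J) + C * (A powr (1 - 2 / p) * ?q i + ?f i)"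
    using IH * by (rule add_mono)
  also have "\<dots> = C * (A powr (1 - 2 / p) * sum ?q (insert i J) + sum ?f (insert i J))"
    unfolding sum.insert[OF insert.hyps] by (simp only: distrib_left ac_simps)
  finally show ?case .
qed

end

text \<open>The constant is obtained before the measure, the family and its size are chosen; this
  uniformity is what the infinite sums rely on.\<close>

lemma rosenthal_upper:
  assumes p: "2 < p"
  obtains K where "1 \<le> K"
    "\<And>(M :: 'a measure) (X :: 'i \<Rightarrow> 'a \<Rightarrow> real) J. prob_space M \<Longrightarrow> finite J \<Longrightarrow>
      prob_space.indep_vars M (\<lambda>_. borel) X J \<Longrightarrow>
      (\<And>i. i \<in> J \<Longrightarrow> integrable M (\<lambda>x. \<bar>X i x\<bar> powr p)) \<Longrightarrow> (\<And>i. i \<in> J \<Longrightarrow> integral\<^sup>L M (X i) = 0) \<Longrightarrow>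
      (\<integral>x. \<bar>\<Sum>i\<in>J. X i x\<bar> powr p \<partial>M) \<le>
        K * ((\<Sum>i\<in>J. \<integral>x. \<bar>X i x\<bar> powr p \<partial>M) + (\<Sum>i\<in>J. \<integral>x. (X i x)\<^sup>2 \<partial>M) powr (p / 2))"
proof -
  obtain C where C: "0 < C" "\<And>a b :: real. \<bar>a + b\<bar> powr p \<le> \<bar>a\<bar> powr p + p * signed_powr (p - 1) a * b
      + C * (\<bar>a\<bar> powr (p - 2) * b\<^sup>2 + \<bar>b\<bar> powr p)"
    using abs_powr_add_le[OF p] by blast
  define K where "K = 1 + 2 * C + (2 * C) powr (p / 2)"
  have "1 \<le> K" unfolding K_def using C(1) by (simp add: add_nonneg_nonneg)
  moreover have "(\<integral>x. \<bar>\<Sum>i\<in>J. X i x\<bar> powr p \<partial>M) \<le>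
        K * ((\<Sum>i\<in>J. \<integral>x. \<bar>X i x\<bar> powr p \<partial>M) + (\<Sum>i\<in>J. \<integral>x. (X i x)\<^sup>2 \<partial>M) powr (p / 2))"
    if "prob_space M" "finite J" "prob_space.indep_vars M (\<lambda>_. borel) X J"
      "\<And>i. i \<in> J \<Longrightarrow> integrable M (\<lambda>x. \<bar>X i x\<bar> powr p)" "\<And>i. i \<in> J \<Longrightarrow> integral\<^sup>L M (X i) = 0"
    for M :: "'a measure" and X :: "'i \<Rightarrow> 'a \<Rightarrow> real" and J
  proof -
    interpret prob_space M by fact
    define \<Phi> where "\<Phi> = (\<Sum>i\<in>J. \<integral>x. \<bar>X i x\<bar> powr p \<partial>M)"
    define Q where "Q = (\<Sum>i\<in>J. \<integral>x. (X i x)\<^sup>2 \<partial>M)"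
    have nn: "0 \<le> \<Phi>" "0 \<le> Q" unfolding \<Phi>_def Q_def by (auto intro!: sum_nonneg Bochner_Integration.integral_nonneg)
    \<comment> \<open>Chosen so that the two parts of the barrier condition, C * A^(1-2/p) * Q and C
      * \<Phi>, are at most A/2 each. For the first this amounts to 2CQ \<le> A^(2/p), which the
      second summand of \<open>A\<close> ensures.\<close>
    define A where "A = 2 * C * \<Phi> + (2 * C * Q) powr (p / 2)"
    have A0: "0 \<le> A" unfolding A_def using nn C by simp
    have "2 * C * Q = ((2 * C * Q) powr (p / 2)) powr (2 / p)"
      unfolding powr_powr using nn C p by simp
    also have "\<dots> \<le> A powr (2 / p)"
      unfolding A_def using nn C p by (intro powr_mono2) auto
    finally have "A powr (1 - 2 / p) * (2 * C * Q) \<le> A powr (1 - 2 / p) * A powr (2 / p)"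
      by (intro mult_left_mono) auto
    also have "\<dots> = A" using A0 by (simp add: powr_add[symmetric])
    finally have "C * (A powr (1 - 2 / p) * Q) \<le> A / 2" by (simp add: algebra_simps)
    moreover have "C * \<Phi> \<le> A / 2" unfolding A_def by simp
    ultimately have A: "C * (A powr (1 - 2 / p) * Q + \<Phi>) \<le> A" by (simp add: algebra_simps)
    have "(\<integral>x. \<bar>\<Sum>i\<in>J. X i x\<bar> powr p \<partial>M) \<le> C * (A powr (1 - 2 / p) * Q + \<Phi>)"
      unfolding Q_def \<Phi>_def
      by (rule rosenthal_upper_aux[OF that(2,3) p that(4,5) C(2) C(1) A]) (auto simp: Q_def \<Phi>_def)
    also have "\<dots> \<le> A" by (rule A)
    also have "\<dots> \<le> K * (\<Phi> + Q powr (p / 2))"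
    proof -
      have "A = 2 * C * \<Phi> + (2 * C) powr (p / 2) * Q powr (p / 2)"
        unfolding A_def using nn C by (simp add: powr_mult)
      also have "\<dots> \<le> K * \<Phi> + K * Q powr (p / 2)"
        unfolding K_def using nn C by (intro add_mono mult_right_mono) (auto simp: add_nonneg_nonneg)
      finally show ?thesis by (simp add: distrib_left)
    qed
    finally show ?thesis unfolding Q_def \<Phi>_def .
  qed
  ultimately show thesis by (rule that)
qed

section \<open>Subspaces of $L_p$\<close>

lemma lin_span_base: "g \<in> G \<Longrightarrow> g \<in> lin_span G"
  unfolding lin_span_def by (rule CollectI, rule exI[of _ 1], rule exI[of _ "\<lambda>_. 1"], rule exI[of _ "\<lambda>_. g"]) auto

lemma lin_span_lc:
  assumes "h \<in> lin_span G" "h' \<in> lin_span G"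
  shows "(\<lambda>x. a * h x + b * h' x) \<in> lin_span G"
proof -
  obtain n :: nat and c g where h: "\<forall>i<n. g i \<in> G" "h = (\<lambda>x. \<Sum>i<n. c i * g i x)"
    using assms(1) unfolding lin_span_def by blast
  obtain m :: nat and c' g' where h': "\<forall>i<m. g' i \<in> G" "h' = (\<lambda>x. \<Sum>i<m. c' i * g' i x)"
    using assms(2) unfolding lin_span_def by blast
  define k where "k i = (if i < n then g i else g' (i - n))" for i
  define d where "d i = (if i < n then a * c i else b * c' (i - n))" for i
  have "(\<Sum>i<n + m. d i * k i x) = a * h x + b * h' x" for x
  proof -
    have "(\<Sum>i<n + m. d i * k i x) = (\<Sum>i<n. d i * k i x) + (\<Sum>i=n..<n+m. d i * k i x)"
      using sum.atLeastLessThan_concat[of 0 n "n + m" "\<lambda>i. d i * k i x"] by (simp add: lessThan_atLeast0)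
    also have "(\<Sum>i=n..<n+m. d i * k i x) = (\<Sum>i<m. d (i + n) * k (i + n) x)"
      using sum.shift_bounds_nat_ivl[of "\<lambda>i. d i * k i x" 0 n m] by (simp add: lessThan_atLeast0 add.commute)
    also have "\<dots> = b * h' x"
      unfolding h'(2) d_def k_def by (simp add: sum_distrib_left mult.assoc)
    also have "(\<Sum>i<n. d i * k i x) = a * h x"
      unfolding h(2) d_def k_def by (simp add: sum_distrib_left mult.assoc)
    finally show ?thesis .
  qed
  then have "(\<lambda>x. a * h x + b * h' x) = (\<lambda>x. \<Sum>i<n + m. d i * k i x)" by simp
  moreover have "\<forall>i<n + m. k i \<in> G" using h h' by (auto simp: k_def)
  ultimately show ?thesis unfolding lin_span_def by blast
qed

lemma lin_span_zero: "(\<lambda>_. 0) \<in> lin_span G"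
  unfolding lin_span_def by (rule CollectI, rule exI[of _ 0]) auto

lemma lin_span_minimal:
  assumes "G \<subseteq> S" "(\<lambda>_. 0) \<in> S" "\<And>f g a b. f \<in> S \<Longrightarrow> g \<in> S \<Longrightarrow> (\<lambda>x. a * f x + b * g x) \<in> S"
  shows "lin_span G \<subseteq> S"
proof
  fix h assume "h \<in> lin_span G"
  then obtain n :: nat and c g where h: "\<forall>i<n. g i \<in> G" "h = (\<lambda>x. \<Sum>i<n. c i * g i x)"
    unfolding lin_span_def by blast
  have "m \<le> n \<Longrightarrow> (\<lambda>x. \<Sum>i<m. c i * g i x) \<in> S" for m
  proof (induction m)
    case (Suc m)
    then have "(\<lambda>x. 1 * (\<Sum>i<m. c i * g i x) + c m * g m x) \<in> S"
      using h assms(1) by (intro assms(3)) auto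
    then show ?case by simp
  qed (use assms in simp)
  then show "h \<in> S" using h by auto
qed

lemma integral_embed_measure:
  fixes f :: "'b \<Rightarrow> real"
  assumes "inj j" "(\<lambda>x. f (j x)) \<in> borel_measurable M"
  shows "(\<integral>x. f x \<partial>embed_measure M j) = (\<integral>x. f (j x) \<partial>M)"
    and "integrable (embed_measure M j) f \<longleftrightarrow> integrable M (\<lambda>x. f (j x))"
proof -
  have f: "f \<in> borel_measurable (embed_measure M j)"
    using assms(2) by (rule measurable_embed_measure1)
  have j: "j \<in> measurable M (embed_measure M j)" using assms(1) by (rule measurable_embed_measure2)
  show "(\<integral>x. f x \<partial>embed_measure M j) = (\<integral>x. f (j x) \<partial>M)"
    by (subst embed_measure_eq_distr[OF assms(1)]) (rule integral_distr[OF j f])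
  show "integrable (embed_measure M j) f \<longleftrightarrow> integrable M (\<lambda>x. f (j x))"
    by (subst embed_measure_eq_distr[OF assms(1)]) (rule integrable_distr_eq[OF j f])
qed

section \<open>Moments of order p and completeness of L_p\<close>

context exponent
begin

lemma Lp_iff: "f \<in> Lp p M \<longleftrightarrow> f \<in> borel_measurable M \<and> integrable M (\<lambda>x. \<bar>f x\<bar> powr p)"
  by (simp add: Lp_def)

lemma Lp_lc:
  assumes "prob_space M" "f \<in> Lp p M" "g \<in> Lp p M"
  shows "(\<lambda>x. a * f x + b * g x) \<in> Lp p M"
  using prob_space.integrable_powr_lc(1)[OF assms(1), of f g p a b] assms(2,3) p_gt_2
  by (auto simp: Lp_iff)

lemma Lp_diff:
  assumes "prob_space M" "f \<in> Lp p M" "g \<in> Lp p M"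
  shows "(\<lambda>x. f x - g x) \<in> Lp p M"
  using Lp_lc[OF assms, of 1 "-1"] by simp

lemma Lp_const: "prob_space M \<Longrightarrow> (\<lambda>_. c) \<in> Lp p M"
  using finite_measure.integrable_const[of M "\<bar>c\<bar> powr p"] by (simp add: Lp_iff prob_space_def)

lemma Lp_integrable:
  assumes "prob_space M" "f \<in> Lp p M"
  shows "integrable M f"
  by (rule prob_space.integrable_of_powr[OF assms(1), where p = p])
    (use assms(2) p_gt_2 in \<open>simp_all add: Lp_iff\<close>)

lemma Lp_integrable_square:
  assumes "prob_space M" "f \<in> Lp p M"
  shows "integrable M (\<lambda>x. (f x)\<^sup>2)"
  by (rule prob_space.integrable_square_of_powr[OF assms(1), where p = p])
    (use assms(2) p_gt_2 in \<open>simp_all add: Lp_iff\<close>)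

definition pmom :: "'a measure \<Rightarrow> ('a \<Rightarrow> real) \<Rightarrow> real" where
  "pmom M f = (\<integral>x. \<bar>f x\<bar> powr p \<partial>M)"

lemma pmom_nonneg [simp]: "0 \<le> pmom M f"
  unfolding pmom_def by (rule Bochner_Integration.integral_nonneg) simp

lemma pmom_lc:
  assumes "prob_space M" "f \<in> Lp p M" "g \<in> Lp p M"
  shows "pmom M (\<lambda>x. a * f x + b * g x) \<le> 2 powr p * (\<bar>a\<bar> powr p * pmom M f + \<bar>b\<bar> powr p * pmom M g)"
  using prob_space.integrable_powr_lc(2)[OF assms(1), of f g p a b] assms(2,3) p_gt_2
  by (auto simp: Lp_iff pmom_def)

lemma pmom_add:
  assumes "prob_space M" "f \<in> Lp p M" "g \<in> Lp p M"
  shows "pmom M (\<lambda>x. f x + g x) \<le> 2 powr p * (pmom M f + pmom M g)"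
  using pmom_lc[OF assms, of 1 1] by simp

lemma pmom_diff_commute: "pmom M (\<lambda>x. f x - g x) = pmom M (\<lambda>x. g x - f x)"
  unfolding pmom_def by (simp add: abs_minus_commute)

lemma pmom_const: "prob_space M \<Longrightarrow> pmom M (\<lambda>_. c) = \<bar>c\<bar> powr p"
  by (simp add: pmom_def prob_space.prob_space)

lemma Lp_norm_eq: "Lp_norm p M f = pmom M f powr (1 / p)"
  by (simp add: Lp_norm_def pmom_def)

lemma square_le_pmom:
  assumes "prob_space M" "f \<in> Lp p M"
  shows "(\<integral>x. (f x)\<^sup>2 \<partial>M) powr (p / 2) \<le> pmom M f"
proof -
  have "(\<integral>x. (f x)\<^sup>2 \<partial>M) \<le> pmom M f powr (2 / p)"
    using prob_space.expectation_powr_le[OF assms(1), of f p 2] assms(2) p_gt_2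
    by (simp add: Lp_iff pmom_def)
  then have "(\<integral>x. (f x)\<^sup>2 \<partial>M) powr (p / 2) \<le> (pmom M f powr (2 / p)) powr (p / 2)"
    using p_gt_2 by (intro powr_mono2) (auto intro: Bochner_Integration.integral_nonneg)
  also have "\<dots> = pmom M f" unfolding powr_powr using p_gt_2 by simp
  finally show ?thesis .
qed

lemma abs_integral_le_pmom:
  assumes "prob_space M" "f \<in> Lp p M"
  shows "\<bar>\<integral>x. f x \<partial>M\<bar> powr p \<le> pmom M f"
proof -
  have "\<bar>\<integral>x. f x \<partial>M\<bar> \<le> (\<integral>x. \<bar>f x\<bar> \<partial>M)" by (rule integral_abs_bound)
  also have "\<dots> \<le> pmom M f powr (1 / p)"
    using prob_space.expectation_powr_le[OF assms(1), of f p 1] assms(2) p_gt_2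
    by (simp add: Lp_iff pmom_def)
  finally have "\<bar>\<integral>x. f x \<partial>M\<bar> powr p \<le> (pmom M f powr (1 / p)) powr p"
    using p_gt_2 by (intro powr_mono2) auto
  also have "\<dots> = pmom M f" unfolding powr_powr using p_gt_2 by simp
  finally show ?thesis .
qed

lemma pmom_cong_AE:
  assumes "f \<in> borel_measurable M" "g \<in> borel_measurable M" "AE x in M. f x = g x"
  shows "pmom M f = pmom M g"
  unfolding pmom_def by (rule integral_cong_AE) (use assms in auto)

lemma Lp_cong_AE:
  assumes "f \<in> Lp p M" "g \<in> borel_measurable M" "AE x in M. f x = g x"
  shows "g \<in> Lp p M"
proof -
  have "integrable M (\<lambda>x. \<bar>f x\<bar> powr p) \<longleftrightarrow> integrable M (\<lambda>x. \<bar>g x\<bar> powr p)"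
    by (rule integrable_cong_AE) (use assms in \<open>auto simp: Lp_iff\<close>)
  then show ?thesis using assms by (simp add: Lp_iff)
qed

text \<open>The Riesz-Fischer theorem. A subsequence whose consecutive differences have L_1 norms at
  most 2^(-k) converges almost everywhere, and Fatou's lemma along it turns the Cauchy condition
  into convergence of the p-th moments.\<close>

lemma Lp_complete:
  assumes M: "prob_space M" and u: "\<And>n. u n \<in> Lp p M"
    and cauchy: "\<And>\<epsilon>. 0 < \<epsilon> \<Longrightarrow> \<exists>N. \<forall>m\<ge>N. \<forall>n\<ge>N. pmom M (\<lambda>x. u m x - u n x) < \<epsilon>"
  obtains f where "f \<in> Lp p M" "(\<lambda>n. pmom M (\<lambda>x. u n x - f x)) \<longlonglongrightarrow> 0"
proof -
  interpret prob_space M by fact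
  have um [measurable]: "u n \<in> borel_measurable M" for n using u[of n] by (simp add: Lp_iff)
  have d: "(\<lambda>x. u m x - u n x) \<in> Lp p M" for m n by (intro Lp_diff M u)
  have "\<forall>k. \<exists>N. \<forall>m\<ge>N. \<forall>n\<ge>N. pmom M (\<lambda>x. u m x - u n x) < ((1/2) ^ k) powr p"
    using cauchy by simp
  then obtain N where N: "\<And>k m n. m \<ge> N k \<Longrightarrow> n \<ge> N k \<Longrightarrow> pmom M (\<lambda>x. u m x - u n x) < ((1/2) ^ k) powr p"
    by metis
  \<comment> \<open>Summing the indices makes r increasing; it dominates N(k) by construction, and
    the added k makes it unbounded.\<close>
  define r where "r k = (\<Sum>i\<le>k. N i) + k" for k
  have r: "r k \<ge> N k" "r (Suc k) \<ge> r k" "r k \<ge> k" for k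
    unfolding r_def by (auto intro: trans_le_add1 member_le_sum)
  have "(\<integral>x. \<bar>u (r (Suc k)) x - u (r k) x\<bar> \<partial>M) \<le> (1/2) ^ k" for k
  proof -
    have "(\<integral>x. \<bar>u (r (Suc k)) x - u (r k) x\<bar> \<partial>M) \<le> pmom M (\<lambda>x. u (r (Suc k)) x - u (r k) x) powr (1 / p)"
      using expectation_powr_le[of "\<lambda>x. u (r (Suc k)) x - u (r k) x" p 1] d[of "r (Suc k)" "r k"] p_gt_2
      by (simp add: Lp_iff pmom_def)
    also have "\<dots> \<le> (((1/2) ^ k) powr p) powr (1 / p)"
      using N[of k "r (Suc k)" "r k"] r[of k] p_gt_2 by (intro powr_mono2) auto
    also have "\<dots> = (1/2) ^ k" unfolding powr_powr using p_gt_2 by simp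
    finally show ?thesis .
  qed
  note L1 = this
  have "(\<integral>\<^sup>+x. (\<Sum>k. ennreal \<bar>u (r (Suc k)) x - u (r k) x\<bar>) \<partial>M)
      = (\<Sum>k. \<integral>\<^sup>+x. ennreal \<bar>u (r (Suc k)) x - u (r k) x\<bar> \<partial>M)"
    by (rule nn_integral_suminf) measurable
  also have "\<dots> = (\<Sum>k. ennreal (\<integral>x. \<bar>u (r (Suc k)) x - u (r k) x\<bar> \<partial>M))"
    using Lp_integrable[OF M d] by (intro suminf_cong nn_integral_eq_integral) auto
  also have "\<dots> \<le> (\<Sum>k. ennreal ((1/2) ^ k))"
    using L1 by (intro suminf_le ennreal_leI) auto
  also have "\<dots> = ennreal (\<Sum>k. (1/2) ^ k)"
    by (rule suminf_ennreal2) (auto intro: summable_geometric)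
  also have "\<dots> < \<infinity>" by simp
  finally have "(\<integral>\<^sup>+x. (\<Sum>k. ennreal \<bar>u (r (Suc k)) x - u (r k) x\<bar>) \<partial>M) \<noteq> \<infinity>" by simp
  then have "AE x in M. (\<Sum>k. ennreal \<bar>u (r (Suc k)) x - u (r k) x\<bar>) \<noteq> \<infinity>"
    by (intro nn_integral_noteq_infinite) auto
  then have AE_lim: "AE x in M. (\<lambda>k. u (r k) x) \<longlonglongrightarrow> lim (\<lambda>k. u (r k) x)"
  proof eventually_elim
    case (elim x)
    then have "summable (\<lambda>k. \<bar>u (r (Suc k)) x - u (r k) x\<bar>)"
      by (intro summable_suminf_not_top) auto
    then have "summable (\<lambda>k. u (r (Suc k)) x - u (r k) x)" by (rule summable_rabs_cancel)
    then have "(\<lambda>n. \<Sum>k<n. u (r (Suc k)) x - u (r k) x) \<longlonglongrightarrow> (\<Sum>k. u (r (Suc k)) x - u (r k) x)"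
      by (rule summable_LIMSEQ)
    then have "(\<lambda>n. u (r n) x - u (r 0) x) \<longlonglongrightarrow> (\<Sum>k. u (r (Suc k)) x - u (r k) x)"
      unfolding sum_lessThan_telescope[of "\<lambda>k. u (r k) x"] .
    from tendsto_add[OF this tendsto_const[of "u (r 0) x"]]
    have "convergent (\<lambda>k. u (r k) x)" by (auto simp: convergent_def)
    then show ?case by (simp add: convergent_LIMSEQ_iff)
  qed
  \<comment> \<open>\<open>lim\<close> is measurable in x; on the null set where the subsequence
    diverges its value is arbitrary.\<close>
  define f where "f x = lim (\<lambda>k. u (r k) x)" for x
  have fm [measurable]: "f \<in> borel_measurable M" unfolding f_def[abs_def] by measurable
  have fatou: "(\<integral>\<^sup>+x. ennreal (\<bar>u n x - f x\<bar> powr p) \<partial>M) \<le> ennreal \<epsilon>"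
    if N': "\<forall>m\<ge>N'. \<forall>n\<ge>N'. pmom M (\<lambda>x. u m x - u n x) < \<epsilon>" and n: "n \<ge> N'"
    for n \<epsilon> N'
  proof -
    have "AE x in M. ennreal (\<bar>u n x - f x\<bar> powr p) = liminf (\<lambda>k. ennreal (\<bar>u n x - u (r k) x\<bar> powr p))"
      using AE_lim
    proof eventually_elim
      case (elim x)
      then have "(\<lambda>k. \<bar>u n x - u (r k) x\<bar> powr p) \<longlonglongrightarrow> \<bar>u n x - f x\<bar> powr p"
        unfolding f_def using p_gt_2 by (intro tendsto_powr' tendsto_intros) auto
      then have "(\<lambda>k. ennreal (\<bar>u n x - u (r k) x\<bar> powr p)) \<longlonglongrightarrow> ennreal (\<bar>u n x - f x\<bar> powr p)"
        by (rule tendsto_ennrealI)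
      then show ?case by (intro lim_imp_Liminf[symmetric]) auto
    qed
    then have "(\<integral>\<^sup>+x. ennreal (\<bar>u n x - f x\<bar> powr p) \<partial>M)
        = (\<integral>\<^sup>+x. liminf (\<lambda>k. ennreal (\<bar>u n x - u (r k) x\<bar> powr p)) \<partial>M)"
      by (rule nn_integral_cong_AE)
    also have "\<dots> \<le> liminf (\<lambda>k. \<integral>\<^sup>+x. ennreal (\<bar>u n x - u (r k) x\<bar> powr p) \<partial>M)"
      by (rule nn_integral_liminf) measurable
    also have "\<dots> = liminf (\<lambda>k. ennreal (pmom M (\<lambda>x. u n x - u (r k) x)))"
      using d unfolding pmom_def by (subst nn_integral_eq_integral) (auto simp: Lp_iff)
    also have "\<dots> \<le> liminf (\<lambda>k. ennreal \<epsilon>)"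
    proof (rule Liminf_mono)
      show "\<forall>\<^sub>F k in sequentially. ennreal (pmom M (\<lambda>x. u n x - u (r k) x)) \<le> ennreal \<epsilon>"
        unfolding eventually_sequentially
      proof (intro exI[of _ N'] allI impI ennreal_leI less_imp_le)
        fix k assume "N' \<le> k"
        then have "N' \<le> r k" using r(3)[of k] by simp
        then show "pmom M (\<lambda>x. u n x - u (r k) x) < \<epsilon>" using N' n by blast
      qed
    qed
    also have "\<dots> = ennreal \<epsilon>" by (simp add: Liminf_const)
    finally show ?thesis .
  qed
  have bound: "(\<lambda>x. u n x - f x) \<in> Lp p M \<and> pmom M (\<lambda>x. u n x - f x) \<le> \<epsilon>"
    if N': "\<forall>m\<ge>N'. \<forall>n\<ge>N'. pmom M (\<lambda>x. u m x - u n x) < \<epsilon>" and n: "n \<ge> N'" for n \<epsilon> N'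
  proof
    have le: "(\<integral>\<^sup>+x. ennreal (\<bar>u n x - f x\<bar> powr p) \<partial>M) \<le> ennreal \<epsilon>" by (rule fatou[OF that])
    have "0 < \<epsilon>" using N' n pmom_nonneg[of M "\<lambda>x. u n x - u n x"] by (meson le_less_trans)
    have int: "integrable M (\<lambda>x. \<bar>u n x - f x\<bar> powr p)"
      using le by (intro integrableI_nonneg) (auto intro: le_less_trans)
    then show "(\<lambda>x. u n x - f x) \<in> Lp p M" by (simp add: Lp_iff)
    have "ennreal (pmom M (\<lambda>x. u n x - f x)) \<le> ennreal \<epsilon>"
      using le nn_integral_eq_integral[OF int] by (simp add: pmom_def)
    then show "pmom M (\<lambda>x. u n x - f x) \<le> \<epsilon>" using \<open>0 < \<epsilon>\<close> by simp
  qed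
  obtain N1 where "\<forall>m\<ge>N1. \<forall>n\<ge>N1. pmom M (\<lambda>x. u m x - u n x) < 1" using cauchy[of 1] by auto
  then have "(\<lambda>x. u N1 x - f x) \<in> Lp p M" using bound[of N1 1 N1] by simp
  from Lp_diff[OF M u[of N1] this] have "f \<in> Lp p M" by simp
  moreover have "(\<lambda>n. pmom M (\<lambda>x. u n x - f x)) \<longlonglongrightarrow> 0"
  proof (rule LIMSEQ_I)
    fix \<epsilon> :: real assume "0 < \<epsilon>"
    then obtain N' where N': "\<forall>m\<ge>N'. \<forall>n\<ge>N'. pmom M (\<lambda>x. u m x - u n x) < \<epsilon> / 2"
      using cauchy[of "\<epsilon> / 2"] by auto
    have "norm (pmom M (\<lambda>x. u n x - f x) - 0) < \<epsilon>" if "n \<ge> N'" for n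
      using bound[OF N' that] \<open>0 < \<epsilon>\<close> by simp
    then show "\<exists>N. \<forall>n\<ge>N. norm (pmom M (\<lambda>x. u n x - f x) - 0) < \<epsilon>" by blast
  qed
  ultimately show thesis by (rule that)
qed

end

section \<open>Closed subspaces of L_p as two-normed spaces\<close>

context exponent
begin

definition lp_space :: "'a measure \<Rightarrow> ('a \<Rightarrow> real) set \<Rightarrow> 'a two_normed" where
  "lp_space M X = \<lparr>car = X, pw = pmom M, sq = (\<lambda>f. \<integral>x. (f x)\<^sup>2 \<partial>M)\<rparr>"

lemma car_lp_space [simp]: "car (lp_space M X) = X"
  and pw_lp_space [simp]: "pw (lp_space M X) = pmom M"
  and sq_lp_space [simp]: "sq (lp_space M X) f = (\<integral>x. (f x)\<^sup>2 \<partial>M)"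
  by (simp_all add: lp_space_def)

text \<open>The last clause also makes the set saturated under almost everywhere equality within
  L_p: a constant sequence converges to every function that agrees with it almost
  everywhere.\<close>

definition closed_subspace :: "'a measure \<Rightarrow> ('a \<Rightarrow> real) set \<Rightarrow> bool" where
  "closed_subspace M X \<longleftrightarrow> X \<subseteq> Lp p M \<and> (\<lambda>_. 0) \<in> X \<and>
     (\<forall>f\<in>X. \<forall>g\<in>X. \<forall>a b. (\<lambda>x. a * f x + b * g x) \<in> X) \<and>
     (\<forall>u. \<forall>f\<in>Lp p M. (\<forall>n. u n \<in> X) \<longrightarrow> (\<lambda>n. pmom M (\<lambda>x. u n x - f x)) \<longlonglongrightarrow> 0 \<longrightarrow> f \<in> X)"

lemma closed_subspaceI:
  assumes "X \<subseteq> Lp p M" "(\<lambda>_. 0) \<in> X"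
    "\<And>f g a b. f \<in> X \<Longrightarrow> g \<in> X \<Longrightarrow> (\<lambda>x. a * f x + b * g x) \<in> X"
    "\<And>u f. f \<in> Lp p M \<Longrightarrow> (\<And>n. u n \<in> X) \<Longrightarrow> (\<lambda>n. pmom M (\<lambda>x. u n x - f x)) \<longlonglongrightarrow> 0 \<Longrightarrow> f \<in> X"
  shows "closed_subspace M X"
  using assms unfolding closed_subspace_def by blast

lemma closed_subspaceD:
  assumes "closed_subspace M X"
  shows "f \<in> X \<Longrightarrow> f \<in> Lp p M" "(\<lambda>_. 0) \<in> X"
    "f \<in> X \<Longrightarrow> g \<in> X \<Longrightarrow> (\<lambda>x. a * f x + b * g x) \<in> X"
    "f \<in> Lp p M \<Longrightarrow> (\<And>n. u n \<in> X) \<Longrightarrow> (\<lambda>n. pmom M (\<lambda>x. u n x - f x)) \<longlonglongrightarrow> 0 \<Longrightarrow> f \<in> X"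
  using assms unfolding closed_subspace_def by blast+

lemma square_eq_0_iff:
  assumes "prob_space M" "f \<in> Lp p M"
  shows "(\<integral>x. (f x)\<^sup>2 \<partial>M) = 0 \<longleftrightarrow> (AE x in M. f x = 0)"
proof -
  have "(\<integral>x. (f x)\<^sup>2 \<partial>M) = 0 \<longleftrightarrow> (AE x in M. (f x)\<^sup>2 = 0)"
    by (rule integral_nonneg_eq_0_iff_AE[OF Lp_integrable_square[OF assms]]) simp
  then show ?thesis by simp
qed

lemma pmom_eq_0:
  assumes "AE x in M. f x = 0"
  shows "pmom M f = 0"
  unfolding pmom_def by (rule integral_eq_zero_AE) (use assms in auto)

lemma pmom_eq_0_imp:
  assumes "f \<in> Lp p M" "pmom M f = 0"
  shows "AE x in M. f x = 0"
  using integral_nonneg_eq_0_iff_AE[of M "\<lambda>x. \<bar>f x\<bar> powr p"] assms by (simp add: Lp_iff pmom_def)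

lemma two_normed_space_lp:
  assumes M: "prob_space M" and X: "closed_subspace M X"
  shows "two_normed_space (lp_space M X)"
proof -
  have sq: "(\<integral>x. (a * f x + b * g x)\<^sup>2 \<partial>M) \<le> 2 * (a\<^sup>2 * (\<integral>x. (f x)\<^sup>2 \<partial>M) + b\<^sup>2 * (\<integral>x. (g x)\<^sup>2 \<partial>M))"
    if "f \<in> X" "g \<in> X" for f g a b
  proof -
    have i: "integrable M (\<lambda>x. (f x)\<^sup>2)" "integrable M (\<lambda>x. (g x)\<^sup>2)" "integrable M (\<lambda>x. (a * f x + b * g x)\<^sup>2)"
      using Lp_integrable_square[OF M] Lp_lc[OF M] closed_subspaceD(1)[OF X] that by blast+
    have "(\<integral>x. (a * f x + b * g x)\<^sup>2 \<partial>M) \<le> (\<integral>x. 2 * (a\<^sup>2 * (f x)\<^sup>2 + b\<^sup>2 * (g x)\<^sup>2) \<partial>M)"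
    proof (rule integral_mono)
      show "(a * f x + b * g x)\<^sup>2 \<le> 2 * (a\<^sup>2 * (f x)\<^sup>2 + b\<^sup>2 * (g x)\<^sup>2)" for x
        using zero_le_power2[of "a * f x - b * g x"] by (simp add: power2_eq_square algebra_simps)
    qed (use i in auto)
    then show ?thesis using i by simp
  qed
  have "pmom M f = 0" if "f \<in> X" "(\<integral>x. (f x)\<^sup>2 \<partial>M) = 0" for f
    using square_eq_0_iff[OF M closed_subspaceD(1)[OF X that(1)]] that(2) pmom_eq_0 by blast
  moreover have "0 \<le> (\<integral>x. (f x)\<^sup>2 \<partial>M)" for f :: "'a \<Rightarrow> real"
    by (rule Bochner_Integration.integral_nonneg) simp
  ultimately show ?thesis
    unfolding two_normed_space_def car_lp_space pw_lp_space sq_lp_space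
    by (intro conjI ballI allI impI)
      (assumption | rule closed_subspaceD[OF X] sq pmom_lc[OF M] pmom_nonneg | blast)+
qed

text \<open>On a probability space the L_2 norm is dominated by the L_p norm, so inside a function
  space \<open>wt\<close> and the p-th moment are equivalent, and completeness and density have to
  be checked in L_p only. The two norms become independent of each other in direct sums.\<close>

lemma wt_lp_le:
  assumes "prob_space M" "f \<in> Lp p M"
  shows "wt (lp_space M X) f \<le> 2 * pmom M f"
  using square_le_pmom[OF assms] by (simp add: wt_def)

lemma pmom_le_wt: "pmom M f \<le> wt (lp_space M X) f"
  by (simp add: wt_def)

lemma is_complete_lp:
  assumes M: "prob_space M" and X: "closed_subspace M X"
  shows "is_complete (lp_space M X)"
  unfolding is_complete_def
proof (intro allI impI)
  fix u assume u: "\<forall>n. u n \<in> car (lp_space M X)" and c: "is_cauchy (lp_space M X) u"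
  have uX: "u n \<in> X" and uL: "u n \<in> Lp p M" for n
    using u closed_subspaceD(1)[OF X] by auto
  have "\<exists>N. \<forall>m\<ge>N. \<forall>n\<ge>N. pmom M (\<lambda>x. u m x - u n x) < \<epsilon>" if "0 < \<epsilon>" for \<epsilon>
    using c that unfolding is_cauchy_def by (meson pmom_le_wt le_less_trans)
  then obtain f where f: "f \<in> Lp p M" "(\<lambda>n. pmom M (\<lambda>x. u n x - f x)) \<longlonglongrightarrow> 0"
    by (rule Lp_complete[OF M uL]) blast+
  have fX: "f \<in> X" using closed_subspaceD(4)[OF X f(1) uX f(2)] .
  have d: "(\<lambda>x. u n x - f x) \<in> Lp p M" for n by (rule Lp_diff[OF M uL f(1)])
  have "converges (lp_space M X) u f"
    unfolding converges_def
  proof (rule tendsto_sandwich)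
    show "\<forall>\<^sub>F n in sequentially. 0 \<le> wt (lp_space M X) (\<lambda>x. u n x - f x)"
      by (intro always_eventually allI order_trans[OF pmom_nonneg pmom_le_wt])
    show "\<forall>\<^sub>F n in sequentially. wt (lp_space M X) (\<lambda>x. u n x - f x) \<le> 2 * pmom M (\<lambda>x. u n x - f x)"
      by (intro always_eventually allI wt_lp_le[OF M d])
    show "(\<lambda>n. 2 * pmom M (\<lambda>x. u n x - f x)) \<longlonglongrightarrow> 0"
      using tendsto_mult[OF tendsto_const[of 2] f(2)] by simp
  qed simp
  then show "\<exists>f\<in>car (lp_space M X). converges (lp_space M X) u f" using fX by auto
qed

lemma closed_subspace_mean_zero:
  assumes M: "prob_space M" and X: "closed_subspace M X"
  shows "closed_subspace M (mean_zero M X)"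
proof (rule closed_subspaceI)
  have XL: "f \<in> Lp p M" if "f \<in> X" for f using closed_subspaceD(1)[OF X that] .
  show "mean_zero M X \<subseteq> Lp p M" using XL by (auto simp: mean_zero_def)
  show "(\<lambda>_. 0) \<in> mean_zero M X" using closed_subspaceD(2)[OF X] by (simp add: mean_zero_def)
  show "(\<lambda>x. a * f x + b * g x) \<in> mean_zero M X" if "f \<in> mean_zero M X" "g \<in> mean_zero M X" for f g a b
    using that closed_subspaceD(3)[OF X] Lp_integrable[OF M XL] by (auto simp: mean_zero_def)
  fix u f assume f: "f \<in> Lp p M" and u: "\<And>n. u n \<in> mean_zero M X"
    and lim: "(\<lambda>n. pmom M (\<lambda>x. u n x - f x)) \<longlonglongrightarrow> 0"
  have uX: "u n \<in> X" "(\<integral>x. u n x \<partial>M) = 0" for n using u[of n] by (auto simp: mean_zero_def)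
  have "f \<in> X" using closed_subspaceD(4)[OF X f uX(1) lim] .
  moreover have "\<bar>\<integral>x. f x \<partial>M\<bar> powr p \<le> pmom M (\<lambda>x. u n x - f x)" for n
    using abs_integral_le_pmom[OF M Lp_diff[OF M XL[OF uX(1)] f], of n] uX(2)[of n]
      Lp_integrable[OF M f] Lp_integrable[OF M XL[OF uX(1)]] by simp
  then have "\<bar>\<integral>x. f x \<partial>M\<bar> powr p \<le> 0" using LIMSEQ_le_const[OF lim] by blast
  then have "(\<integral>x. f x \<partial>M) = 0" using powr_gt_zero[of "\<bar>\<integral>x. f x \<partial>M\<bar>" p] by (auto simp: not_less)
  ultimately show "f \<in> mean_zero M X" by (simp add: mean_zero_def)
qed

lemma lin_span_Lp:
  assumes "prob_space M" "G \<subseteq> Lp p M"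
  shows "lin_span G \<subseteq> Lp p M"
  using assms Lp_const[OF assms(1), of 0] Lp_lc[OF assms(1)] by (intro lin_span_minimal) auto

lemma closed_span_iff:
  "f \<in> closed_span p M G \<longleftrightarrow> f \<in> Lp p M \<and> (\<forall>\<epsilon>>0. \<exists>h\<in>lin_span G. pmom M (\<lambda>x. f x - h x) < \<epsilon>)"
proof -
  have "(\<forall>\<epsilon>>0. \<exists>h\<in>lin_span G. Lp_norm p M (\<lambda>x. f x - h x) < \<epsilon>) \<longleftrightarrow>
      (\<forall>\<epsilon>>0. \<exists>h\<in>lin_span G. pmom M (\<lambda>x. f x - h x) < \<epsilon>)"
  proof (intro iffI allI impI)
    fix \<epsilon> :: real assume *: "\<forall>\<epsilon>>0. \<exists>h\<in>lin_span G. Lp_norm p M (\<lambda>x. f x - h x) < \<epsilon>" and "0 < \<epsilon>"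
    then obtain h where h: "h \<in> lin_span G" "pmom M (\<lambda>x. f x - h x) powr (1 / p) < \<epsilon> powr (1 / p)"
      by (metis Lp_norm_eq powr_gt_zero less_irrefl)
    have "pmom M (\<lambda>x. f x - h x) < \<epsilon>"
    proof (rule ccontr)
      assume "\<not> pmom M (\<lambda>x. f x - h x) < \<epsilon>"
      then have "\<epsilon> powr (1 / p) \<le> pmom M (\<lambda>x. f x - h x) powr (1 / p)"
        using \<open>0 < \<epsilon>\<close> p_gt_2 by (intro powr_mono2) auto
      then show False using h(2) by simp
    qed
    then show "\<exists>h\<in>lin_span G. pmom M (\<lambda>x. f x - h x) < \<epsilon>" using h(1) by blast
  next
    fix \<epsilon> :: real assume *: "\<forall>\<epsilon>>0. \<exists>h\<in>lin_span G. pmom M (\<lambda>x. f x - h x) < \<epsilon>" and "0 < \<epsilon>"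
    then obtain h where h: "h \<in> lin_span G" "pmom M (\<lambda>x. f x - h x) < \<epsilon> powr p"
      by (metis powr_gt_zero less_irrefl)
    have "pmom M (\<lambda>x. f x - h x) powr (1 / p) < (\<epsilon> powr p) powr (1 / p)"
      using h(2) p_gt_2 by (intro powr_less_mono2) auto
    also have "\<dots> = \<epsilon>" unfolding powr_powr using p_gt_2 \<open>0 < \<epsilon>\<close> by simp
    finally show "\<exists>h\<in>lin_span G. Lp_norm p M (\<lambda>x. f x - h x) < \<epsilon>"
      using h(1) by (auto simp: Lp_norm_eq)
  qed
  then show ?thesis by (simp add: closed_span_def)
qed

lemma closed_subspace_closed_span:
  assumes M: "prob_space M" and G: "G \<subseteq> Lp p M"
  shows "closed_subspace M (closed_span p M G)" "lin_span G \<subseteq> closed_span p M G"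
proof -
  have LG: "h \<in> Lp p M" if "h \<in> lin_span G" for h using lin_span_Lp[OF M G] that by blast
  have triv: "pmom M (\<lambda>x. h x - h x) = 0" for h :: "'a \<Rightarrow> real" by (simp add: pmom_def)
  show sub: "lin_span G \<subseteq> closed_span p M G"
  proof
    fix h assume h: "h \<in> lin_span G"
    show "h \<in> closed_span p M G"
      unfolding closed_span_iff
      by (intro conjI allI impI LG[OF h] bexI[OF _ h]) (simp only: triv)
  qed
  show "closed_subspace M (closed_span p M G)"
  proof (rule closed_subspaceI)
    show "closed_span p M G \<subseteq> Lp p M" by (auto simp: closed_span_iff)
    show "(\<lambda>_. 0) \<in> closed_span p M G" using sub lin_span_zero by blast
  next
    fix f g a b assume f: "f \<in> closed_span p M G" and g: "g \<in> closed_span p M G"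
    have fL: "f \<in> Lp p M" and gL: "g \<in> Lp p M" using f g by (auto simp: closed_span_iff)
    show "(\<lambda>x. a * f x + b * g x) \<in> closed_span p M G"
      unfolding closed_span_iff
    proof (intro conjI allI impI)
      show "(\<lambda>x. a * f x + b * g x) \<in> Lp p M" by (rule Lp_lc[OF M fL gL])
      fix \<epsilon> :: real assume "0 < \<epsilon>"
      \<comment> \<open>The summand 1 keeps \<open>c\<close> positive when a = b = 0 and makes the
        final estimate strict.\<close>
      define c where "c = 2 powr p * (\<bar>a\<bar> powr p + \<bar>b\<bar> powr p) + 1"
      have c: "0 < c" unfolding c_def by (simp add: add_nonneg_pos)
      have "0 < \<epsilon> / c" using \<open>0 < \<epsilon>\<close> c by simp
      obtain h where h: "h \<in> lin_span G" "pmom M (\<lambda>x. f x - h x) < \<epsilon> / c"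
        using f \<open>0 < \<epsilon> / c\<close> unfolding closed_span_iff by blast
      obtain k where k: "k \<in> lin_span G" "pmom M (\<lambda>x. g x - k x) < \<epsilon> / c"
        using g \<open>0 < \<epsilon> / c\<close> unfolding closed_span_iff by blast
      have "pmom M (\<lambda>x. (a * f x + b * g x) - (a * h x + b * k x))
          = pmom M (\<lambda>x. a * (f x - h x) + b * (g x - k x))" by (simp add: algebra_simps)
      also have "\<dots> \<le> 2 powr p * (\<bar>a\<bar> powr p * pmom M (\<lambda>x. f x - h x) + \<bar>b\<bar> powr p * pmom M (\<lambda>x. g x - k x))"
        by (intro pmom_lc M Lp_diff fL gL LG h k)
      also have "\<dots> \<le> 2 powr p * (\<bar>a\<bar> powr p * (\<epsilon> / c) + \<bar>b\<bar> powr p * (\<epsilon> / c))"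
        using h k by (intro mult_left_mono add_mono) auto
      also have "\<dots> = (c - 1) * (\<epsilon> / c)" unfolding c_def by (simp add: algebra_simps add_divide_distrib)
      also have "\<dots> < c * (\<epsilon> / c)" using \<open>0 < \<epsilon> / c\<close> by (intro mult_strict_right_mono) auto
      also have "\<dots> = \<epsilon>" using c by simp
      finally show "\<exists>h\<in>lin_span G. pmom M (\<lambda>x. (a * f x + b * g x) - h x) < \<epsilon>"
        by (intro bexI[of _ "\<lambda>x. a * h x + b * k x"] lin_span_lc[OF h(1) k(1)])
    qed
  next
    fix u f assume f: "f \<in> Lp p M" and u: "\<And>n. u n \<in> closed_span p M G"
      and lim: "(\<lambda>n. pmom M (\<lambda>x. u n x - f x)) \<longlonglongrightarrow> 0"
    have uL: "u n \<in> Lp p M" for n using u[of n] by (simp add: closed_span_iff)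
    show "f \<in> closed_span p M G"
      unfolding closed_span_iff
    proof (intro conjI allI impI f)
      fix \<epsilon> :: real assume "0 < \<epsilon>"
      define \<delta> where "\<delta> = \<epsilon> / (2 * 2 powr p)"
      have "0 < \<delta>" unfolding \<delta>_def using \<open>0 < \<epsilon>\<close> by simp
      obtain n where n: "pmom M (\<lambda>x. u n x - f x) < \<delta>"
        using order_tendstoD(2)[OF lim \<open>0 < \<delta>\<close>] unfolding eventually_sequentially by blast
      obtain h where h: "h \<in> lin_span G" "pmom M (\<lambda>x. u n x - h x) < \<delta>"
        using u[of n] \<open>0 < \<delta>\<close> unfolding closed_span_iff by blast
      have "pmom M (\<lambda>x. f x - h x) = pmom M (\<lambda>x. (f x - u n x) + (u n x - h x))" by simp
      also have "\<dots> \<le> 2 powr p * (pmom M (\<lambda>x. f x - u n x) + pmom M (\<lambda>x. u n x - h x))"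
        by (intro pmom_add M Lp_diff f uL LG h)
      also have "\<dots> < 2 powr p * (\<delta> + \<delta>)"
        using n h by (intro mult_strict_left_mono add_strict_mono) (auto simp: pmom_diff_commute[of M f])
      also have "\<dots> = \<epsilon>" unfolding \<delta>_def by (simp add: field_simps)
      finally show "\<exists>h\<in>lin_span G. pmom M (\<lambda>x. f x - h x) < \<epsilon>" using h(1) by blast
    qed
  qed
qed

text \<open>Elements of the span close to f need not have mean zero. But f has, and the mean is a
  contraction from L_p, so the mean of h is as small as the approximation error and may be
  subtracted.\<close>

lemma closed_span_mean_zero_dense:
  assumes M: "prob_space M" and G: "G \<subseteq> Lp p M" and f: "f \<in> mean_zero M (closed_span p M G)" and "0 < \<epsilon>"
  obtains h where "h \<in> lin_span G" "pmom M (\<lambda>x. (h x - (\<integral>x. h x \<partial>M)) - f x) < \<epsilon>"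
proof -
  have f': "f \<in> Lp p M" "(\<integral>x. f x \<partial>M) = 0" "f \<in> closed_span p M G"
    using f by (auto simp: mean_zero_def closed_span_iff)
  define \<delta> where "\<delta> = \<epsilon> / (2 * 2 powr p)"
  have "0 < \<delta>" unfolding \<delta>_def using \<open>0 < \<epsilon>\<close> by simp
  obtain h where h: "h \<in> lin_span G" "pmom M (\<lambda>x. f x - h x) < \<delta>"
    using f'(3) \<open>0 < \<delta>\<close> unfolding closed_span_iff by blast
  have hL: "h \<in> Lp p M" using lin_span_Lp[OF M G] h(1) by blast
  define c where "c = (\<integral>x. h x \<partial>M)"
  have d: "(\<lambda>x. h x - f x) \<in> Lp p M" by (rule Lp_diff[OF M hL f'(1)])
  have "\<bar>c\<bar> powr p \<le> pmom M (\<lambda>x. h x - f x)"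
    using abs_integral_le_pmom[OF M d] f'(2) Lp_integrable[OF M hL] Lp_integrable[OF M f'(1)]
    by (simp add: c_def)
  then have c: "pmom M (\<lambda>_. - c) < \<delta>"
    using h(2) unfolding pmom_const[OF M] pmom_diff_commute[of M f] by simp
  have "pmom M (\<lambda>x. (h x - c) - f x) = pmom M (\<lambda>x. (h x - f x) + - c)" by (simp add: algebra_simps)
  also have "\<dots> \<le> 2 powr p * (pmom M (\<lambda>x. h x - f x) + pmom M (\<lambda>_. - c))"
    by (intro pmom_add M d Lp_const)
  also have "\<dots> < 2 powr p * (\<delta> + \<delta>)"
    using h(2) c by (intro mult_strict_left_mono add_strict_mono) (auto simp: pmom_diff_commute[of M f])
  also have "\<dots> = \<epsilon>" unfolding \<delta>_def by (simp add: field_simps)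
  finally show thesis using that h(1) unfolding c_def by blast
qed

section \<open>Relabelling of points\<close>

lemma relabel_in_Lp:
  assumes "inj j" shows "f \<in> Lp p (embed_measure M j) \<longleftrightarrow> (\<lambda>x. f (j x)) \<in> Lp p M"
proof -
  have m: "f \<in> borel_measurable (embed_measure M j) \<longleftrightarrow> (\<lambda>x. f (j x)) \<in> borel_measurable M"
    using measurable_embed_measure1[of f j M borel] measurable_compose[OF measurable_embed_measure2[OF assms]]
    by blast
  show ?thesis
    unfolding Lp_iff m
    using integral_embed_measure(2)[OF assms, of "\<lambda>x. \<bar>f x\<bar> powr p" M] by auto
qed

lemma relabel_moments:
  assumes "inj j" "(\<lambda>x. f (j x)) \<in> borel_measurable M"
  shows "pmom (embed_measure M j) f = pmom M (\<lambda>x. f (j x))"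
    "(\<integral>x. (f x)\<^sup>2 \<partial>embed_measure M j) = (\<integral>x. (f (j x))\<^sup>2 \<partial>M)"
    "(\<integral>x. f x \<partial>embed_measure M j) = (\<integral>x. f (j x) \<partial>M)"
  unfolding pmom_def using assms(2) by (subst integral_embed_measure[OF assms(1)]; simp)+

lemma closed_subspace_relabel:
  assumes j: "inj j" and X: "closed_subspace M X"
  shows "closed_subspace (embed_measure M j) (relabel j X)"
proof (rule closed_subspaceI)
  show "relabel j X \<subseteq> Lp p (embed_measure M j)"
    using relabel_in_Lp[OF j] closed_subspaceD(1)[OF X] by (auto simp: relabel_def)
  show "(\<lambda>_. 0) \<in> relabel j X" using closed_subspaceD(2)[OF X] by (simp add: relabel_def)
  show "(\<lambda>x. a * f x + b * g x) \<in> relabel j X" if "f \<in> relabel j X" "g \<in> relabel j X" for f g a b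
    using that closed_subspaceD(3)[OF X] by (simp add: relabel_def)
  fix u f assume f: "f \<in> Lp p (embed_measure M j)" and u: "\<And>n. u n \<in> relabel j X"
    and lim: "(\<lambda>n. pmom (embed_measure M j) (\<lambda>x. u n x - f x)) \<longlonglongrightarrow> 0"
  have uj: "(\<lambda>x. u n (j x)) \<in> X" for n using u by (simp add: relabel_def)
  have fj: "(\<lambda>x. f (j x)) \<in> Lp p M" using f relabel_in_Lp[OF j] by blast
  have "(\<lambda>x. u n (j x) - f (j x)) \<in> borel_measurable M" for n
    using closed_subspaceD(1)[OF X uj[of n]] fj by (auto simp: Lp_iff)
  then have "pmom (embed_measure M j) (\<lambda>x. u n x - f x) = pmom M (\<lambda>x. u n (j x) - f (j x))" for n
    by (rule relabel_moments(1)[OF j])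
  then have "(\<lambda>n. pmom M (\<lambda>x. u n (j x) - f (j x))) \<longlonglongrightarrow> 0" using lim by simp
  from closed_subspaceD(4)[OF X fj uj this] show "f \<in> relabel j X" by (simp add: relabel_def)
qed

lemma relabel_iso:
  assumes j: "inj j" and M: "prob_space M" and X: "closed_subspace M X"
  shows "isomorphic 1 (lp_space (embed_measure M j) (mean_zero (embed_measure M j) (relabel j X)))
    (lp_space M (mean_zero M X))"
proof (rule isometric_iso[where P = "\<lambda>f F. F = (\<lambda>x. f (j x))"])
  have meas: "f \<in> borel_measurable M" if "f \<in> X" for f
    using closed_subspaceD(1)[OF X that] by (simp add: Lp_iff)
  show "two_normed_space (lp_space (embed_measure M j) (mean_zero (embed_measure M j) (relabel j X)))"
    by (intro two_normed_space_lp closed_subspace_mean_zero closed_subspace_relabel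
        prob_space_embed_measure j M X)
  show "two_normed_space (lp_space M (mean_zero M X))"
    by (intro two_normed_space_lp closed_subspace_mean_zero M X)
  show "f \<in> car (lp_space (embed_measure M j) (mean_zero (embed_measure M j) (relabel j X))) \<longleftrightarrow>
      F \<in> car (lp_space M (mean_zero M X))" if "F = (\<lambda>x. f (j x))" for f F
    using that relabel_moments(3)[OF j meas, of f] by (auto simp: mean_zero_def relabel_def)
  show "pw (lp_space (embed_measure M j) (mean_zero (embed_measure M j) (relabel j X))) f
        = pw (lp_space M (mean_zero M X)) F \<and>
      sq (lp_space (embed_measure M j) (mean_zero (embed_measure M j) (relabel j X))) f
        = sq (lp_space M (mean_zero M X)) F"
    if "F = (\<lambda>x. f (j x))" "f \<in> car (lp_space (embed_measure M j) (mean_zero (embed_measure M j) (relabel j X)))"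
    for f F
    using that relabel_moments(1,2)[OF j meas, of f] by (auto simp: mean_zero_def relabel_def)
  show "\<exists>f. F = (\<lambda>x. f (j x))" for F
    by (rule exI[of _ "\<lambda>y. F (inv j y)"]) (use j in simp)
qed auto

end

section \<open>Independent sums\<close>

text \<open>The joint law of all coordinates is the product measure itself, hence the product of
  their laws.\<close>

lemma indep_vars_coordinates:
  assumes M: "\<And>n. prob_space (M n)" and x: "\<And>n. n \<in> J \<Longrightarrow> x n \<in> borel_measurable (M n)"
  shows "prob_space.indep_vars (PiM UNIV M) (\<lambda>_. borel) (\<lambda>n \<omega>. x n (\<omega> n)) J"
proof -
  interpret P: prob_space "PiM UNIV M" by (intro prob_space_PiM M)
  have "distr (PiM UNIV M) (PiM UNIV M) (\<lambda>\<omega>. \<lambda>i\<in>UNIV. \<omega> i) = distr (PiM UNIV M) (PiM UNIV M) (\<lambda>\<omega>. \<omega>)"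
    by (simp add: restrict_def)
  also have "\<dots> = PiM UNIV (\<lambda>i. distr (PiM UNIV M) (M i) (\<lambda>\<omega>. \<omega> i))"
    using M by (simp add: distr_id distr_PiM_component)
  finally have "P.indep_vars M (\<lambda>n \<omega>. \<omega> n) UNIV"
    by (subst P.indep_vars_iff_distr_eq_PiM') auto
  then have "P.indep_vars M (\<lambda>n \<omega>. \<omega> n) J" by (rule P.indep_vars_subset) auto
  then show ?thesis by (rule P.indep_vars_compose2) (use x in auto)
qed

lemma integral_PiM_coordinate:
  fixes x :: "'a \<Rightarrow> real"
  assumes M: "\<And>n. prob_space (M n)" and x: "x \<in> borel_measurable (M n)"
  shows "(\<integral>\<omega>. x (\<omega> n) \<partial>PiM UNIV M) = (\<integral>t. x t \<partial>M n)"
    and "integrable (PiM UNIV M) (\<lambda>\<omega>. x (\<omega> n)) \<longleftrightarrow> integrable (M n) x"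
    and "(\<lambda>\<omega>. x (\<omega> n)) \<in> borel_measurable (PiM UNIV M)"
proof -
  have d: "distr (PiM UNIV M) (M n) (\<lambda>\<omega>. \<omega> n) = M n" using M by (intro distr_PiM_component) auto
  have m: "(\<lambda>\<omega>. \<omega> n) \<in> measurable (PiM UNIV M) (M n)" by simp
  show "(\<integral>\<omega>. x (\<omega> n) \<partial>PiM UNIV M) = (\<integral>t. x t \<partial>M n)"
    using integral_distr[OF m x] by (simp add: d)
  show "integrable (PiM UNIV M) (\<lambda>\<omega>. x (\<omega> n)) \<longleftrightarrow> integrable (M n) x"
    using integrable_distr_eq[OF m x] by (simp add: d)
  show "(\<lambda>\<omega>. x (\<omega> n)) \<in> borel_measurable (PiM UNIV M)" using x m by simp
qed

context exponent
begin

lemma coordinate_Lp: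
  assumes M: "\<And>n. prob_space (M n)" and x: "x \<in> Lp p (M n)"
  shows "(\<lambda>\<omega>. x (\<omega> n)) \<in> Lp p (PiM UNIV M)"
    "pmom (PiM UNIV M) (\<lambda>\<omega>. x (\<omega> n)) = pmom (M n) x"
    "(\<integral>\<omega>. (x (\<omega> n))\<^sup>2 \<partial>PiM UNIV M) = (\<integral>t. (x t)\<^sup>2 \<partial>M n)"
    "(\<integral>\<omega>. x (\<omega> n) \<partial>PiM UNIV M) = (\<integral>t. x t \<partial>M n)"
proof -
  have m: "x \<in> borel_measurable (M n)" using x by (simp add: Lp_iff)
  then have m': "(\<lambda>t. \<bar>x t\<bar> powr p) \<in> borel_measurable (M n)" "(\<lambda>t. (x t)\<^sup>2) \<in> borel_measurable (M n)" by auto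
  show "(\<lambda>\<omega>. x (\<omega> n)) \<in> Lp p (PiM UNIV M)"
    using integral_PiM_coordinate(3)[of M x n, OF M m] integral_PiM_coordinate(2)[of M "\<lambda>t. \<bar>x t\<bar> powr p" n, OF M m'(1)] x
    by (simp add: Lp_iff)
  show "pmom (PiM UNIV M) (\<lambda>\<omega>. x (\<omega> n)) = pmom (M n) x"
    unfolding pmom_def by (rule integral_PiM_coordinate(1)[of M "\<lambda>t. \<bar>x t\<bar> powr p" n, OF M m'(1)])
  show "(\<integral>\<omega>. (x (\<omega> n))\<^sup>2 \<partial>PiM UNIV M) = (\<integral>t. (x t)\<^sup>2 \<partial>M n)"
    by (rule integral_PiM_coordinate(1)[of M "\<lambda>t. (x t)\<^sup>2" n, OF M m'(2)])
  show "(\<integral>\<omega>. x (\<omega> n) \<partial>PiM UNIV M) = (\<integral>t. x t \<partial>M n)"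
    by (rule integral_PiM_coordinate(1)[of M x n, OF M m])
qed

lemma indep_sum_generators_Lp:
  assumes M: "\<And>n. prob_space (M n)" and X: "\<And>n. X n \<subseteq> Lp p (M n)"
  shows "range (\<lambda>c _. c) \<union> (\<Union>n. {\<lambda>\<omega>. f (\<omega> n) | f. f \<in> X n}) \<subseteq> Lp p (PiM UNIV M)"
  using coordinate_Lp(1)[of M, OF M] X Lp_const[OF prob_space_PiM[of UNIV M]] M by auto

lemma closed_subspace_indep_sum:
  assumes M: "\<And>n. prob_space (M n)" and X: "\<And>n. X n \<subseteq> Lp p (M n)"
  shows "closed_subspace (PiM UNIV M) (indep_sum p M X)" "(\<lambda>_. c) \<in> indep_sum p M X"
proof -
  note G = indep_sum_generators_Lp[of M X, OF M X]
  show "closed_subspace (PiM UNIV M) (indep_sum p M X)"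
    unfolding indep_sum_def by (intro closed_subspace_closed_span(1) prob_space_PiM M G)
  have "(\<lambda>_. c) \<in> lin_span (range (\<lambda>c _. c) \<union> (\<Union>n. {\<lambda>\<omega>. f (\<omega> n) | f. f \<in> X n}))"
    by (rule lin_span_base) auto
  then show "(\<lambda>_. c) \<in> indep_sum p M X"
    unfolding indep_sum_def using closed_subspace_closed_span(2)[OF prob_space_PiM G] M by blast
qed

text \<open>A family with finitely many nonzero members corresponds to the sum of its members, each
  evaluated at its own coordinate. Rosenthal's inequality and orthogonality make this correspondence
  comparable, and it is dense on both sides. \<open>K\<close> is fixed before the spaces, so it
  depends on p only.\<close>

lemma rosenthal_iso:
  obtains K where "\<And>(M :: nat \<Rightarrow> 'a measure) X. (\<And>n. prob_space (M n)) \<Longrightarrow> (\<And>n. closed_subspace (M n) (X n)) \<Longrightarrow>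
    isomorphic K (dsum UNIV (\<lambda>n. lp_space (M n) (mean_zero (M n) (X n))))
      (lp_space (PiM UNIV M) (mean_zero (PiM UNIV M) (indep_sum p M (\<lambda>n. mean_zero (M n) (X n)))))"
proof -
  obtain K where K: "1 \<le> K"
    "\<And>(M :: (nat \<Rightarrow> 'a) measure) (X :: nat \<Rightarrow> (nat \<Rightarrow> 'a) \<Rightarrow> real) J. prob_space M \<Longrightarrow> finite J \<Longrightarrow>
      prob_space.indep_vars M (\<lambda>_. borel) X J \<Longrightarrow>
      (\<And>i. i \<in> J \<Longrightarrow> integrable M (\<lambda>x. \<bar>X i x\<bar> powr p)) \<Longrightarrow> (\<And>i. i \<in> J \<Longrightarrow> integral\<^sup>L M (X i) = 0) \<Longrightarrow>
      (\<integral>x. \<bar>\<Sum>i\<in>J. X i x\<bar> powr p \<partial>M) \<le>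
        K * ((\<Sum>i\<in>J. \<integral>x. \<bar>X i x\<bar> powr p \<partial>M) + (\<Sum>i\<in>J. \<integral>x. (X i x)\<^sup>2 \<partial>M) powr (p / 2))"
    using rosenthal_upper[OF p_gt_2] by blast
  \<comment> \<open>K + 1 bounds \<open>wt\<close> of the sum, the 1 coming from its
    \<open>sq\<close> part; 1 + 2^(p-1) serves for the inverse, since 2^(p-1) undoes the factor
    2^(1-p) of the lower estimate.\<close>
  define L where "L = K + 1 + 2 powr (p - 1)"
  have L: "1 \<le> L" unfolding L_def using K(1) powr_ge_zero[of 2 "p - 1"] by linarith
  have "isomorphic (4 powr p * L) (dsum UNIV (\<lambda>n. lp_space (M n) (mean_zero (M n) (X n))))
      (lp_space (PiM UNIV M) (mean_zero (PiM UNIV M) (indep_sum p M (\<lambda>n. mean_zero (M n) (X n)))))"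
    if M: "\<And>n. prob_space (M n)" and X: "\<And>n. closed_subspace (M n) (X n)" for M :: "nat \<Rightarrow> 'a measure" and X
  proof -
    define Y where "Y n = mean_zero (M n) (X n)" for n
    have Y: "closed_subspace (M n) (Y n)" for n unfolding Y_def by (intro closed_subspace_mean_zero M X)
    have YL: "f \<in> Lp p (M n)" if "f \<in> Y n" for f n using closed_subspaceD(1)[OF Y that] .
    have Y0: "(\<integral>t. f t \<partial>M n) = 0" if "f \<in> Y n" for f n using that by (simp add: Y_def mean_zero_def)
    define P where "P = PiM UNIV M"
    have P: "prob_space P" unfolding P_def by (intro prob_space_PiM M)
    interpret P: prob_space P by fact
    define G where "G = range (\<lambda>c _. c) \<union> (\<Union>n. {\<lambda>\<omega>. f (\<omega> n) | f. f \<in> Y n})"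
    have GL: "G \<subseteq> Lp p P" unfolding G_def P_def using YL by (intro indep_sum_generators_Lp M) auto
    define A where "A = dsum UNIV (\<lambda>n. lp_space (M n) (Y n))"
    define Z where "Z = closed_span p P G"
    define B where "B = lp_space P (mean_zero P Z)"
    have Zc: "closed_subspace P Z" "lin_span G \<subseteq> Z"
      unfolding Z_def using closed_subspace_closed_span[OF P GL] by auto
    have tn: "two_normed_space (lp_space (M n) (Y n))" "is_complete (lp_space (M n) (Y n))" for n
      by (intro two_normed_space_lp is_complete_lp M Y)+
    have A: "two_normed_space A" "is_complete A"
      unfolding A_def by (intro two_normed_space_dsum is_complete_dsum tn)+
    have B: "two_normed_space B" "is_complete B"
      unfolding B_def by (intro two_normed_space_lp is_complete_lp P closed_subspace_mean_zero Zc)+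
    \<comment> \<open>\<open>J\<close> is any finite set containing the support, not the support
      itself, so two related pairs can be brought to a common index set before linear combinations
      are formed.\<close>
    define D where "D f F \<longleftrightarrow> f \<in> car A \<and>
      (\<exists>J. finite J \<and> (\<forall>n x. n \<notin> J \<longrightarrow> f (n, x) = 0) \<and> F = (\<lambda>\<omega>. \<Sum>n\<in>J. f (n, \<omega> n)))"
      for f :: "nat \<times> 'a \<Rightarrow> real" and F
    have fY: "(\<lambda>x. f (n, x)) \<in> Y n" if "f \<in> car A" for f n
      using that by (simp add: A_def in_dsum)
    have F_props: "F \<in> lin_span G \<and> (\<integral>\<omega>. F \<omega> \<partial>P) = 0 \<and> sq B F = sq A f \<and>
        pmom P F \<le> K * wt A f \<and> 2 powr (1 - p) * pw A f \<le> pmom P F" if D: "D f F" for f F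
    proof -
      obtain J where J: "finite J" "\<And>n x. n \<notin> J \<Longrightarrow> f (n, x) = 0" "F = (\<lambda>\<omega>. \<Sum>n\<in>J. f (n, \<omega> n))"
        and f: "f \<in> car A" using D unfolding D_def by blast
      note c = coordinate_Lp[of M, OF M YL[OF fY[OF f]], folded P_def]
      have ind: "P.indep_vars (\<lambda>_. borel) (\<lambda>n \<omega>. f (n, \<omega> n)) J"
        unfolding P_def using indep_vars_coordinates[of M J "\<lambda>n x. f (n, x)", OF M] YL[OF fY[OF f]]
        by (simp add: Lp_iff)
      have int: "integrable P (\<lambda>\<omega>. \<bar>f (n, \<omega> n)\<bar> powr p)" for n using c(1)[of n] by (simp add: Lp_iff)
      have mean: "(\<integral>\<omega>. f (n, \<omega> n) \<partial>P) = 0" for n using c(4)[of n] Y0[OF fY[OF f]] by simp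
      have pwA: "pw A f = (\<Sum>n\<in>J. \<integral>\<omega>. \<bar>f (n, \<omega> n)\<bar> powr p \<partial>P)"
      proof -
        have "pw A f = (\<Sum>\<^sub>\<infinity>n\<in>J. pmom (M n) (\<lambda>x. f (n, x)))"
          unfolding A_def pw_dsum by (rule infsum_cong_neutral) (use J(2) in \<open>auto intro!: pmom_eq_0\<close>)
        also have "\<dots> = (\<Sum>n\<in>J. pmom P (\<lambda>\<omega>. f (n, \<omega> n)))" using J(1) c(2) by simp
        finally show ?thesis by (simp add: pmom_def)
      qed
      have sqA: "sq A f = (\<Sum>n\<in>J. \<integral>\<omega>. (f (n, \<omega> n))\<^sup>2 \<partial>P)"
      proof -
        have "sq A f = (\<Sum>\<^sub>\<infinity>n\<in>J. \<integral>x. (f (n, x))\<^sup>2 \<partial>M n)"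
          unfolding A_def sq_dsum by (rule infsum_cong_neutral) (use J(2) in auto)
        then show ?thesis using J(1) c(3) by simp
      qed
      have partial: "(\<lambda>\<omega>. \<Sum>n\<in>J'. f (n, \<omega> n)) \<in> lin_span G" if "finite J'" for J'
        using that
      proof (induction J' rule: finite_induct)
        case (insert m J')
        have "(\<lambda>\<omega>. f (m, \<omega> m)) \<in> G" unfolding G_def
          by (intro UnI2 UN_I[of m] CollectI exI[of _ "\<lambda>x. f (m, x)"] conjI refl UNIV_I fY[OF f])
        then have "(\<lambda>\<omega>. 1 * f (m, \<omega> m) + 1 * (\<Sum>n\<in>J'. f (n, \<omega> n))) \<in> lin_span G"
          by (intro lin_span_lc insert.IH lin_span_base)
        then show ?case using insert.hyps by simp
      qed (simp add: lin_span_zero)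
      have "F \<in> lin_span G" unfolding J(3) by (rule partial[OF J(1)])
      moreover have "(\<integral>\<omega>. F \<omega> \<partial>P) = 0"
      proof -
        have "integrable P (\<lambda>\<omega>. f (n, \<omega> n))" for n by (rule Lp_integrable[OF P c(1)])
        then show ?thesis unfolding J(3) by (subst Bochner_Integration.integral_sum) (simp_all add: mean)
      qed
      moreover have "sq B F = sq A f"
        unfolding sqA B_def sq_lp_space J(3)
        using P.rosenthal_lower_and_orthogonality[OF J(1) ind p_gt_2 int mean] by (rule conjunct2)
      moreover have "2 powr (1 - p) * pw A f \<le> pmom P F"
        unfolding pwA pmom_def J(3)
        using P.rosenthal_lower_and_orthogonality[OF J(1) ind p_gt_2 int mean] by (rule conjunct1)
      moreover have "pmom P F \<le> K * wt A f"
        unfolding wt_def pwA sqA unfolding pmom_def J(3)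
        by (rule K(2)[OF P J(1) ind int mean])
      ultimately show ?thesis by blast
    qed
    have lin: "D (\<lambda>x. a * f x + b * g x) (\<lambda>x. a * F x + b * H x)" if Df: "D f F" and Dg: "D g H" for f F g H a b
    proof -
      obtain I where "finite I \<and> (\<forall>n x. n \<notin> I \<longrightarrow> f (n, x) = 0) \<and> F = (\<lambda>\<omega>. \<Sum>n\<in>I. f (n, \<omega> n))"
        using conjunct2[OF Df[unfolded D_def]] by (rule exE)
      then have I: "finite I" "\<And>n x. n \<notin> I \<Longrightarrow> f (n, x) = 0" "F = (\<lambda>\<omega>. \<Sum>n\<in>I. f (n, \<omega> n))"
        by simp_all
      obtain J where "finite J \<and> (\<forall>n x. n \<notin> J \<longrightarrow> g (n, x) = 0) \<and> H = (\<lambda>\<omega>. \<Sum>n\<in>J. g (n, \<omega> n))"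
        using conjunct2[OF Dg[unfolded D_def]] by (rule exE)
      then have J: "finite J" "\<And>n x. n \<notin> J \<Longrightarrow> g (n, x) = 0" "H = (\<lambda>\<omega>. \<Sum>n\<in>J. g (n, \<omega> n))"
        by simp_all
      have fg: "f \<in> car A" "g \<in> car A" using Df Dg by (simp_all add: D_def)
      have "F = (\<lambda>\<omega>. \<Sum>n\<in>I \<union> J. f (n, \<omega> n))"
        unfolding I(3) by (rule ext, rule sum.mono_neutral_left) (simp_all add: I(1,2) J(1))
      moreover have "H = (\<lambda>\<omega>. \<Sum>n\<in>I \<union> J. g (n, \<omega> n))"
        unfolding J(3) by (rule ext, rule sum.mono_neutral_left) (simp_all add: J(1,2) I(1))
      ultimately have "(\<lambda>x. a * F x + b * H x) = (\<lambda>\<omega>. \<Sum>n\<in>I \<union> J. a * f (n, \<omega> n) + b * g (n, \<omega> n))"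
        by (simp add: sum.distrib sum_distrib_left)
      then show ?thesis
        unfolding D_def
        by (intro conjI exI[of _ "I \<union> J"] lc_car[OF A(1) fg]) (simp_all add: I(1,2) J(1,2))
    qed
    have rel: "linear_relation L A B D"
    proof (rule linear_relationI[OF L])
      fix f F assume D: "D f F"
      note F = F_props[OF D]
      show f: "f \<in> car A" using D by (simp add: D_def)
      show "F \<in> car B" using F Zc(2) by (auto simp: B_def mean_zero_def)
      have nn: "0 \<le> sq A f" "0 \<le> wt A f" "0 \<le> pmom P F" using A f by (auto simp: sq_nonneg wt_nonneg)
      have 1: "sq A f \<le> L * sq A f" using L nn mult_right_mono[OF L nn(1)] by simp
      have wB: "wt B F = pmom P F + sq A f powr (p / 2)"
        using F unfolding wt_def by (simp add: B_def)
      have "sq A f powr (p / 2) \<le> wt A f" unfolding wt_def using pw_nonneg[OF A(1) f] by simp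
      then have "wt B F \<le> K * wt A f + wt A f" unfolding wB using F by simp
      also have "\<dots> \<le> L * wt A f" unfolding L_def using nn by (simp add: distrib_right)
      finally have 2: "wt B F \<le> L * wt A f" .
      have "pw A f = 2 powr (p - 1) * (2 powr (1 - p) * pw A f)"
        by (simp add: mult.assoc[symmetric] powr_add[symmetric])
      also have "\<dots> \<le> 2 powr (p - 1) * pmom P F" using F by (intro mult_left_mono) auto
      finally have "pw A f \<le> 2 powr (p - 1) * pmom P F" .
      moreover have "0 \<le> sq A f powr (p / 2)" by simp
      ultimately have "wt A f \<le> (1 + 2 powr (p - 1)) * (pmom P F + sq A f powr (p / 2))"
        unfolding wt_def using nn(3) by (simp add: algebra_simps add_increasing add_increasing2)
      also have "\<dots> \<le> L * (pmom P F + sq A f powr (p / 2))"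
        unfolding L_def using K(1) nn(3) by (intro mult_right_mono) auto
      also have "\<dots> = L * wt B F" by (simp only: wB)
      finally show "comparable L A B f F" unfolding comparable_def using F 1 2 by simp
    qed (rule lin)
    show ?thesis
      unfolding Y_def[symmetric] A_def[symmetric] indep_sum_def P_def[symmetric] G_def[symmetric] Z_def[symmetric] B_def[symmetric]
    proof (rule iso_from_dense[OF A B rel])
      fix f and \<epsilon> :: real assume f: "f \<in> car A" and "0 < \<epsilon>"
      show "\<exists>g H. D g H \<and> wt A (\<lambda>x. g x - f x) < \<epsilon>"
        unfolding A_def using f[unfolded A_def] \<open>0 < \<epsilon>\<close>
        by (rule dsum_finite_support_dense[OF tn(1), of _ UNIV])
          (auto simp: D_def A_def)
    next
      fix F and \<epsilon> :: real assume F: "F \<in> car B" and "0 < \<epsilon>"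
      have F': "F \<in> mean_zero P (closed_span p P G)" using F by (simp add: B_def Z_def)
      obtain h where h: "h \<in> lin_span G" "pmom P (\<lambda>x. (h x - (\<integral>x. h x \<partial>P)) - F x) < \<epsilon> / 2"
        using closed_span_mean_zero_dense[OF P GL F', of "\<epsilon> / 2"] \<open>0 < \<epsilon>\<close> by auto
      \<comment> \<open>The generators include the constants, so an element of the span is an image
        under the correspondence plus a constant. This constant is its mean, which the approximation
        by \<open>h\<close> has already subtracted.\<close>
      define S where "S = {h. \<exists>c f H. D f H \<and> h = (\<lambda>\<omega>. c + H \<omega>)}"
      have D0: "D (\<lambda>_. 0) (\<lambda>_. 0)" unfolding D_def using zero_car[OF A(1)] by auto
      have "lin_span G \<subseteq> S"
      proof (rule lin_span_minimal)
        show "(\<lambda>_. 0) \<in> S" unfolding S_def using D0 by force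
        show "G \<subseteq> S"
        proof
          fix g assume "g \<in> G"
          then consider c where "g = (\<lambda>_. c)" | n f where "f \<in> Y n" "g = (\<lambda>\<omega>. f (\<omega> n))"
            unfolding G_def by blast
          then show "g \<in> S"
          proof cases
            case 1
            then show ?thesis unfolding S_def using D0 by force
          next
            case 2
            \<comment> \<open>The family whose only nonzero member is f, at place n.\<close>
            define f' where "f' = (\<lambda>(m, x). if m = n then f x else 0)"
            have "(\<lambda>x. f' (m, x)) = (if m = n then f else (\<lambda>_. 0))" for m by (auto simp: f'_def)
            then have sec: "(\<lambda>x. f' (m, x)) = (if m \<in> {n} then f else (\<lambda>_. 0))" for m by simp
            have "f' \<in> car A"
              unfolding A_def in_dsum
            proof (intro conjI ballI)
              show "(\<lambda>x. f' (m, x)) \<in> car (lp_space (M m) (Y m))" for m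
                using 2(1) closed_subspaceD(2)[OF Y] by (auto simp: sec)
              show "(\<lambda>m. pw (lp_space (M m) (Y m)) (\<lambda>x. f' (m, x))) summable_on UNIV"
                by (rule summable_on_cong_neutral[THEN iffD1, OF _ _ _ summable_on_finite[of "{n}" "\<lambda>m. pmom (M m) f"]])
                  (auto simp: sec pmom_eq_0)
              show "(\<lambda>m. sq (lp_space (M m) (Y m)) (\<lambda>x. f' (m, x))) summable_on UNIV"
                by (rule summable_on_cong_neutral[THEN iffD1, OF _ _ _ summable_on_finite[of "{n}" "\<lambda>m. \<integral>t. (f t)\<^sup>2 \<partial>M m"]])
                  (auto simp: f'_def)
            qed
            then have "D f' (\<lambda>\<omega>. \<Sum>m\<in>{n}. f' (m, \<omega> m))"
              unfolding D_def by (intro conjI exI[of _ "{n}"]) (simp_all add: f'_def)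
            moreover have "g = (\<lambda>\<omega>. 0 + (\<Sum>m\<in>{n}. f' (m, \<omega> m)))" unfolding 2(2) by (simp add: f'_def)
            ultimately show ?thesis unfolding S_def by (intro CollectI exI conjI)
          qed
        qed
      next
        fix g k a b assume "g \<in> S" "k \<in> S"
        then obtain c f H c' f' H' where "D f H" "g = (\<lambda>\<omega>. c + H \<omega>)" "D f' H'" "k = (\<lambda>\<omega>. c' + H' \<omega>)"
          unfolding S_def by blast
        then have "D (\<lambda>x. a * f x + b * f' x) (\<lambda>x. a * H x + b * H' x)"
          "(\<lambda>x. a * g x + b * k x) = (\<lambda>x. (a * c + b * c') + (a * H x + b * H' x))"
          by (auto intro: lin simp: algebra_simps)
        then show "(\<lambda>x. a * g x + b * k x) \<in> S" unfolding S_def by (intro CollectI exI conjI)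
      qed
      then obtain c f H where H: "D f H" "h = (\<lambda>\<omega>. c + H \<omega>)" using h(1) unfolding S_def by blast
      have HL: "H \<in> Lp p P" using F_props[OF H(1)] lin_span_Lp[OF P GL] by blast
      have FL: "F \<in> Lp p P" using F' by (simp add: mean_zero_def closed_span_iff)
      have "(\<integral>x. h x \<partial>P) = c"
        unfolding H(2) using F_props[OF H(1)] Lp_integrable[OF P HL] by (simp add: P.prob_space)
      then have "pmom P (\<lambda>x. H x - F x) < \<epsilon> / 2" using h(2) by (simp add: H(2))
      then have "wt B (\<lambda>x. H x - F x) < \<epsilon>"
        using wt_lp_le[OF P Lp_diff[OF P HL FL], of "mean_zero P Z"] unfolding B_def by linarith
      then show "\<exists>g H. D g H \<and> wt B (\<lambda>x. H x - F x) < \<epsilon>" using H(1) by blast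
    qed
  qed
  then show thesis by (rule that)
qed

end

section \<open>Tensor products with $L_p^1$\<close>

lemma id_borel_unit_interval: "(\<lambda>x. x) \<in> borel_measurable unit_interval"
  unfolding unit_interval_def by (rule measurable_restrict_space1) simp

text \<open>The half-open dyadic intervals miss the endpoint 1 of [0,1], which is a null
  set.\<close>

lemma AE_unit_interval:
  "AE s in unit_interval. 0 \<le> s \<and> s < 1"
proof -
  have "AE s in lborel. s \<noteq> (1::real)" by (rule AE_lborel_singleton)
  then have "AE s in lborel. s \<in> {0..1} \<longrightarrow> 0 \<le> s \<and> s < (1::real)" by eventually_elim auto
  then show ?thesis unfolding unit_interval_def by (subst AE_restrict_space_iff) auto
qed

lemma integral_unit_interval_halves:
  fixes a b :: real
  shows "integrable unit_interval (\<lambda>s. if s < 1/2 then a else b)"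
    and "(\<integral>s. (if s < 1/2 then a else b) \<partial>unit_interval) = (a + b) / 2"
proof -
  interpret U: prob_space unit_interval by (rule prob_space_unit_interval)
  have A: "{0..<1/2} \<in> sets unit_interval"
    unfolding unit_interval_def by (auto simp: sets_restrict_space_iff)
  have m: "measure unit_interval {0..<1/2} = 1/2"
    unfolding unit_interval_def by (subst measure_restrict_space) auto
  have eq: "(if s < 1/2 then a else b) = b + (a - b) * indicator {0..<1/2} s" if "s \<in> space unit_interval" for s
    using that by (auto simp: unit_interval_def space_restrict_space indicator_def)
  have int: "integrable unit_interval (\<lambda>s. b + (a - b) * indicator {0..<1/2} s)"
    using A by (intro Bochner_Integration.integrable_add Bochner_Integration.integrable_mult_right)
      (auto intro!: integrable_real_indicator simp: U.emeasure_eq_measure)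
  then show "integrable unit_interval (\<lambda>s. if s < 1/2 then a else b)"
    by (subst Bochner_Integration.integrable_cong[OF refl eq])
  have "(\<integral>s. (if s < 1/2 then a else b) \<partial>unit_interval) = (\<integral>s. b + (a - b) * indicator {0..<1/2} s \<partial>unit_interval)"
    by (rule Bochner_Integration.integral_cong[OF refl eq])
  also have "\<dots> = b + (a - b) * measure unit_interval {0..<1/2}"
    using A by (subst Bochner_Integration.integral_add)
      (auto simp: U.prob_space U.emeasure_eq_measure intro!: integrable_real_indicator)
  also have "\<dots> = (a + b) / 2" unfolding m by (simp add: field_simps)
  finally show "(\<integral>s. (if s < 1/2 then a else b) \<partial>unit_interval) = (a + b) / 2" .
qed

text \<open>Normal form for the tensor product with L_p^1: almost everywhere, its generators have
  this shape.\<close>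

definition halves :: "('a \<Rightarrow> real) \<Rightarrow> ('a \<Rightarrow> real) \<Rightarrow> real \<times> 'a \<Rightarrow> real" where
  "halves u v = (\<lambda>(s, t). if s < 1/2 then u t else v t)"

lemma halves_measurable:
  assumes "u \<in> borel_measurable M" "v \<in> borel_measurable M"
  shows "halves u v \<in> borel_measurable (unit_interval \<Otimes>\<^sub>M M)"
proof -
  have [measurable]: "fst \<in> borel_measurable (unit_interval \<Otimes>\<^sub>M M)"
    by (rule measurable_compose[OF measurable_fst id_borel_unit_interval])
  have [measurable]: "(\<lambda>z. u (snd z)) \<in> borel_measurable (unit_interval \<Otimes>\<^sub>M M)"
    "(\<lambda>z. v (snd z)) \<in> borel_measurable (unit_interval \<Otimes>\<^sub>M M)"
    using assms by (auto intro: measurable_compose[OF measurable_snd])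
  have "(\<lambda>z. if fst z < 1/2 then u (snd z) else v (snd z)) \<in> borel_measurable (unit_interval \<Otimes>\<^sub>M M)"
    by measurable
  then show ?thesis by (simp add: halves_def case_prod_beta')
qed

lemma halves_integral:
  assumes M: "prob_space M" and u: "integrable M u" and v: "integrable M v"
  shows "integrable (unit_interval \<Otimes>\<^sub>M M) (halves u v)"
    and "(\<integral>z. halves u v z \<partial>(unit_interval \<Otimes>\<^sub>M M)) = ((\<integral>t. u t \<partial>M) + (\<integral>t. v t \<partial>M)) / 2"
proof -
  interpret M: prob_space M by fact
  interpret U: prob_space unit_interval by (rule prob_space_unit_interval)
  interpret pair_prob_space unit_interval M ..
  have inner: "(\<integral>t. norm (halves u v (s, t)) \<partial>M) = (if s < 1/2 then \<integral>t. norm (u t) \<partial>M else \<integral>t. norm (v t) \<partial>M)" for s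
    by (simp add: halves_def)
  show int: "integrable (unit_interval \<Otimes>\<^sub>M M) (halves u v)"
  proof (rule Fubini_integrable)
    show "halves u v \<in> borel_measurable (unit_interval \<Otimes>\<^sub>M M)"
      using u v by (intro halves_measurable) auto
    show "integrable unit_interval (\<lambda>s. \<integral>t. norm (halves u v (s, t)) \<partial>M)"
      unfolding inner by (rule integral_unit_interval_halves)
    show "AE s in unit_interval. integrable M (\<lambda>t. halves u v (s, t))"
    proof (rule AE_I2)
      show "integrable M (\<lambda>t. halves u v (s, t))" for s
        using u v by (cases "s < 1/2") (simp_all add: halves_def)
    qed
  qed
  have inner': "(\<integral>t. halves u v (s, t) \<partial>M) = (if s < 1/2 then \<integral>t. u t \<partial>M else \<integral>t. v t \<partial>M)" for s
    by (simp add: halves_def)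
  have "(\<integral>z. halves u v z \<partial>(unit_interval \<Otimes>\<^sub>M M)) = (\<integral>s. (\<integral>t. halves u v (s, t) \<partial>M) \<partial>unit_interval)"
    by (rule integral_fst'[OF int, symmetric])
  also have "\<dots> = ((\<integral>t. u t \<partial>M) + (\<integral>t. v t \<partial>M)) / 2"
    unfolding inner' by (rule integral_unit_interval_halves)
  finally show "(\<integral>z. halves u v z \<partial>(unit_interval \<Otimes>\<^sub>M M)) = ((\<integral>t. u t \<partial>M) + (\<integral>t. v t \<partial>M)) / 2" .
qed

lemma prob_space_unit_pair: "prob_space M \<Longrightarrow> prob_space (unit_interval \<Otimes>\<^sub>M M)"
  by (intro prob_space_pair prob_space_unit_interval)

lemma AE_unit_pair:
  assumes "prob_space M" "AE s in unit_interval. P s"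
  shows "AE z in unit_interval \<Otimes>\<^sub>M M. P (fst z)"
proof -
  have "AE s in distr (unit_interval \<Otimes>\<^sub>M M) unit_interval fst. P s"
    by (subst prob_space.distr_pair_fst[OF assms(1)]) (rule assms(2))
  then show ?thesis by (rule AE_distrD[rotated]) simp
qed

context exponent
begin

lemma Lp_dyadic_0_AE:
  assumes "x \<in> Lp_dyadic p 0"
  obtains c where "AE s in unit_interval. x s = c"
proof -
  obtain c where "AE s in unit_interval. s \<in> {0..<1} \<longrightarrow> x s = c"
    using assms by (auto simp: Lp_dyadic_def)
  then have "AE s in unit_interval. x s = c"
    using AE_unit_interval by eventually_elim auto
  then show thesis by (rule that)
qed

lemma Lp_dyadic_1_AE:
  assumes "x \<in> Lp_dyadic p 1"
  obtains a b where "AE s in unit_interval. x s = (if s < 1/2 then a else b)"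
proof -
  have *: "\<forall>k<2. \<exists>c. AE s in unit_interval. s \<in> {real k / 2..<(real k + 1) / 2} \<longrightarrow> x s = c"
    using assms by (auto simp: Lp_dyadic_def)
  obtain a where a: "AE s in unit_interval. s \<in> {0..<1/2} \<longrightarrow> x s = a" using *[rule_format, of 0] by auto
  obtain b where b: "AE s in unit_interval. s \<in> {1/2..<1} \<longrightarrow> x s = b" using *[rule_format, of 1] by auto
  have "AE s in unit_interval. x s = (if s < 1/2 then a else b)"
    using a b AE_unit_interval by eventually_elim auto
  then show thesis by (rule that)
qed

lemma halves_in_Lp_dyadic_1: "(\<lambda>s. if s < 1/2 then a else b) \<in> Lp_dyadic p 1"
proof -
  have m: "(\<lambda>s. if s < 1/2 then a else b) \<in> borel_measurable unit_interval"
    using integral_unit_interval_halves(1)[of a b] by (rule borel_measurable_integrable)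
  have "\<bar>if s < 1/2 then a else b\<bar> powr p = (if s < 1/2 then \<bar>a\<bar> powr p else \<bar>b\<bar> powr p)" for s :: real by simp
  then have L: "(\<lambda>s. if s < 1/2 then a else b) \<in> Lp p unit_interval"
    using m integral_unit_interval_halves(1)[of "\<bar>a\<bar> powr p" "\<bar>b\<bar> powr p"] by (simp add: Lp_iff)
  have "\<exists>c. AE s in unit_interval. s \<in> {real k / 2 ^ 1..<(real k + 1) / 2 ^ 1} \<longrightarrow> (if s < 1/2 then a else b) = c"
    if "k < 2 ^ 1" for k :: nat
    using that by (intro exI[of _ "if k = 0 then a else b"] AE_I2) (auto simp: less_Suc_eq numeral_2_eq_2)
  then show ?thesis unfolding Lp_dyadic_def using L by blast
qed

lemma halves_Lp:
  assumes M: "prob_space M" and u: "u \<in> Lp p M" and v: "v \<in> Lp p M"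
  shows "halves u v \<in> Lp p (unit_interval \<Otimes>\<^sub>M M)"
    "pmom (unit_interval \<Otimes>\<^sub>M M) (halves u v) = (pmom M u + pmom M v) / 2"
    "(\<integral>z. (halves u v z)\<^sup>2 \<partial>(unit_interval \<Otimes>\<^sub>M M)) = ((\<integral>t. (u t)\<^sup>2 \<partial>M) + (\<integral>t. (v t)\<^sup>2 \<partial>M)) / 2"
    "(\<integral>z. halves u v z \<partial>(unit_interval \<Otimes>\<^sub>M M)) = ((\<integral>t. u t \<partial>M) + (\<integral>t. v t \<partial>M)) / 2"
proof -
  have p: "(\<lambda>z. \<bar>halves u v z\<bar> powr p) = halves (\<lambda>t. \<bar>u t\<bar> powr p) (\<lambda>t. \<bar>v t\<bar> powr p)"
    by (auto simp: halves_def)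
  have s: "(\<lambda>z. (halves u v z)\<^sup>2) = halves (\<lambda>t. (u t)\<^sup>2) (\<lambda>t. (v t)\<^sup>2)" by (auto simp: halves_def)
  have ip: "integrable M (\<lambda>t. \<bar>u t\<bar> powr p)" "integrable M (\<lambda>t. \<bar>v t\<bar> powr p)" using u v by (auto simp: Lp_iff)
  have "halves u v \<in> borel_measurable (unit_interval \<Otimes>\<^sub>M M)"
    using u v by (intro halves_measurable) (auto simp: Lp_iff)
  then show "halves u v \<in> Lp p (unit_interval \<Otimes>\<^sub>M M)"
    unfolding Lp_iff p using halves_integral(1)[OF M ip] by blast
  show "pmom (unit_interval \<Otimes>\<^sub>M M) (halves u v) = (pmom M u + pmom M v) / 2"
    unfolding pmom_def p by (rule halves_integral(2)[OF M ip])
  show "(\<integral>z. (halves u v z)\<^sup>2 \<partial>(unit_interval \<Otimes>\<^sub>M M)) = ((\<integral>t. (u t)\<^sup>2 \<partial>M) + (\<integral>t. (v t)\<^sup>2 \<partial>M)) / 2"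
    unfolding s by (rule halves_integral(2)[OF M Lp_integrable_square[OF M u] Lp_integrable_square[OF M v]])
  show "(\<integral>z. halves u v z \<partial>(unit_interval \<Otimes>\<^sub>M M)) = ((\<integral>t. u t \<partial>M) + (\<integral>t. v t \<partial>M)) / 2"
    by (rule halves_integral(2)[OF M Lp_integrable[OF M u] Lp_integrable[OF M v]])
qed

abbreviation tensor_generators :: "('a \<Rightarrow> real) set \<Rightarrow> (real \<times> 'a \<Rightarrow> real) set" where
  "tensor_generators X \<equiv> {\<lambda>(s, t). x s * y t | x y. x \<in> Lp_dyadic p 1 \<and> y \<in> X}"

text \<open>An element of L_p^1 is constant on each half only almost everywhere, so a generator
  agrees with a function of the form \<open>halves\<close> only almost everywhere too, and its
  membership in L_p is transferred from there.\<close>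

lemma tensor_generator_AE:
  assumes M: "prob_space M" and x: "x \<in> Lp_dyadic p 1" and y: "y \<in> Lp p M"
  obtains a b where "AE z in unit_interval \<Otimes>\<^sub>M M. (\<lambda>(s, t). x s * y t) z = halves (\<lambda>t. a * y t) (\<lambda>t. b * y t) z"
    "(\<lambda>(s, t). x s * y t) \<in> Lp p (unit_interval \<Otimes>\<^sub>M M)"
proof -
  obtain a b where ab: "AE s in unit_interval. x s = (if s < 1/2 then a else b)"
    using Lp_dyadic_1_AE[OF x] by blast
  have AE: "AE z in unit_interval \<Otimes>\<^sub>M M. (\<lambda>(s, t). x s * y t) z = halves (\<lambda>t. a * y t) (\<lambda>t. b * y t) z"
    using AE_unit_pair[OF M ab] by eventually_elim (auto simp: halves_def)
  have "(\<lambda>z. x (fst z)) \<in> borel_measurable (unit_interval \<Otimes>\<^sub>M M)"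
    using x by (intro measurable_compose[OF measurable_fst]) (auto simp: Lp_dyadic_def Lp_iff)
  moreover have "(\<lambda>z. y (snd z)) \<in> borel_measurable (unit_interval \<Otimes>\<^sub>M M)"
    using y by (intro measurable_compose[OF measurable_snd]) (auto simp: Lp_iff)
  ultimately have m: "(\<lambda>(s, t). x s * y t) \<in> borel_measurable (unit_interval \<Otimes>\<^sub>M M)"
    by (simp add: case_prod_beta')
  have sc: "(\<lambda>t. c * y t) \<in> Lp p M" for c using Lp_lc[OF M y y, of c 0] by simp
  have "(\<lambda>(s, t). x s * y t) \<in> Lp p (unit_interval \<Otimes>\<^sub>M M)"
    by (rule Lp_cong_AE[OF halves_Lp(1)[OF M sc sc] m]) (use AE in eventually_elim, simp)
  then show thesis using that AE by blast
qed

lemma tensor_generators_Lp: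
  assumes "prob_space M" "X \<subseteq> Lp p M"
  shows "tensor_generators X \<subseteq> Lp p (unit_interval \<Otimes>\<^sub>M M)"
  using tensor_generator_AE[OF assms(1)] assms(2) by blast

lemma closed_subspace_tensor:
  assumes M: "prob_space M" and X: "X \<subseteq> Lp p M" and c: "\<And>c. (\<lambda>_. c) \<in> X"
  shows "closed_subspace (unit_interval \<Otimes>\<^sub>M M) (tensor p unit_interval (Lp_dyadic p 1) M X)"
    "(\<lambda>_. c) \<in> tensor p unit_interval (Lp_dyadic p 1) M X"
proof -
  note cs = closed_subspace_closed_span[OF prob_space_unit_pair[OF M] tensor_generators_Lp[OF M X]]
  show "closed_subspace (unit_interval \<Otimes>\<^sub>M M) (tensor p unit_interval (Lp_dyadic p 1) M X)"
    unfolding tensor_def by (rule cs)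
  \<comment> \<open>The constant 1 is written with two equal branches so that it is literally of the
    form known to lie in L_p^1.\<close>
  have "(\<lambda>(s, t). (if s < 1/2 then 1 else 1) * c) \<in> tensor_generators X"
    using halves_in_Lp_dyadic_1[of 1 1] assms(3)[of c]
    by (intro CollectI exI[of _ "\<lambda>s. if s < 1/2 then 1 else 1"] exI[of _ "\<lambda>_. c"]) simp
  then have g: "(\<lambda>_. c) \<in> tensor_generators X" by (simp add: case_prod_beta')
  show "(\<lambda>_. c) \<in> tensor p unit_interval (Lp_dyadic p 1) M X"
    unfolding tensor_def by (rule subsetD[OF cs(2) lin_span_base[OF g]])
qed

text \<open>The real line with all its norms equal to the absolute value, represented by functions
  on a given type of which only the value at \<open>x0\<close> counts. In this way it can stand in a
  family beside function spaces over that type.\<close>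

definition line :: "'i \<Rightarrow> 'i two_normed" where
  "line x0 = \<lparr>car = UNIV, pw = (\<lambda>f. \<bar>f x0\<bar> powr p), sq = (\<lambda>f. (f x0)\<^sup>2)\<rparr>"

lemma line_simps [simp]: "car (line x0) = UNIV" "pw (line x0) f = \<bar>f x0\<bar> powr p" "sq (line x0) f = (f x0)\<^sup>2"
  by (simp_all add: line_def)

lemma two_normed_space_line: "two_normed_space (line x0)"
proof -
  have "(a * y + b * z)\<^sup>2 \<le> 2 * (a\<^sup>2 * y\<^sup>2 + b\<^sup>2 * z\<^sup>2)" for a b y z :: real
    using zero_le_power2[of "a * y - b * z"] by (simp add: power2_eq_square algebra_simps)
  moreover have "\<bar>a * y + b * z\<bar> powr p \<le> 2 powr p * (\<bar>a\<bar> powr p * \<bar>y\<bar> powr p + \<bar>b\<bar> powr p * \<bar>z\<bar> powr p)"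
    for a b y z :: real
  proof -
    have "\<bar>a * y + b * z\<bar> powr p \<le> (\<bar>a * y\<bar> + \<bar>b * z\<bar>) powr p"
      using p_gt_2 by (intro powr_mono2) auto
    also have "\<dots> \<le> 2 powr p * (\<bar>a * y\<bar> powr p + \<bar>b * z\<bar> powr p)"
      using p_gt_2 by (intro powr_add_le) auto
    finally show ?thesis by (simp add: abs_mult powr_mult)
  qed
  ultimately show ?thesis unfolding two_normed_space_def by simp
qed

lemma is_complete_line: "is_complete (line x0)"
  unfolding is_complete_def
proof (intro allI impI)
  fix u assume c: "is_cauchy (line x0) u"
  have "Cauchy (\<lambda>n. u n x0)"
  proof (rule CauchyI)
    fix \<epsilon> :: real assume "0 < \<epsilon>"
    then obtain N where N: "\<forall>m\<ge>N. \<forall>n\<ge>N. wt (line x0) (\<lambda>x. u m x - u n x) < \<epsilon> powr p"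
      using c unfolding is_cauchy_def by (metis powr_gt_zero less_irrefl)
    have "norm (u m x0 - u n x0) < \<epsilon>" if "m \<ge> N" "n \<ge> N" for m n
    proof (rule ccontr)
      assume "\<not> norm (u m x0 - u n x0) < \<epsilon>"
      then have "\<epsilon> powr p \<le> \<bar>u m x0 - u n x0\<bar> powr p" using \<open>0 < \<epsilon>\<close> p_gt_2 by (intro powr_mono2) auto
      also have "\<dots> \<le> wt (line x0) (\<lambda>x. u m x - u n x)" by (simp add: wt_def)
      also have "\<dots> < \<epsilon> powr p" using N that by blast
      finally show False by simp
    qed
    then show "\<exists>N. \<forall>m\<ge>N. \<forall>n\<ge>N. norm (u m x0 - u n x0) < \<epsilon>" by blast
  qed
  then obtain l where "(\<lambda>n. u n x0) \<longlonglongrightarrow> l" using Cauchy_convergent_iff convergent_def by blast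
  then have l: "(\<lambda>n. u n x0 - l) \<longlonglongrightarrow> 0" by (simp add: LIM_zero)
  have "(\<lambda>n. \<bar>u n x0 - l\<bar> powr p + ((u n x0 - l)\<^sup>2) powr (p / 2)) \<longlonglongrightarrow> 0 + 0"
    using p_gt_2 tendsto_rabs_zero[OF l] tendsto_power[OF l, of 2]
    by (intro tendsto_add tendsto_zero_powrI) (auto intro!: tendsto_const)
  then have "converges (line x0) u (\<lambda>_. l)" by (simp add: converges_def wt_def)
  then show "\<exists>f\<in>car (line x0). converges (line x0) u f" by auto
qed

text \<open>Mean-zero functions are orthogonal to constants, so the squares add exactly. In L_p the
  mean is a contraction, so f + c controls |c| and then, by subtraction, f.\<close>

lemma shift_by_constant:
  assumes M: "prob_space M" and f: "f \<in> Lp p M" "(\<integral>t. f t \<partial>M) = 0"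
  shows "(\<lambda>t. f t + c) \<in> Lp p M" "(\<integral>t. f t + c \<partial>M) = c"
    "(\<integral>t. (f t + c)\<^sup>2 \<partial>M) = (\<integral>t. (f t)\<^sup>2 \<partial>M) + c\<^sup>2"
    "pmom M (\<lambda>t. f t + c) \<le> 2 powr p * (pmom M f + \<bar>c\<bar> powr p)"
    "\<bar>c\<bar> powr p \<le> pmom M (\<lambda>t. f t + c)"
    "pmom M f \<le> 2 * 2 powr p * pmom M (\<lambda>t. f t + c)"
proof -
  interpret prob_space M by fact
  have c: "(\<lambda>_. c) \<in> Lp p M" "(\<lambda>_. - c) \<in> Lp p M" by (intro Lp_const M)+
  show L: "(\<lambda>t. f t + c) \<in> Lp p M" using Lp_lc[OF M f(1) c(1), of 1 1] by simp
  show m: "(\<integral>t. f t + c \<partial>M) = c" using Lp_integrable[OF M f(1)] f(2) by (simp add: prob_space)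
  have "(\<lambda>t. (f t + c)\<^sup>2) = (\<lambda>t. (f t)\<^sup>2 + c\<^sup>2 + (2 * c) * f t)"
    by (auto simp: power2_eq_square algebra_simps)
  then show "(\<integral>t. (f t + c)\<^sup>2 \<partial>M) = (\<integral>t. (f t)\<^sup>2 \<partial>M) + c\<^sup>2"
    using Lp_integrable[OF M f(1)] Lp_integrable_square[OF M f(1)] f(2) by (simp add: prob_space)
  show "pmom M (\<lambda>t. f t + c) \<le> 2 powr p * (pmom M f + \<bar>c\<bar> powr p)"
    using pmom_add[OF M f(1) c(1)] by (simp add: pmom_const[OF M])
  show ge: "\<bar>c\<bar> powr p \<le> pmom M (\<lambda>t. f t + c)" using abs_integral_le_pmom[OF M L] by (simp add: m)
  have "pmom M f \<le> 2 powr p * (pmom M (\<lambda>t. f t + c) + \<bar>c\<bar> powr p)"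
    using pmom_add[OF M L c(2)] by (simp add: pmom_const[OF M])
  also have "\<dots> \<le> 2 powr p * (pmom M (\<lambda>t. f t + c) + pmom M (\<lambda>t. f t + c))"
    using ge by (intro mult_left_mono add_left_mono) auto
  finally show "pmom M f \<le> 2 * 2 powr p * pmom M (\<lambda>t. f t + c)" by (simp add: algebra_simps)
qed

end

section \<open>Splitting off means: the tensor product with L_p^1 and the constants\<close>

context exponent
begin

text \<open>A function on the product is determined by its two halves, and each half by its
  mean-zero part and its mean. If the total mean vanishes, the means of the halves are c and -c, so
  a single real coordinate remains, at index 2.\<close>

lemma halving_iso:
  fixes M :: "'a measure" and x0 :: 'a
  assumes M: "prob_space M" and X: "closed_subspace M X" and constants: "\<And>c. (\<lambda>_. c) \<in> X"
  shows "isomorphic (4 powr p * (9 * 2 powr p + 2))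
    (dsum {0, 1, 2 :: nat} (\<lambda>i. if i = 2 then line x0 else lp_space M (mean_zero M X)))
    (lp_space (unit_interval \<Otimes>\<^sub>M M)
      (mean_zero (unit_interval \<Otimes>\<^sub>M M) (tensor p unit_interval (Lp_dyadic p 1) M X)))"
proof -
  \<comment> \<open>Large enough for all estimates at once: 8 * 2^p + 2 for \<open>pw\<close> of the
    inverse, 2^p for the map itself, and 2 and 2^(p/2) for \<open>sq\<close> and its power. The
    factor 4^p in the statement is the price of the extension by density.\<close>
  define L where "L = (9 * 2 powr p + 2 :: real)"
  interpret M: prob_space M by fact
  have L: "1 \<le> L" "2 \<le> L" unfolding L_def by simp_all
  define Q where "Q = unit_interval \<Otimes>\<^sub>M M"
  have Q: "prob_space Q" unfolding Q_def by (rule prob_space_unit_pair[OF M])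
  interpret Q: prob_space Q by fact
  define Y where "Y = mean_zero M X"
  have Y: "closed_subspace M Y" unfolding Y_def by (rule closed_subspace_mean_zero[OF M X])
  have XL: "X \<subseteq> Lp p M" using closed_subspaceD(1)[OF X] by blast
  have YL: "f \<in> Lp p M" and Y0: "(\<integral>t. f t \<partial>M) = 0" and YX: "f \<in> X" if "f \<in> Y" for f
    using that XL by (auto simp: Y_def mean_zero_def)
  have addX: "(\<lambda>t. f t + c) \<in> X" if "f \<in> X" for f c
    using closed_subspaceD(3)[OF X that constants[of c], of 1 1] by simp
  define A where "A = dsum {0, 1, 2 :: nat} (\<lambda>i. if i = 2 then line x0 else lp_space M Y)"
  define G where "G = tensor_generators X"
  have GL: "G \<subseteq> Lp p Q" unfolding G_def Q_def by (rule tensor_generators_Lp[OF M XL])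
  define Z where "Z = closed_span p Q G"
  have Zc: "closed_subspace Q Z" "lin_span G \<subseteq> Z"
    unfolding Z_def by (rule closed_subspace_closed_span[OF Q GL])+
  define B where "B = lp_space Q (mean_zero Q Z)"
  have tn: "two_normed_space (if i = 2 then line x0 else lp_space M Y)"
    "is_complete (if i = 2 then line x0 else lp_space M Y)" for i :: nat
    using two_normed_space_line is_complete_line two_normed_space_lp[OF M Y] is_complete_lp[OF M Y] by auto
  have A: "two_normed_space A" "is_complete A"
    unfolding A_def by (intro two_normed_space_dsum is_complete_dsum tn)+
  have B: "two_normed_space B" "is_complete B"
    unfolding B_def by (intro two_normed_space_lp is_complete_lp Q closed_subspace_mean_zero Zc)+
  have inA: "f \<in> car A \<longleftrightarrow> (\<lambda>t. f (0, t)) \<in> Y \<and> (\<lambda>t. f (1, t)) \<in> Y" for f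
    unfolding A_def by (subst in_dsum_finite) auto
  have pwA: "pw A f = pmom M (\<lambda>t. f (0, t)) + pmom M (\<lambda>t. f (1, t)) + \<bar>f (2, x0)\<bar> powr p" for f
    unfolding A_def pw_dsum by simp
  have sqA: "sq A f = (\<integral>t. (f (0, t))\<^sup>2 \<partial>M) + (\<integral>t. (f (1, t))\<^sup>2 \<partial>M) + (f (2, x0))\<^sup>2" for f
    unfolding A_def sq_dsum by simp
  define T where "T f = halves (\<lambda>t. f (0, t) + f (2, x0)) (\<lambda>t. f (1, t) + - f (2, x0))"
    for f :: "nat \<times> 'a \<Rightarrow> real"
  define D where "D f F \<longleftrightarrow> f \<in> car A \<and> F = T f" for f F
  have T_lin: "T (\<lambda>x. a * f x + b * g x) = (\<lambda>z. a * T f z + b * T g z)" for f g a b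
    by (auto simp: T_def halves_def algebra_simps)
  have T_props: "T f \<in> lin_span G \<and> T f \<in> Lp p Q \<and> (\<integral>z. T f z \<partial>Q) = 0 \<and>
      2 * (\<integral>z. (T f z)\<^sup>2 \<partial>Q) = (\<integral>t. (f (0, t))\<^sup>2 \<partial>M) + (\<integral>t. (f (1, t))\<^sup>2 \<partial>M) + 2 * (f (2, x0))\<^sup>2 \<and>
      pmom Q (T f) \<le> 2 powr p * pw A f \<and> pw A f \<le> (8 * 2 powr p + 2) * pmom Q (T f)"
    if f: "f \<in> car A" for f
  proof -
    define c where "c = f (2, x0)"
    define u where "u t = f (0, t)" for t
    define v where "v t = f (1, t)" for t
    have u: "u \<in> Y" and v: "v \<in> Y" using f by (auto simp: inA u_def[abs_def] v_def[abs_def])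
    have Tf: "T f = halves (\<lambda>t. u t + c) (\<lambda>t. v t + - c)" by (simp add: T_def u_def v_def c_def)
    note su = shift_by_constant[OF M YL[OF u] Y0[OF u], of c]
    note sv = shift_by_constant[OF M YL[OF v] Y0[OF v], of "- c"]
    note h = halves_Lp[OF M su(1) sv(1), folded Q_def, folded Tf]
    have g1: "(\<lambda>(s, t). (if s < 1/2 then 1 else 0) * (u t + c)) \<in> G"
      unfolding G_def using halves_in_Lp_dyadic_1[of 1 0] addX[OF YX[OF u]]
      by (intro CollectI exI[of _ "\<lambda>s. if s < 1/2 then 1 else 0"] exI[of _ "\<lambda>t. u t + c"]) simp
    have g2: "(\<lambda>(s, t). (if s < 1/2 then 0 else 1) * (v t + - c)) \<in> G"
      unfolding G_def using halves_in_Lp_dyadic_1[of 0 1] addX[OF YX[OF v], of "- c"]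
      by (intro CollectI exI[of _ "\<lambda>s. if s < 1/2 then 0 else 1"] exI[of _ "\<lambda>t. v t + - c"]) simp
    have "T f = (\<lambda>z. 1 * (\<lambda>(s, t). (if s < 1/2 then 1 else 0) * (u t + c)) z
        + 1 * (\<lambda>(s, t). (if s < 1/2 then 0 else 1) * (v t + - c)) z)"
      unfolding Tf by (auto simp: halves_def)
    then have 1: "T f \<in> lin_span G"
      by (simp only: lin_span_lc[OF lin_span_base[OF g1] lin_span_base[OF g2], of 1 1])
    have 2: "(\<integral>z. T f z \<partial>Q) = 0" unfolding h(4) su(2) sv(2) by simp
    have 3: "2 * (\<integral>z. (T f z)\<^sup>2 \<partial>Q) = (\<integral>t. (f (0, t))\<^sup>2 \<partial>M) + (\<integral>t. (f (1, t))\<^sup>2 \<partial>M) + 2 * (f (2, x0))\<^sup>2"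
      unfolding h(3) su(3) sv(3) by (simp add: u_def v_def c_def)
    have pwA': "pw A f = pmom M u + pmom M v + \<bar>c\<bar> powr p"
      unfolding pwA u_def[abs_def] v_def[abs_def] c_def ..
    have cm: "\<bar>- c\<bar> powr p = \<bar>c\<bar> powr p" by simp
    have "pmom Q (T f) \<le> (2 powr p * (pmom M u + \<bar>c\<bar> powr p) + 2 powr p * (pmom M v + \<bar>c\<bar> powr p)) / 2"
      unfolding h(2) using su(4) sv(4) unfolding cm by (intro divide_right_mono add_mono) auto
    also have "\<dots> = 2 powr p * (pw A f - (pmom M u + pmom M v) / 2)"
      unfolding pwA' by (simp add: field_simps)
    also have "\<dots> \<le> 2 powr p * pw A f" by (intro mult_left_mono) auto
    finally have 4: "pmom Q (T f) \<le> 2 powr p * pw A f" .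
    have nn: "0 \<le> pmom M (\<lambda>t. u t + c)" "0 \<le> pmom M (\<lambda>t. v t + - c)" by auto
    have le: "pmom M (\<lambda>t. u t + c) \<le> 2 * pmom Q (T f)" "pmom M (\<lambda>t. v t + - c) \<le> 2 * pmom Q (T f)"
      unfolding h(2) using nn by auto
    \<comment> \<open>Recovering a mean-zero part from its half costs 2 * 2^p, and each half has at
      most twice the moment of the whole, since it occupies measure 1/2. This happens for both
      halves; |c|^p adds the last term.\<close>
    have "pw A f \<le> 2 * 2 powr p * (2 * pmom Q (T f)) + 2 * 2 powr p * (2 * pmom Q (T f)) + 2 * pmom Q (T f)"
      unfolding pwA'
      by (intro add_mono order_trans[OF su(6)] order_trans[OF sv(6)] order_trans[OF su(5)] mult_left_mono le) auto
    also have "\<dots> = (8 * 2 powr p + 2) * pmom Q (T f)" by (simp add: algebra_simps)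
    finally show ?thesis using 1 2 3 4 h(1) by blast
  qed
  have rel: "linear_relation L A B D"
  proof (rule linear_relationI[OF L(1)])
    fix f F assume D: "D f F"
    then show f: "f \<in> car A" by (simp add: D_def)
    have F: "F = T f" using D by (simp add: D_def)
    note t = T_props[OF f]
    show FB: "F \<in> car B" unfolding F B_def using t Zc(2) by (auto simp: mean_zero_def)
    define S where "S = (\<integral>z. (F z)\<^sup>2 \<partial>Q)"
    have sqB: "sq B F = S" by (simp add: B_def S_def)
    have S2: "2 * S = (\<integral>t. (f (0, t))\<^sup>2 \<partial>M) + (\<integral>t. (f (1, t))\<^sup>2 \<partial>M) + 2 * (f (2, x0))\<^sup>2"
      using t unfolding S_def F by blast
    have i: "0 \<le> (\<integral>t. (f (0, t))\<^sup>2 \<partial>M)" "0 \<le> (\<integral>t. (f (1, t))\<^sup>2 \<partial>M)"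
      by (rule Bochner_Integration.integral_nonneg, simp)+
    have 1: "S \<le> sq A f" "sq A f \<le> 2 * S" using S2 i zero_le_power2[of "f (2, x0)"] unfolding sqA by linarith+
    have nn: "0 \<le> S" "0 \<le> sq A f" "0 \<le> pw A f" "0 \<le> wt A f" "0 \<le> wt B F"
      using sq_nonneg[OF B(1) FB] sq_nonneg[OF A(1) f] pw_nonneg[OF A(1) f] wt_nonneg[OF A(1) f] wt_nonneg[OF B(1) FB]
      by (auto simp: sqB)
    have wB: "wt B F = pmom Q F + S powr (p / 2)" by (simp add: wt_def sqB) (simp add: B_def)
    have p1: "1 \<le> (2::real) powr p" using p_gt_2 by (intro ge_one_powr_ge_zero) auto
    have "S powr (p / 2) \<le> 1 * sq A f powr (p / 2)" using 1 nn p_gt_2 by (auto intro!: powr_mono2)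
    also have "\<dots> \<le> 2 powr p * sq A f powr (p / 2)" using p1 by (intro mult_right_mono) auto
    finally have "wt B F \<le> 2 powr p * wt A f"
      unfolding wB wt_def[of A] distrib_left using t unfolding F by (intro add_mono) auto
    also have "\<dots> \<le> L * wt A f" unfolding L_def using nn(4) by (intro mult_right_mono) auto
    finally have 2: "wt B F \<le> L * wt A f" .
    have "sq A f powr (p / 2) \<le> (2 * S) powr (p / 2)" using 1 nn p_gt_2 by (auto intro!: powr_mono2)
    also have "\<dots> = 2 powr (p / 2) * S powr (p / 2)" using nn by (simp add: powr_mult)
    also have "\<dots> \<le> L * S powr (p / 2)"
    proof (rule mult_right_mono)
      have "2 powr (p / 2) \<le> (2::real) powr p" using p_gt_2 by (intro powr_mono) auto
      then show "2 powr (p / 2) \<le> L" unfolding L_def using p1 by linarith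
    qed simp
    finally have "sq A f powr (p / 2) \<le> L * S powr (p / 2)" .
    moreover have "pw A f \<le> L * pmom Q F"
    proof -
      have "pw A f \<le> (8 * 2 powr p + 2) * pmom Q F" using t unfolding F by blast
      also have "\<dots> \<le> L * pmom Q F" unfolding L_def by (intro mult_right_mono) auto
      finally show ?thesis .
    qed
    ultimately have 3: "wt A f \<le> L * wt B F" unfolding wB wt_def[of A] distrib_left by (rule add_mono[rotated])
    have "sq B F \<le> L * sq A f" "sq A f \<le> L * sq B F"
      unfolding sqB using 1 mult_right_mono[OF L(1) nn(2)] mult_right_mono[OF L(2) nn(1)] by linarith+
    then show "comparable L A B f F" unfolding comparable_def using 2 3 by blast
  next
    fix f F g H a b assume "D f F" "D g H"
    then show "D (\<lambda>x. a * f x + b * g x) (\<lambda>x. a * F x + b * H x)"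
      unfolding D_def T_lin using lc_car[OF A(1)] by simp
  qed
  show ?thesis
    unfolding tensor_def Q_def[symmetric] Y_def[symmetric] A_def[symmetric] G_def[symmetric] Z_def[symmetric]
      B_def[symmetric] L_def[symmetric]
  proof (rule iso_from_dense[OF A B rel])
    fix f and \<epsilon> :: real assume f: "f \<in> car A" and "0 < \<epsilon>"
    have "wt A (\<lambda>x. f x - f x) = 0" using p_gt_2 by (simp add: wt_def sq_zero[OF A(1)] pw_zero[OF A(1)])
    then show "\<exists>g H. D g H \<and> wt A (\<lambda>x. g x - f x) < \<epsilon>"
      using f \<open>0 < \<epsilon>\<close> by (intro exI[of _ f] exI[of _ "T f"]) (simp add: D_def)
  next
    fix F and \<epsilon> :: real assume F: "F \<in> car B" and "0 < \<epsilon>"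
    have F': "F \<in> mean_zero Q (closed_span p Q G)" using F by (simp add: B_def Z_def)
    obtain h where h: "h \<in> lin_span G" "pmom Q (\<lambda>x. (h x - (\<integral>x. h x \<partial>Q)) - F x) < \<epsilon> / 2"
      using closed_span_mean_zero_dense[OF Q GL F', of "\<epsilon> / 2"] \<open>0 < \<epsilon>\<close> by auto
    \<comment> \<open>Only almost everywhere equality can be required, because the generators are of
      the form \<open>halves\<close> only almost everywhere.\<close>
    define S where "S = {h. \<exists>c f. f \<in> car A \<and> (AE z in Q. h z = c + T f z)}"
    have "lin_span G \<subseteq> S"
    proof (rule lin_span_minimal)
      have "T (\<lambda>_. 0) = (\<lambda>_. 0)" by (auto simp: T_def halves_def)
      then show "(\<lambda>_. 0) \<in> S" unfolding S_def using zero_car[OF A(1)]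
        by (intro CollectI exI[of _ 0] exI[of _ "\<lambda>_. 0"]) simp
      show "G \<subseteq> S"
      proof
        fix g assume "g \<in> G"
        then obtain x y where g: "g = (\<lambda>(s, t). x s * y t)" and x: "x \<in> Lp_dyadic p 1" and y: "y \<in> X"
          unfolding G_def by blast
        have yL: "y \<in> Lp p M" using y XL by blast
        obtain a b where ab: "AE z in Q. g z = halves (\<lambda>t. a * y t) (\<lambda>t. b * y t) z"
          using tensor_generator_AE[OF M x yL] unfolding g Q_def by metis
        define m where "m = (\<integral>t. y t \<partial>M)"
        have y0: "(\<lambda>t. r * y t - r * m) \<in> Y" for r
        proof -
          have "(\<lambda>t. r * y t + (- r * m) * 1) \<in> X" using closed_subspaceD(3)[OF X y constants[of 1]] .
          moreover have "(\<integral>t. r * y t - r * m \<partial>M) = 0"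
            using Lp_integrable[OF M yL] by (simp add: m_def M.prob_space)
          ultimately show ?thesis by (simp add: Y_def mean_zero_def)
        qed
        \<comment> \<open>The halves a*y and b*y have means a*m and b*m. Their average is the total
          mean, and half of their difference is the real coordinate.\<close>
        define f where "f = (\<lambda>(i::nat, t). if i = 0 then a * y t - a * m else if i = 1 then b * y t - b * m
            else (a * m - b * m) / 2)"
        have "f \<in> car A" using y0 by (simp add: inA f_def)
        moreover have "halves (\<lambda>t. a * y t) (\<lambda>t. b * y t) z = (a * m + b * m) / 2 + T f z" for z
          by (cases z) (simp add: T_def halves_def f_def field_simps)
        ultimately show "g \<in> S" unfolding S_def using ab by auto
      qed
    next
      fix g k a b assume "g \<in> S" "k \<in> S"
      then obtain c f c' f' where f: "f \<in> car A" "f' \<in> car A"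
        and AE: "AE z in Q. g z = c + T f z" "AE z in Q. k z = c' + T f' z"
        unfolding S_def by blast
      have "AE z in Q. a * g z + b * k z = (a * c + b * c') + T (\<lambda>x. a * f x + b * f' x) z"
        using AE by eventually_elim (simp add: T_lin algebra_simps)
      then show "(\<lambda>x. a * g x + b * k x) \<in> S"
        unfolding S_def using lc_car[OF A(1) f, of a b]
        by (intro CollectI exI[of _ "a * c + b * c'"] exI[of _ "\<lambda>x. a * f x + b * f' x"] conjI)
    qed
    then obtain c f where f: "f \<in> car A" and AE: "AE z in Q. h z = c + T f z" using h(1) unfolding S_def by blast
    have hL: "h \<in> Lp p Q" using lin_span_Lp[OF Q GL] h(1) by blast
    have TL: "T f \<in> Lp p Q" "(\<integral>z. T f z \<partial>Q) = 0" using T_props[OF f] by auto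
    have FL: "F \<in> Lp p Q" using F' by (simp add: mean_zero_def closed_span_iff)
    have meas: "h \<in> borel_measurable Q" "T f \<in> borel_measurable Q" "F \<in> borel_measurable Q"
      using hL TL FL by (auto simp: Lp_iff)
    have "(\<integral>x. h x \<partial>Q) = (\<integral>z. c + T f z \<partial>Q)"
      by (rule integral_cong_AE) (use AE meas in auto)
    also have "\<dots> = c" using TL Lp_integrable[OF Q TL(1)] by (simp add: Q.prob_space)
    finally have hc: "(\<integral>x. h x \<partial>Q) = c" .
    have "pmom Q (\<lambda>x. (h x - c) - F x) = pmom Q (\<lambda>x. T f x - F x)"
      by (rule pmom_cong_AE) (use AE meas in auto)
    then have "wt B (\<lambda>x. T f x - F x) < \<epsilon>"
      using h(2) wt_lp_le[OF Q Lp_diff[OF Q TL(1) FL], of "mean_zero Q Z"] unfolding B_def hc by linarith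
    then show "\<exists>g H. D g H \<and> wt B (\<lambda>x. H x - F x) < \<epsilon>" unfolding D_def using f by blast
  qed
qed

text \<open>The map (f, c) to f + c is onto, since every F is the sum of F minus its mean and its
  mean; \<open>shift_by_constant\<close> gives the estimates.\<close>

lemma constant_iso:
  fixes M :: "'a measure" and x0 :: 'a
  assumes M: "prob_space M" and X: "closed_subspace M X" and constants: "\<And>c. (\<lambda>_. c) \<in> X"
  shows "isomorphic (2 * 2 powr p + 1)
    (dsum {0, 1 :: nat} (\<lambda>i. if i = 1 then line x0 else lp_space M (mean_zero M X))) (lp_space M X)"
proof -
  define L where "L = (2 * 2 powr p + 1 :: real)"
  interpret M: prob_space M by fact
  have L: "1 \<le> L" unfolding L_def by simp
  define Y where "Y = mean_zero M X"
  have Y: "closed_subspace M Y" unfolding Y_def by (rule closed_subspace_mean_zero[OF M X])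
  have XL: "f \<in> Lp p M" if "f \<in> X" for f using closed_subspaceD(1)[OF X that] .
  have YL: "f \<in> Lp p M" and Y0: "(\<integral>t. f t \<partial>M) = 0" and YX: "f \<in> X" if "f \<in> Y" for f
    using that XL by (auto simp: Y_def mean_zero_def)
  have addX: "(\<lambda>t. f t + c) \<in> X" if "f \<in> X" for f c
    using closed_subspaceD(3)[OF X that constants[of c], of 1 1] by simp
  define A where "A = dsum {0, 1 :: nat} (\<lambda>i. if i = 1 then line x0 else lp_space M Y)"
  define B where "B = lp_space M X"
  have A: "two_normed_space A"
    unfolding A_def using two_normed_space_line two_normed_space_lp[OF M Y]
    by (intro two_normed_space_dsum) auto
  have B: "two_normed_space B" unfolding B_def by (rule two_normed_space_lp[OF M X])
  have inA: "f \<in> car A \<longleftrightarrow> (\<lambda>t. f (0, t)) \<in> Y" for f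
    unfolding A_def by (subst in_dsum_finite) auto
  have pwA: "pw A f = pmom M (\<lambda>t. f (0, t)) + \<bar>f (1, x0)\<bar> powr p" for f
    unfolding A_def pw_dsum by simp
  have sqA: "sq A f = (\<integral>t. (f (0, t))\<^sup>2 \<partial>M) + (f (1, x0))\<^sup>2" for f
    unfolding A_def sq_dsum by simp
  define T where "T f = (\<lambda>t. f (0, t) + f (1, x0))" for f :: "nat \<times> 'a \<Rightarrow> real"
  show ?thesis
    unfolding Y_def[symmetric] A_def[symmetric] B_def[symmetric] L_def[symmetric]
  proof (rule isoI[where D = "\<lambda>f F. f \<in> car A \<and> F = T f"])
    show "linear_relation L A B (\<lambda>f F. f \<in> car A \<and> F = T f)"
    proof (rule linear_relationI[OF L])
      fix f F assume D: "f \<in> car A \<and> F = T f"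
      then show f: "f \<in> car A" by simp
      have u: "(\<lambda>t. f (0, t)) \<in> Y" using f by (simp add: inA)
      note s = shift_by_constant[OF M YL[OF u] Y0[OF u], of "f (1, x0)", folded T_def]
      show F: "F \<in> car B" using D addX[OF YX[OF u]] by (simp add: B_def T_def)
      have sq: "sq B F = sq A f" using D s(3) by (simp add: B_def sqA T_def)
      have nn: "0 \<le> sq A f" "0 \<le> pw A f" "0 \<le> pw B F"
        using A B f F by (auto simp: sq_nonneg pw_nonneg)
      have pB: "pw B F = pmom M (T f)" using D by (simp add: B_def)
      have "pw B F \<le> 2 powr p * pw A f" unfolding pB pwA by (rule s(4))
      also have "\<dots> \<le> L * pw A f" unfolding L_def using nn by (intro mult_right_mono) auto
      finally have 1: "pw B F \<le> L * pw A f" .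
      have 2: "pw A f \<le> L * pw B F"
        unfolding pB pwA L_def distrib_right using s(5,6) by (intro add_mono) auto
      have 3: "sq A f \<le> L * sq A f" "sq A f powr (p / 2) \<le> L * sq A f powr (p / 2)"
        using mult_right_mono[OF L nn(1)] mult_right_mono[OF L, of "sq A f powr (p / 2)"] by auto
      show "comparable L A B f F"
        unfolding comparable_def wt_def sq distrib_left
        using 3 add_mono[OF 1 3(2)] add_mono[OF 2 3(2)] by blast
    next
      fix f F g H a b assume "f \<in> car A \<and> F = T f" "g \<in> car A \<and> H = T g"
      then show "(\<lambda>x. a * f x + b * g x) \<in> car A \<and> (\<lambda>x. a * F x + b * H x) = T (\<lambda>x. a * f x + b * g x)"
        using lc_car[OF A] by (auto simp: T_def algebra_simps)
    qed
  next
    fix F assume F: "F \<in> car B"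
    define m where "m = (\<integral>t. F t \<partial>M)"
    have FX: "F \<in> X" using F by (simp add: B_def)
    define f where "f = (\<lambda>(i::nat, t). if i = 0 then F t - m else m)"
    have "(\<lambda>t. F t + - m) \<in> X" by (rule addX[OF FX])
    moreover have "(\<integral>t. F t - m \<partial>M) = 0"
      using Lp_integrable[OF M XL[OF FX]] by (simp add: m_def M.prob_space)
    ultimately have "f \<in> car A" by (simp add: inA f_def Y_def mean_zero_def)
    moreover have "F = T f" by (simp add: T_def f_def)
    ultimately show "\<exists>f. f \<in> car A \<and> F = T f" by blast
  qed auto
qed

end

section \<open>Multiplicities of summands\<close>

text \<open>All infinite sets receive the value \<infinity>. For countable sets, which alone are
  compared, this determines the set up to equipotence.\<close>

definition ecard :: "'a set \<Rightarrow> enat" where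
  "ecard A = (if finite A then enat (card A) else \<infinity>)"

definition below :: "enat \<Rightarrow> nat set" where
  "below k = {n. enat n < k}"

lemma below_simps [simp]: "below \<infinity> = UNIV" "below (enat j) = {..<j}" "below 0 = {}" "below 1 = {0}"
  by (auto simp: below_def zero_enat_def one_enat_def)

lemma ecard_below [simp]: "ecard (below k) = k"
  by (cases k) (auto simp: ecard_def)

lemma eqpoll_iff_ecard:
  assumes "countable A" "countable B"
  shows "A \<approx> B \<longleftrightarrow> ecard A = ecard B"
proof
  assume "A \<approx> B"
  then show "ecard A = ecard B"
    using eqpoll_finite_iff[of A B] eqpoll_iff_card[of A B] by (auto simp: ecard_def)
next
  assume eq: "ecard A = ecard B"
  show "A \<approx> B"
  proof (cases "finite A")
    case True
    then have "finite B" using eq by (auto simp: ecard_def split: if_splits)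
    then show ?thesis using True eq by (auto simp: ecard_def eqpoll_iff_card)
  next
    case False
    then have "infinite B" using eq by (auto simp: ecard_def split: if_splits)
    have "A \<approx> (UNIV :: nat set)" "B \<approx> (UNIV :: nat set)"
      unfolding eqpoll_def
      by (rule exI, rule to_nat_on_infinite[OF assms(1) False],
          rule exI, rule to_nat_on_infinite[OF assms(2) \<open>infinite B\<close>])
    then show ?thesis by (rule eqpoll_trans[OF _ eqpoll_sym])
  qed
qed

lemma below_eqpoll_iff: "countable A \<Longrightarrow> below k \<approx> A \<longleftrightarrow> ecard A = k"
  by (subst eqpoll_iff_ecard) auto

lemma below_add_eqpoll: "below (a + b) \<approx> below a <+> below b"
proof -
  have "ecard (below a <+> below b) = ecard (below a) + ecard (below b)"
    by (auto simp: ecard_def card_Plus finite_Plus_iff simp del: ecard_below)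
  then show ?thesis by (subst below_eqpoll_iff) auto
qed

definition indic :: "'l set \<Rightarrow> 'l \<Rightarrow> enat" where
  "indic S l = (if l \<in> S then 1 else 0)"

definition infinite_copies :: "'l set \<Rightarrow> 'l \<Rightarrow> enat" where
  "infinite_copies S l = (if l \<in> S then \<infinity> else 0)"

text \<open>\<open>N\<close> is the pointwise sum of the multiplicity functions m(i), possibly
  infinitely many. Equipotence expresses this directly in the form from which a bijection between
  index sets of summands is read off.\<close>

definition family_total :: "'k set \<Rightarrow> ('k \<Rightarrow> 'l \<Rightarrow> enat) \<Rightarrow> ('l \<Rightarrow> enat) \<Rightarrow> bool" where
  "family_total I m N \<longleftrightarrow> (\<forall>l. below (N l) \<approx> (SIGMA i:I. below (m i l)))"

text \<open>Treating a sum of two as a family over \<open>bool\<close> makes the rule for finite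
  sums an instance of the rule for families.\<close>

lemma family_total_bool: "family_total UNIV (\<lambda>b. if b then m else m') (m + m')"
  unfolding family_total_def
proof
  fix l
  have "bij_betw (case_sum (Pair True) (Pair False)) (below (m l) <+> below (m' l))
      (SIGMA b:UNIV. below ((if b then m else m') l))"
    by (rule bij_betw_byWitness[where f' = "\<lambda>(b, n). if b then Inl n else Inr n"]) (auto split: if_splits)
  then have "below (m l) <+> below (m' l) \<approx> (SIGMA b:UNIV. below ((if b then m else m') l))"
    unfolding eqpoll_def by blast
  then show "below ((m + m') l) \<approx> (SIGMA b:UNIV. below ((if b then m else m') l))"
    using below_add_eqpoll[of "m l" "m' l"] eqpoll_trans by fastforce
qed

lemma family_total_add:
  assumes "family_total I m N" "family_total I m' N'"
  shows "family_total I (\<lambda>i. m i + m' i) (N + N')"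
  unfolding family_total_def
proof
  fix l
  let ?A = "\<lambda>i. below (m i l)" and ?B = "\<lambda>i. below (m' i l)"
  have "below ((N + N') l) \<approx> below (N l) <+> below (N' l)" using below_add_eqpoll by simp
  also have "\<dots> \<approx> Sigma I ?A <+> Sigma I ?B"
    using assms unfolding family_total_def by (intro sum_eqpoll_cong) auto
  also have "\<dots> \<approx> (SIGMA i:I. ?A i <+> ?B i)"
  proof -
    have "bij_betw (case_sum (\<lambda>(i, a). (i, Inl a)) (\<lambda>(i, b). (i, Inr b)))
        (Sigma I ?A <+> Sigma I ?B) (SIGMA i:I. ?A i <+> ?B i)"
      by (rule bij_betw_byWitness[where f' = "\<lambda>(i, s). case_sum (\<lambda>a. Inl (i, a)) (\<lambda>b. Inr (i, b)) s"]) auto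
    then show ?thesis unfolding eqpoll_def by blast
  qed
  also have "\<dots> \<approx> (SIGMA i:I. below ((m i + m' i) l))"
    by (rule Sigma_eqpoll_cong[OF bij_betw_id]) (simp add: below_add_eqpoll eqpoll_sym)
  finally show "below ((N + N') l) \<approx> (SIGMA i:I. below ((m i + m' i) l))" .
qed

lemma family_total_single:
  assumes "inj_on f I"
  shows "family_total I (\<lambda>i. indic {f i}) (indic (f ` I))"
  unfolding family_total_def
proof
  fix l
  show "below (indic (f ` I) l) \<approx> (SIGMA i:I. below (indic {f i} l))"
  proof (cases "l \<in> f ` I")
    case True
    then obtain i where i: "i \<in> I" "l = f i" by blast
    then have "(SIGMA i:I. below (indic {f i} l)) = {(i, 0)}"
      using assms by (auto simp: indic_def inj_on_def split: if_splits)
    then show ?thesis using True by (simp add: indic_def singleton_eqpoll)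
  next
    case False
    then have "(SIGMA i:I. below (indic {f i} l)) = {}" by (auto simp: indic_def split: if_splits)
    then show ?thesis using False by (simp add: indic_def)
  qed
qed

text \<open>A label contained in infinitely many of the sets gets infinite multiplicity, and since
  \<open>I\<close> is countable all such multiplicities are the same.\<close>

lemma family_total_infinite:
  assumes I: "countable I" and inf: "\<And>l. l \<in> T \<Longrightarrow> infinite {i \<in> I. l \<in> S i}"
    and sub: "\<And>i. i \<in> I \<Longrightarrow> S i \<subseteq> T"
  shows "family_total I (\<lambda>i. indic (S i)) (infinite_copies T)"
  unfolding family_total_def
proof
  fix l
  have eq: "(SIGMA i:I. below (indic (S i) l)) = (\<lambda>i. (i, 0)) ` {i \<in> I. l \<in> S i}"
    by (auto simp: indic_def split: if_splits)
  have "ecard ((\<lambda>i. (i, 0 :: nat)) ` {i \<in> I. l \<in> S i}) = infinite_copies T l"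
  proof (cases "l \<in> T")
    case True
    then show ?thesis using inf[OF True] by (simp add: ecard_def infinite_copies_def finite_image_iff inj_on_def)
  next
    case False
    then have "{i \<in> I. l \<in> S i} = {}" using sub by auto
    then show ?thesis using False unfolding \<open>{i \<in> I. l \<in> S i} = {}\<close>
      by (simp add: ecard_def infinite_copies_def zero_enat_def)
  qed
  then show "below (infinite_copies T l) \<approx> (SIGMA i:I. below (indic (S i) l))"
    unfolding eq using I by (subst below_eqpoll_iff) auto
qed

section \<open>Direct sums of the spaces X_a with prescribed multiplicities\<close>

locale lp_ordinal_scale = exponent p for p :: real +
  fixes e :: "countable_ordinal \<Rightarrow> nat \<Rightarrow> countable_ordinal"
  assumes enum: "enumerates_below_limits e"
begin

abbreviation "RM \<equiv> R_measure e"
abbreviation "RS \<equiv> R_space p e"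

lemma prob_RM: "prob_space (RM a)"
  by (rule prob_space_R_measure[OF enum])

lemma enum_below: "is_limit b \<Longrightarrow> e b n < b"
  using enum by (auto simp: enumerates_below_limits_def dest!: bij_betwE)

text \<open>A limit of constants is compared with its own mean, which up to a factor approximates it
  as well as any other constant does.\<close>

lemma closed_subspace_Lp_dyadic_0: "closed_subspace unit_interval (Lp_dyadic p 0)" "(\<lambda>_. c) \<in> Lp_dyadic p 0"
proof -
  note U = prob_space_unit_interval
  have const: "f \<in> Lp_dyadic p 0" if "f \<in> Lp p unit_interval" "AE x in unit_interval. f x = c" for f c
    using that unfolding Lp_dyadic_def by (auto intro!: exI[of _ c])
  show "(\<lambda>_. c) \<in> Lp_dyadic p 0" for c by (rule const[OF Lp_const[OF U], of _ c]) simp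
  show "closed_subspace unit_interval (Lp_dyadic p 0)"
  proof (rule closed_subspaceI)
    show sub: "Lp_dyadic p 0 \<subseteq> Lp p unit_interval" by (auto simp: Lp_dyadic_def)
    show "(\<lambda>_. 0) \<in> Lp_dyadic p 0" by (rule const[OF Lp_const[OF U], of _ 0]) simp
    show "(\<lambda>x. a * f x + b * g x) \<in> Lp_dyadic p 0" if fg: "f \<in> Lp_dyadic p 0" "g \<in> Lp_dyadic p 0" for f g a b
    proof -
      obtain c where c: "AE x in unit_interval. f x = c" using Lp_dyadic_0_AE[OF fg(1)] by blast
      obtain d where d: "AE x in unit_interval. g x = d" using Lp_dyadic_0_AE[OF fg(2)] by blast
      have "AE x in unit_interval. a * f x + b * g x = a * c + b * d" using c d by eventually_elim simp
      then show ?thesis using const[OF Lp_lc[OF U]] fg sub by blast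
    qed
    fix u f assume f: "f \<in> Lp p unit_interval" and u: "\<And>n. u n \<in> Lp_dyadic p 0"
      and lim: "(\<lambda>n. pmom unit_interval (\<lambda>x. u n x - f x)) \<longlonglongrightarrow> 0"
    interpret U: prob_space unit_interval by (rule U)
    define c where "c = (\<integral>x. f x \<partial>unit_interval)"
    have uL: "u n \<in> Lp p unit_interval" for n using u sub by blast
    have le: "pmom unit_interval (\<lambda>x. f x - c) \<le> 2 * 2 powr p * pmom unit_interval (\<lambda>x. u n x - f x)" for n
    proof -
      obtain d where d: "AE x in unit_interval. u n x = d" using Lp_dyadic_0_AE[OF u] by blast
      \<comment> \<open>Here f - c has mean zero and is shifted by c - d; the result is f - d, which
        is f minus u_n almost everywhere.\<close>
      have "pmom unit_interval (\<lambda>x. f x - c) \<le> 2 * 2 powr p * pmom unit_interval (\<lambda>x. (f x - c) + (c - d))"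
      proof (rule shift_by_constant(6)[OF U])
        show "(\<lambda>x. f x - c) \<in> Lp p unit_interval" by (rule Lp_diff[OF U f Lp_const[OF U]])
        show "(\<integral>x. f x - c \<partial>unit_interval) = 0"
          using Lp_integrable[OF U f] by (simp add: c_def U.prob_space)
      qed
      also have "pmom unit_interval (\<lambda>x. (f x - c) + (c - d)) = pmom unit_interval (\<lambda>x. f x - u n x)"
        by (rule pmom_cong_AE) (use d f uL[of n] in \<open>auto simp: Lp_iff\<close>)
      finally show ?thesis by (simp add: pmom_diff_commute[of _ f])
    qed
    have "pmom unit_interval (\<lambda>x. f x - c) \<le> 2 * 2 powr p * 0"
      by (rule LIMSEQ_le_const[OF tendsto_mult[OF tendsto_const lim]]) (use le in blast)
    then have "pmom unit_interval (\<lambda>x. f x - c) = 0" using pmom_nonneg[of unit_interval "\<lambda>x. f x - c"] by simp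
    then have "AE x in unit_interval. f x = c"
      using pmom_eq_0_imp[OF Lp_diff[OF U f Lp_const[OF U]]] by auto
    then show "f \<in> Lp_dyadic p 0" by (rule const[OF f])
  qed
qed

text \<open>The induction carries the constants along because the tensor product contains them only
  if its factor does; they are what later allows means to be subtracted within the space.\<close>

lemma closed_subspace_RS: "closed_subspace (RM a) (RS a) \<and> (\<forall>c. (\<lambda>_. c) \<in> RS a)"
proof (induction a rule: less_induct)
  case (less a)
  consider "a = 0" | b where "a = osucc b" | "is_limit a" by (auto simp: is_limit_def)
  then show ?case
  proof cases
    case 1
    show ?thesis
      unfolding 1 R_measure_0 R_space_0
      using closed_subspace_relabel[OF _ closed_subspace_Lp_dyadic_0(1), of Base] closed_subspace_Lp_dyadic_0(2)
      by (auto simp: relabel_def inj_def)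
  next
    case 2
    have IH: "closed_subspace (RM b) (RS b)" "\<And>c. (\<lambda>_. c) \<in> RS b" using less[of b] 2 by auto
    have sub: "RS b \<subseteq> Lp p (RM b)" using closed_subspaceD(1)[OF IH(1)] by blast
    show ?thesis
      unfolding 2 R_measure_osucc R_space_osucc
      using closed_subspace_relabel[OF _ closed_subspace_tensor(1)[OF prob_RM sub IH(2)], of Extend]
        closed_subspace_tensor(2)[OF prob_RM sub IH(2)]
      by (auto simp: relabel_def inj_def)
  next
    case 3
    have IH: "closed_subspace (RM (e a n)) (RS (e a n))" for n using less[OF enum_below[OF 3]] by blast
    have sub: "mean_zero (RM (e a n)) (RS (e a n)) \<subseteq> Lp p (RM (e a n))" for n
      using closed_subspaceD(1)[OF closed_subspace_mean_zero[OF prob_RM IH]] by blast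
    note cs = closed_subspace_indep_sum[of "\<lambda>n. RM (e a n)" "\<lambda>n. mean_zero (RM (e a n)) (RS (e a n))", OF prob_RM sub]
    show ?thesis
      unfolding R_measure_limit[OF enum 3] R_space_limit[OF enum 3]
      using closed_subspace_relabel[OF _ cs(1), of Seq] cs(2) by (auto simp: relabel_def inj_def)
  qed
qed

text \<open>Summands are labelled by \<open>None\<close> for $\mathbb R$ and \<open>Some a\<close> for $X_a$.\<close>

definition atom :: "countable_ordinal option \<Rightarrow> point two_normed" where
  "atom l = (case l of None \<Rightarrow> line (Base 0) | Some a \<Rightarrow> lp_space (RM a) (mean_zero (RM a) (RS a)))"

lemma atom_simps [simp]: "atom None = line (Base 0)"
  "atom (Some a) = lp_space (RM a) (mean_zero (RM a) (RS a))"
  by (simp_all add: atom_def)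

lemma two_normed_space_atom: "two_normed_space (atom l)"
  using two_normed_space_line two_normed_space_lp[OF prob_RM closed_subspace_mean_zero[OF prob_RM]] closed_subspace_RS
  by (cases l) auto

definition slots :: "(countable_ordinal option \<Rightarrow> enat) \<Rightarrow> (countable_ordinal option \<times> nat) set" where
  "slots m = {(l, n). n \<in> below (m l)}"

text \<open>The normal form in which all computations take place. It depends on the multiplicities
  alone, so an equation between multiplicity functions is already an identity of spaces.\<close>

definition U :: "(countable_ordinal option \<Rightarrow> enat) \<Rightarrow> ((countable_ordinal option \<times> nat) \<times> point) two_normed" where
  "U m = dsum (slots m) (\<lambda>z. atom (fst z))"

lemma two_normed_space_U: "two_normed_space (U m)"
  unfolding U_def by (intro two_normed_space_dsum two_normed_space_atom)

lemma U_reindex: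
  assumes "bij_betw \<pi> I (slots m)" "\<And>i. X i = atom (fst (\<pi> i))"
  shows "isomorphic 1 (dsum I X) (U m)"
  using dsum_reindex[of "slots m" "\<lambda>z. atom (fst z)", OF two_normed_space_atom assms(1)]
  unfolding U_def assms(2)[abs_def] .

text \<open>A sum of normal forms is flattened and then reindexed. The bijection
  \<open>\<pi>\<close> keeps the label and replaces the number of a copy by a summand together with
  a number inside that summand.\<close>

lemma U_family:
  assumes tot: "family_total I m N"
  shows "isomorphic 1 (dsum I (\<lambda>i. U (m i))) (U N)"
proof -
  have "\<forall>l. \<exists>h. bij_betw h (below (N l)) (SIGMA i:I. below (m i l))"
    using tot unfolding family_total_def eqpoll_def by blast
  then obtain h where h: "\<And>l. bij_betw (h l) (below (N l)) (SIGMA i:I. below (m i l))" by metis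
  define \<pi> where "\<pi> = (\<lambda>(l, n). (fst (h l n), (l, snd (h l n))))"
  have bij: "bij_betw \<pi> (slots N) (SIGMA i:I. slots (m i))"
  proof (rule bij_betwI')
    show "\<pi> x = \<pi> y \<longleftrightarrow> x = y" if "x \<in> slots N" "y \<in> slots N" for x y
      using that h by (auto simp: \<pi>_def slots_def bij_betw_def inj_on_def prod_eq_iff)
    show "\<pi> x \<in> (SIGMA i:I. slots (m i))" if x: "x \<in> slots N" for x
    proof -
      obtain l n where ln: "x = (l, n)" "n \<in> below (N l)" using x by (auto simp: slots_def)
      then have "h l n \<in> (SIGMA i:I. below (m i l))" using bij_betwE[OF h] by blast
      then show ?thesis by (auto simp: ln(1) \<pi>_def slots_def)
    qed
    show "\<exists>x\<in>slots N. y = \<pi> x" if y: "y \<in> (SIGMA i:I. slots (m i))" for y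
    proof -
      obtain i l k where ilk: "y = (i, (l, k))" "i \<in> I" "k \<in> below (m i l)" using y by (auto simp: slots_def)
      then have "(i, k) \<in> h l ` below (N l)" using h[of l] by (auto simp: bij_betw_def)
      then obtain n where "n \<in> below (N l)" "h l n = (i, k)" by force
      then show ?thesis by (intro bexI[of _ "(l, n)"]) (simp_all add: ilk(1) \<pi>_def slots_def)
    qed
  qed
  have "isomorphic 1 (dsum I (\<lambda>i. U (m i))) (dsum (SIGMA i:I. slots (m i)) (\<lambda>(i, z). atom (fst z)))"
    unfolding U_def by (rule dsum_flatten) (rule two_normed_space_atom)
  moreover have "isomorphic 1 (U N) (dsum (SIGMA i:I. slots (m i)) (\<lambda>(i, z). atom (fst z)))"
  proof -
    have "(\<lambda>z. (case \<pi> z of (i, z) \<Rightarrow> atom (fst z))) = (\<lambda>z. atom (fst z))" by (auto simp: \<pi>_def)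
    then show ?thesis
      using dsum_reindex[of "SIGMA i:I. slots (m i)" "\<lambda>(i, z). atom (fst z)", OF _ bij] two_normed_space_atom
      unfolding U_def by (auto simp: case_prod_beta)
  qed
  ultimately show ?thesis using iso_trans[OF _ iso_sym] by fastforce
qed

text \<open>The constant is hidden, and it depends on the pair. This is harmless in chains and
  finite sums; statements about infinitely many pairs have to keep the constant explicit.\<close>

definition eqv :: "(countable_ordinal option \<Rightarrow> enat) \<Rightarrow> (countable_ordinal option \<Rightarrow> enat) \<Rightarrow> bool" (infix "\<sim>" 50)
  where "m \<sim> m' \<longleftrightarrow> (\<exists>K. isomorphic K (U m) (U m'))"

lemma eqv_refl [simp, intro]: "m \<sim> m"
  unfolding eqv_def using iso_refl[OF two_normed_space_U] by blast

lemma eqv_sym: "m \<sim> m' \<Longrightarrow> m' \<sim> m"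
  unfolding eqv_def using iso_sym by blast

lemma eqv_trans [trans]: "m \<sim> m' \<Longrightarrow> m' \<sim> m'' \<Longrightarrow> m \<sim> m''"
  unfolding eqv_def using iso_trans by blast

lemma eq_eqv_trans [trans]: "m = m' \<Longrightarrow> m' \<sim> m'' \<Longrightarrow> m \<sim> m''"
  by simp

text \<open>The rule for infinitely many replacements at once, and hence the place where one
  \<open>K\<close> must work for all indices.\<close>

lemma eqv_family:
  assumes "family_total I m N" "family_total I m' N'" and iso: "\<And>i. i \<in> I \<Longrightarrow> isomorphic K (U (m i)) (U (m' i))"
    and "1 \<le> K"
  shows "N \<sim> N'"
proof -
  have "isomorphic (K + K powr (p / 2)) (dsum I (\<lambda>i. U (m i))) (dsum I (\<lambda>i. U (m' i)))"
    by (intro dsum_cong two_normed_space_U iso \<open>1 \<le> K\<close>)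
  from iso_trans[OF iso_trans[OF iso_sym[OF U_family[OF assms(1)]] this] U_family[OF assms(2)]]
  show ?thesis unfolding eqv_def by blast
qed

lemma iso_mono:
  assumes A: "two_normed_space A" and B: "two_normed_space B" and iso: "isomorphic K A B" and "K \<le> L"
  shows "isomorphic L A B"
proof -
  obtain D where D: "linear_relation K A B D" "\<And>f. f \<in> car A \<Longrightarrow> \<exists>F. D f F" "\<And>F. F \<in> car B \<Longrightarrow> \<exists>f. D f F"
    using iso by (rule isoE) blast
  have "linear_relation L A B D"
  proof (rule linear_relationI)
    show "1 \<le> L" using D(1) \<open>K \<le> L\<close> by (simp add: linear_relation_def)
    show "D (\<lambda>x. a * f x + b * g x) (\<lambda>x. a * F x + b * G x)" if "D f F" "D g G" for f F g G a b
      using D(1) that unfolding linear_relation_def by blast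
    fix f F assume "D f F"
    then have *: "f \<in> car A" "F \<in> car B" "comparable K A B f F" using D(1) unfolding linear_relation_def by blast+
    then show "f \<in> car A" "F \<in> car B" by auto
    have up: "z \<le> L * y" if "z \<le> K * y" "0 \<le> y" for z y :: real
      using order_trans[OF that(1) mult_right_mono[OF \<open>K \<le> L\<close> that(2)]] .
    show "comparable L A B f F"
      using * A B unfolding comparable_def by (auto intro: up sq_nonneg wt_nonneg)
  qed
  then show ?thesis using D(2,3) by (rule isoI)
qed

lemma eqv_add:
  assumes "m \<sim> m'" shows "m + k \<sim> m' + k"
proof -
  obtain K where K: "isomorphic K (U m) (U m')" using assms unfolding eqv_def by blast
  have K1: "1 \<le> K" using iso_ge_1[OF K] .
  show ?thesis
  proof (rule eqv_family[OF family_total_bool family_total_bool _ K1])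
    show "isomorphic K (U (if b then m else k)) (U (if b then m' else k))" for b
      using K iso_mono[OF two_normed_space_U two_normed_space_U iso_refl[OF two_normed_space_U] K1] by simp
  qed
qed

lemma eqv_add2: "m \<sim> m' \<Longrightarrow> k \<sim> k' \<Longrightarrow> m + k \<sim> m' + k'"
  using eqv_trans[OF eqv_add[of m m' k] eqv_add[of k k' m', unfolded add.commute[of _ m']]] .

end

section \<open>Ordinals and absorption\<close>

lemma osucc_less_limit: "is_limit b \<Longrightarrow> a < b \<Longrightarrow> osucc a < b"
  using osucc_le[of a b] by (auto simp: is_limit_def order_less_le)

lemma less_osucc_iff: "a < osucc b \<longleftrightarrow> a \<le> b"
  by (metis less_osucc le_less_trans not_less osucc_le)

lemma is_limit_pos: "is_limit b \<Longrightarrow> 0 < b"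
  by (simp add: is_limit_def order_less_le)

lemma omega_le: "is_limit b \<Longrightarrow> omega \<le> b"
  unfolding omega_def by (rule Least_le)

lemma funpow_osucc_strict_mono: "strict_mono (\<lambda>n. (osucc ^^ n) a)"
  by (rule strict_mono_Suc_iff[THEN iffD2]) simp

text \<open>Take g least such that no limit lies strictly between g and b. If g were the successor
  of d, then d would have the same property. All ordinals between g and b are successors, so
  descending from any of them reaches g after finitely many steps.\<close>

lemma limits_bounded_below:
  assumes b: "is_limit b" and no: "\<not> (\<forall>d<b. \<exists>c. is_limit c \<and> d < c \<and> c < b)"
  obtains g where "g < b" "g = 0 \<or> is_limit g"
    "{c. g < c \<and> c < b} = range (\<lambda>n. (osucc ^^ Suc n) g)"
proof -
  define Q where "Q d \<longleftrightarrow> d < b \<and> (\<forall>c. is_limit c \<longrightarrow> d < c \<longrightarrow> \<not> c < b)" for d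
  have ex: "\<exists>d. Q d" using no unfolding Q_def by blast
  define g where "g = (LEAST d. Q d)"
  have g: "Q g" and least: "\<And>d. Q d \<Longrightarrow> g \<le> d"
    unfolding g_def using LeastI_ex[OF ex] Least_le[of Q] by auto
  have gb: "g < b" using g by (simp add: Q_def)
  have succ: "\<exists>d. c = osucc d \<and> g \<le> d" if "g < c" "c < b" for c
  proof -
    have "\<not> is_limit c" using g that unfolding Q_def by blast
    moreover have "c \<noteq> 0" using that(1) by (metis leD zero_le_countable_ordinal)
    ultimately obtain d where "c = osucc d" by (auto simp: is_limit_def)
    then show ?thesis using that by (auto simp: less_osucc_iff)
  qed
  have "g = 0 \<or> is_limit g"
  proof (rule ccontr)
    assume c: "\<not> (g = 0 \<or> is_limit g)"
    then obtain d where d: "g = osucc d" by (auto simp: is_limit_def)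
    have "Q d"
      unfolding Q_def
    proof (intro conjI allI impI)
      show "d < b" using less_trans[OF less_osucc[of d]] gb d by simp
      fix x assume x: "is_limit x" "d < x"
      then have "g \<le> x" using osucc_le[of d x] d by simp
      then have "g < x" using x(1) c by (auto simp: order_less_le)
      then show "\<not> x < b" using g x(1) unfolding Q_def by blast
    qed
    then show False using least[of d] d less_osucc[of d] by (metis leD)
  qed
  moreover have "{c. g < c \<and> c < b} = range (\<lambda>n. (osucc ^^ Suc n) g)"
  proof
    have "c \<in> range (\<lambda>n. (osucc ^^ Suc n) g)" if "g < c" "c < b" for c
      using that
    proof (induction c rule: less_induct)
      case (less c)
      obtain d where d: "c = osucc d" "g \<le> d" using succ[OF less.prems] by blast
      show ?case
      proof (cases "g = d")
        case True
        then show ?thesis using d by (auto intro!: range_eqI[of _ _ 0])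
      next
        case False
        then have "g < d" using d(2) by simp
        moreover have "d < c" using d(1) by simp
        moreover from this have "d < b" using less.prems(2) by (rule less_trans)
        ultimately have "d \<in> range (\<lambda>n. (osucc ^^ Suc n) g)" using less.IH[of d] by blast
        then obtain n where "d = (osucc ^^ Suc n) g" by blast
        then have "c = (osucc ^^ Suc (Suc n)) g" using d(1) by simp
        then show ?thesis by blast
      qed
    qed
    then show "{c. g < c \<and> c < b} \<subseteq> range (\<lambda>n. (osucc ^^ Suc n) g)" by blast
    have "g < (osucc ^^ Suc n) g \<and> (osucc ^^ Suc n) g < b" for n
    proof (induction n)
      case 0
      then show ?case using osucc_less_limit[OF b gb] by simp
    next
      case (Suc n)
      then show ?case using osucc_less_limit[OF b] less_osucc[of "(osucc ^^ Suc n) g"]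
        by (auto intro: less_trans)
    qed
    then show "range (\<lambda>n. (osucc ^^ Suc n) g) \<subseteq> {c. g < c \<and> c < b}" by blast
  qed
  ultimately show thesis using that gb by blast
qed

lemma infinite_copies_absorb: "S \<subseteq> T \<Longrightarrow> infinite_copies T + indic S = infinite_copies T"
  "infinite_copies T + infinite_copies T = infinite_copies T"
  by (auto simp: infinite_copies_def indic_def fun_eq_iff)

lemma indic_disjoint_union: "S \<inter> T = {} \<Longrightarrow> indic (S \<union> T) = indic S + indic T"
  by (auto simp: indic_def fun_eq_iff)

context lp_ordinal_scale
begin

abbreviation "mult_X a \<equiv> indic {Some a} :: countable_ordinal option \<Rightarrow> enat"
abbreviation "mult_line \<equiv> indic {None} :: countable_ordinal option \<Rightarrow> enat"

lemma U_single: "isomorphic 1 (atom l) (U (indic {l}))"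
proof (rule isometric_iso[where P = "\<lambda>f F. \<forall>x. f x = F ((l, 0), x)"])
  have s: "slots (indic {l}) = {(l, 0)}" by (auto simp: slots_def indic_def split: if_splits)
  have sec: "f = (\<lambda>x. F ((l, 0), x))" if "\<forall>x. f x = F ((l, 0), x)" for f :: "point \<Rightarrow> real" and F
    using that by auto
  show "two_normed_space (atom l)" "two_normed_space (U (indic {l}))"
    by (rule two_normed_space_atom two_normed_space_U)+
  show "f \<in> car (atom l) \<longleftrightarrow> F \<in> car (U (indic {l}))" if "\<forall>x. f x = F ((l, 0), x)" for f F
    unfolding U_def s sec[OF that] by (subst in_dsum_finite) auto
  show "pw (atom l) f = pw (U (indic {l})) F \<and> sq (atom l) f = sq (U (indic {l})) F"
    if "\<forall>x. f x = F ((l, 0), x)" for f F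
    unfolding U_def s sec[OF that] pw_dsum sq_dsum by simp
  show "\<exists>F. \<forall>x. f x = F ((l, 0), x)" for f :: "point \<Rightarrow> real"
    by (rule exI[of _ "\<lambda>(z, x). f x"]) simp
  show "\<exists>f. \<forall>x. f x = F ((l, 0), x)" for F :: "(countable_ordinal option \<times> nat) \<times> point \<Rightarrow> real"
    by (rule exI[of _ "\<lambda>x. F ((l, 0), x)"]) simp
qed simp

text \<open>Rosenthal's isomorphism in terms of multiplicities; \<open>K\<close> is the same for all
  limit ordinals, so all limit summands of a sum can be expanded simultaneously.\<close>

lemma limit_expansion:
  obtains K where "1 \<le> K"
    "\<And>b. is_limit b \<Longrightarrow> isomorphic K (U (mult_X b)) (U (indic (Some ` {c. 0 < c \<and> c < b})))"
proof -
  obtain K where K: "\<And>(M :: nat \<Rightarrow> point measure) X. (\<And>n. prob_space (M n)) \<Longrightarrow> (\<And>n. closed_subspace (M n) (X n)) \<Longrightarrow>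
    isomorphic K (dsum UNIV (\<lambda>n. lp_space (M n) (mean_zero (M n) (X n))))
      (lp_space (PiM UNIV M) (mean_zero (PiM UNIV M) (indep_sum p M (\<lambda>n. mean_zero (M n) (X n)))))"
    using rosenthal_iso by blast
  have iso: "isomorphic K (U (mult_X b)) (U (indic (Some ` {c. 0 < c \<and> c < b})))" if b: "is_limit b" for b
  proof -
    let ?M = "\<lambda>n. RM (e b n)" and ?X = "\<lambda>n. RS (e b n)"
    have X: "closed_subspace (?M n) (?X n)" for n using closed_subspace_RS by blast
    have sub: "mean_zero (?M n) (?X n) \<subseteq> Lp p (?M n)" for n
      using closed_subspaceD(1)[OF closed_subspace_mean_zero[OF prob_RM X]] by blast
    have P: "prob_space (PiM UNIV ?M)" by (intro prob_space_PiM prob_RM)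
    have 1: "isomorphic 1 (atom (Some b)) (lp_space (PiM UNIV ?M)
        (mean_zero (PiM UNIV ?M) (indep_sum p ?M (\<lambda>n. mean_zero (?M n) (?X n)))))"
      unfolding atom_simps R_measure_limit[OF enum b] R_space_limit[OF enum b]
      by (intro relabel_iso P closed_subspace_indep_sum(1) prob_RM sub) (simp add: inj_def)
    have 2: "isomorphic 1 (dsum UNIV (\<lambda>n. lp_space (?M n) (mean_zero (?M n) (?X n))))
        (U (indic (Some ` {c. 0 < c \<and> c < b})))"
    proof (rule U_reindex[where \<pi> = "\<lambda>n. (Some (e b n), 0)"])
      have bij: "bij_betw (e b) UNIV {c. 0 < c \<and> c < b}"
        using enum b by (simp add: enumerates_below_limits_def)
      have "slots (indic (Some ` {c. 0 < c \<and> c < b})) = (\<lambda>c. (Some c, 0)) ` {c. 0 < c \<and> c < b}"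
        by (auto simp: slots_def indic_def split: if_splits)
      moreover have "bij_betw (\<lambda>c. (Some c, 0 :: nat)) {c. 0 < c \<and> c < b} ((\<lambda>c. (Some c, 0)) ` {c. 0 < c \<and> c < b})"
        by (rule inj_on_imp_bij_betw) (simp add: inj_on_def)
      ultimately show "bij_betw (\<lambda>n. (Some (e b n), 0)) UNIV (slots (indic (Some ` {c. 0 < c \<and> c < b})))"
        using bij_betw_trans[OF bij] by (simp add: comp_def)
    qed simp
    from iso_trans[OF iso_sym[OF U_single] iso_trans[OF iso_trans[OF 1 iso_sym[OF K[of ?M ?X, OF prob_RM X]]] 2]]
    show ?thesis by simp
  qed
  \<comment> \<open>The bound 1 \<le> K is read off from one instance; \<omega> serves as a limit
    ordinal known to exist.\<close>
  show thesis using that[OF iso_ge_1[OF iso[OF is_limit_omega]] iso] by blast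
qed

lemma slots_double: "slots (mult_X a + mult_X a + mult_line) = {(Some a, 0), (Some a, 1), (None, 0)}"
proof -
  have two: "below 2 = {0, 1}"
    using below_simps(2)[of 2] by (auto simp: numeral_eq_enat)
  have "below ((mult_X a + mult_X a + mult_line) l) = (if l = Some a then {0, 1} else if l = None then {0} else {})" for l
    by (simp add: indic_def two)
  then show ?thesis unfolding slots_def by (auto split: if_splits)
qed

text \<open>Again one \<open>K\<close> for all ordinals, because the constant of
  \<open>halving_iso\<close> depends on p only. This is used for all members of an infinite run of
  successors at once.\<close>

lemma successor_expansion:
  obtains K where "1 \<le> K" "\<And>a. isomorphic K (U (mult_X (osucc a))) (U (mult_X a + mult_X a + mult_line))"
proof -
  define K where "K = 4 powr p * (9 * 2 powr p + 2)"
  have iso: "isomorphic K (U (mult_X (osucc a))) (U (mult_X a + mult_X a + mult_line))" for a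
  proof -
    have X: "closed_subspace (RM a) (RS a)" and c: "\<And>c. (\<lambda>_. c) \<in> RS a" using closed_subspace_RS by blast+
    have sub: "RS a \<subseteq> Lp p (RM a)" using closed_subspaceD(1)[OF X] by blast
    let ?P = "unit_interval \<Otimes>\<^sub>M RM a"
    have 1: "isomorphic 1 (atom (Some (osucc a)))
        (lp_space ?P (mean_zero ?P (tensor p unit_interval (Lp_dyadic p 1) (RM a) (RS a))))"
      unfolding atom_simps R_measure_osucc R_space_osucc
      by (intro relabel_iso prob_space_unit_pair prob_RM closed_subspace_tensor(1) sub c) (simp add: inj_def)
    have 2: "isomorphic 1 (dsum {0, 1, 2 :: nat} (\<lambda>i. if i = 2 then line (Base 0) else lp_space (RM a) (mean_zero (RM a) (RS a))))
        (U (mult_X a + mult_X a + mult_line))"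
    proof (rule U_reindex[where \<pi> = "\<lambda>i. if i = 2 then (None, 0) else (Some a, i)"])
      show "bij_betw (\<lambda>i. if i = 2 then (None, 0) else (Some a, i)) {0, 1, 2} (slots (mult_X a + mult_X a + mult_line))"
        unfolding slots_double by (auto simp: bij_betw_def inj_on_def)
    qed simp
    from iso_trans[OF iso_sym[OF U_single] iso_trans[OF iso_trans[OF 1 iso_sym[OF halving_iso[OF prob_RM X c]]] 2]]
    show ?thesis by (simp add: K_def)
  qed
  show thesis using that[OF iso_ge_1[OF iso] iso] by blast
qed

lemma constant_splitting:
  obtains K where "isomorphic K (lp_space (RM a) (RS a)) (U (mult_X a + mult_line))"
proof -
  have X: "closed_subspace (RM a) (RS a)" and c: "\<And>c. (\<lambda>_. c) \<in> RS a" using closed_subspace_RS by blast+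
  have "below ((mult_X a + mult_line) l) = (if l = Some a \<or> l = None then {0} else {})" for l
    by (simp add: indic_def)
  then have s: "slots (mult_X a + mult_line) = {(Some a, 0), (None, 0)}"
    unfolding slots_def by (auto split: if_splits)
  have "isomorphic 1 (dsum {0, 1 :: nat} (\<lambda>i. if i = 1 then line (Base 0) else lp_space (RM a) (mean_zero (RM a) (RS a))))
      (U (mult_X a + mult_line))"
  proof (rule U_reindex[where \<pi> = "\<lambda>i. if i = 1 then (None, 0) else (Some a, i)"])
    show "bij_betw (\<lambda>i. if i = 1 then (None, 0) else (Some a, i)) {0, 1} (slots (mult_X a + mult_line))"
      unfolding s by (auto simp: bij_betw_def inj_on_def)
  qed simp
  from iso_trans[OF iso_sym[OF constant_iso[OF prob_RM X c]] this] show thesis by (rule that)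
qed

text \<open>A constant with mean zero vanishes. All elements of both spaces are null, so every one
  of them may be related to every other.\<close>

lemma X_zero_eqv: "mult_X 0 \<sim> 0"
proof -
  have "isomorphic 1 (atom (Some 0)) (U 0)"
  proof (rule isometric_iso[where P = "\<lambda>f F. f \<in> car (atom (Some 0))"])
    have s: "slots 0 = {}" by (auto simp: slots_def)
    have F: "F \<in> car (U 0)" "pw (U 0) F = 0" "sq (U 0) F = 0" for F
      unfolding U_def s by (simp_all add: in_dsum pw_dsum sq_dsum)
    show "two_normed_space (atom (Some 0))" "two_normed_space (U 0)"
      by (rule two_normed_space_atom two_normed_space_U)+
    show "f \<in> car (atom (Some 0)) \<longleftrightarrow> F \<in> car (U 0)" if "f \<in> car (atom (Some 0))" for f F
      using that F by simp
    show "pw (atom (Some 0)) f = pw (U 0) F \<and> sq (atom (Some 0)) f = sq (U 0) F"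
      if f: "f \<in> car (atom (Some 0))" for f F
    proof -
      have fX: "f \<in> RS 0" and f0: "(\<integral>x. f x \<partial>RM 0) = 0" using f by (auto simp: mean_zero_def)
      have inj: "inj Base" by (simp add: inj_def)
      have fB: "(\<lambda>x. f (Base x)) \<in> Lp_dyadic p 0" using fX by (simp add: R_space_0 relabel_def)
      obtain c where c: "AE x in unit_interval. f (Base x) = c" using Lp_dyadic_0_AE[OF fB] by blast
      interpret R: prob_space "RM 0" by (rule prob_RM)
      have AEc: "AE x in RM 0. f x = c"
        unfolding R_measure_0 using c by (simp add: AE_embed_measure[OF inj])
      have fL: "f \<in> Lp p (RM 0)" using closed_subspaceD(1)[OF _ fX] closed_subspace_RS by blast
      have "(\<integral>x. f x \<partial>RM 0) = (\<integral>x. c \<partial>RM 0)"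
        by (rule integral_cong_AE) (use AEc fL in \<open>auto simp: Lp_iff\<close>)
      then have "c = 0" using f0 by (simp add: R.prob_space)
      then have sq: "sq (atom (Some 0)) f = 0" using square_eq_0_iff[OF prob_RM fL] AEc by simp
      show ?thesis using F sq pw_eq_0[OF two_normed_space_atom f sq] by simp
    qed
    show "(\<lambda>x. a * f x + b * g x) \<in> car (atom (Some 0))"
      if "f \<in> car (atom (Some 0))" "g \<in> car (atom (Some 0))" for f g a b
      using lc_car[OF two_normed_space_atom that] .
    show "\<exists>f. f \<in> car (atom (Some 0))" using zero_car[OF two_normed_space_atom] by blast
  qed auto
  from iso_trans[OF iso_sym[OF U_single] this] show ?thesis unfolding eqv_def by blast
qed

text \<open>The two properties under which X + X + \<real>, the expansion of the next space,
  collapses to X.\<close>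

definition absorbing :: "(countable_ordinal option \<Rightarrow> enat) \<Rightarrow> bool" where
  "absorbing m \<longleftrightarrow> m + m \<sim> m \<and> m + mult_line \<sim> m"

lemma absorbing_cong:
  assumes "m \<sim> m'" "absorbing m'" shows "absorbing m"
proof -
  have s: "m' \<sim> m" by (rule eqv_sym[OF assms(1)])
  have "m + m \<sim> m' + m'" by (rule eqv_add2[OF assms(1) assms(1)])
  also have "m' + m' \<sim> m'" using assms(2) by (simp add: absorbing_def)
  also note s
  finally have 1: "m + m \<sim> m" .
  have "m + mult_line \<sim> m' + mult_line" by (rule eqv_add[OF assms(1)])
  also have "m' + mult_line \<sim> m'" using assms(2) by (simp add: absorbing_def)
  also note s
  finally show ?thesis unfolding absorbing_def using 1 by blast
qed

lemma X_osucc_eqv: "mult_X (osucc a) \<sim> mult_X a + mult_X a + mult_line"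
  using successor_expansion unfolding eqv_def by metis

lemma X_osucc_absorb:
  assumes "absorbing (mult_X a)" shows "mult_X (osucc a) \<sim> mult_X a"
proof -
  have "mult_X (osucc a) \<sim> mult_X a + mult_X a + mult_line" by (rule X_osucc_eqv)
  also have "\<dots> \<sim> mult_X a + mult_line" using assms by (intro eqv_add) (simp add: absorbing_def)
  also have "\<dots> \<sim> mult_X a" using assms by (simp add: absorbing_def)
  finally show ?thesis .
qed

lemma X_limit_eqv: "is_limit b \<Longrightarrow> mult_X b \<sim> indic (Some ` {c. 0 < c \<and> c < b})"
  using limit_expansion unfolding eqv_def by metis

text \<open>Split the sum into its limit part \<open>L\<close> and the rest \<open>W\<close>. Every
  d below b lies below infinitely many limits c < b, so one expansion of all of \<open>L\<close>
  gives \<open>V\<close>, which contains every summand infinitely often. Then \<open>V\<close>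
  absorbs whatever consists of such summands, while \<open>W\<close> remains as a spectator.\<close>

lemma absorbing_unbounded_limits:
  assumes b: "is_limit b" and unb: "\<forall>d<b. \<exists>c. is_limit c \<and> d < c \<and> c < b"
  shows "absorbing (mult_X b)"
proof -
  define M where "M = (indic (Some ` {c. 0 < c \<and> c < b}) :: countable_ordinal option \<Rightarrow> enat)"
  define L where "L = (indic (Some ` {c. is_limit c \<and> c < b}) :: countable_ordinal option \<Rightarrow> enat)"
  define W where "W = (indic (Some ` {c. 0 < c \<and> c < b \<and> \<not> is_limit c}) :: countable_ordinal option \<Rightarrow> enat)"
  define V where "V = (infinite_copies (Some ` {c. 0 < c \<and> c < b}) :: countable_ordinal option \<Rightarrow> enat)"
  have "Some ` {c. 0 < c \<and> c < b} = Some ` {c. is_limit c \<and> c < b} \<union> Some ` {c. 0 < c \<and> c < b \<and> \<not> is_limit c}"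
    using is_limit_pos by auto
  then have M: "M = L + W" unfolding M_def L_def W_def by (subst indic_disjoint_union[symmetric]) auto
  obtain K where K: "1 \<le> K"
    "\<And>b. is_limit b \<Longrightarrow> isomorphic K (U (mult_X b)) (U (indic (Some ` {c. 0 < c \<and> c < b})))"
    using limit_expansion by blast
  have "L \<sim> V"
  proof (rule eqv_family[OF _ _ _ K(1)])
    show "family_total {c. is_limit c \<and> c < b} mult_X L"
      unfolding L_def by (rule family_total_single[where f = Some]) simp
    show "family_total {c. is_limit c \<and> c < b} (\<lambda>c. indic (Some ` {d. 0 < d \<and> d < c})) V"
      unfolding V_def
    proof (rule family_total_infinite)
      show "countable {c. is_limit c \<and> c < b}"
        by (rule countable_subset[OF _ countable_below[of b]]) auto
      show "Some ` {d. 0 < d \<and> d < c} \<subseteq> Some ` {c. 0 < c \<and> c < b}" if "c \<in> {c. is_limit c \<and> c < b}" for c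
        using that by (auto intro: less_trans)
      fix l assume "l \<in> Some ` {c. 0 < c \<and> c < b}"
      then obtain d where d: "l = Some d" "0 < d" "d < b" by blast
      have eq: "{c \<in> {c. is_limit c \<and> c < b}. l \<in> Some ` {d. 0 < d \<and> d < c}} = {c. is_limit c \<and> d < c \<and> c < b}"
        using d by auto
      show "infinite {c \<in> {c. is_limit c \<and> c < b}. l \<in> Some ` {d. 0 < d \<and> d < c}}"
        unfolding eq
      \<comment> \<open>A finite set of limits between d and b would have a largest element, and by
        assumption there is a further limit above it.\<close>
      proof
        assume fin: "finite {c. is_limit c \<and> d < c \<and> c < b}"
        have ne: "{c. is_limit c \<and> d < c \<and> c < b} \<noteq> {}" using unb d(3) by blast
        define c where "c = Max {c. is_limit c \<and> d < c \<and> c < b}"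
        have c: "d < c" "c < b" using Max_in[OF fin ne] unfolding c_def by auto
        obtain c' where c': "is_limit c'" "c < c'" "c' < b" using unb c(2) by blast
        then have "c' \<le> c" unfolding c_def using c(1) by (intro Max_ge[OF fin]) (auto simp: c_def[symmetric])
        then show False using c'(2) by simp
      qed
    qed
    show "isomorphic K (U (mult_X c)) (U (indic (Some ` {d. 0 < d \<and> d < c})))" if "c \<in> {c. is_limit c \<and> c < b}" for c
      using K(2) that by simp
  qed
  then have MV: "M \<sim> V + W" unfolding M by (rule eqv_add)
  have VM: "V + M = V" unfolding V_def M_def by (rule infinite_copies_absorb) simp
  \<comment> \<open>Only one of the two copies is expanded; the other is then swallowed by
    \<open>V\<close>.\<close>
  have "M + M \<sim> M + (V + W)" using eqv_add2[OF eqv_refl MV] .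
  also have "M + (V + W) = (V + M) + W" by (simp only: ac_simps)
  also have "\<dots> = V + W" by (simp only: VM)
  also have "V + W \<sim> M" by (rule eqv_sym[OF MV])
  finally have 1: "M + M \<sim> M" .
  \<comment> \<open>The real line does not occur among the summands under its own label. But X_0 = 0
    gives X_1 = \<real>, and X_1 is a summand of \<open>V\<close>.\<close>
  have "mult_X (osucc 0) \<sim> mult_X 0 + mult_X 0 + mult_line" by (rule X_osucc_eqv)
  also have "\<dots> \<sim> 0 + 0 + mult_line" by (intro eqv_add eqv_add2 X_zero_eqv)
  finally have o: "mult_X (osucc 0) \<sim> mult_line" by simp
  have V1: "V + mult_X (osucc 0) = V"
    unfolding V_def using osucc_less_limit[OF b is_limit_pos[OF b]] less_osucc[of 0]
    by (intro infinite_copies_absorb) auto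
  have "M + mult_line \<sim> (V + W) + mult_X (osucc 0)" by (rule eqv_add2[OF MV eqv_sym[OF o]])
  also have "(V + W) + mult_X (osucc 0) = (V + mult_X (osucc 0)) + W" by (simp only: ac_simps)
  also have "\<dots> = V + W" by (simp only: V1)
  also have "V + W \<sim> M" by (rule eqv_sym[OF MV])
  finally have "absorbing M" unfolding absorbing_def using 1 by blast
  then show ?thesis using absorbing_cong[OF X_limit_eqv[OF b]] by (simp add: M_def)
qed

text \<open>With \<open>G\<close> for X_g and \<open>N\<close> for infinitely many lines, the
  relation \<open>Y1\<close> expresses Y by a sum in which G and N occur. Both are idempotent, G by
  assumption and N because its multiplicity is infinite, so adding G, N or a line to Y changes
  nothing.\<close>

lemma absorbing_successor_tail:
  assumes g: "mult_X g + mult_X g \<sim> mult_X g"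
  defines "Y \<equiv> indic (Some ` range (\<lambda>n. (osucc ^^ Suc n) g)) :: countable_ordinal option \<Rightarrow> enat"
  shows "absorbing Y" "mult_X g + Y \<sim> Y"
proof -
  define h where "h n = (osucc ^^ n) g" for n
  define N where "N = (infinite_copies {None} :: countable_ordinal option \<Rightarrow> enat)"
  define G where "G = mult_X g"
  have sm: "strict_mono h" unfolding h_def[abs_def] by (rule funpow_osucc_strict_mono)
  have inj: "inj h" by (rule strict_mono_imp_inj_on[OF sm])
  have Y: "Y = indic (range (\<lambda>n. Some (h (Suc n))))"
    unfolding Y_def h_def by (simp only: image_image)
  have GY: "indic (range (\<lambda>n. Some (h n))) = G + Y"
  proof -
    have "range (\<lambda>n. Some (h n)) = {Some g} \<union> range (\<lambda>n. Some (h (Suc n)))"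
    proof
      show "range (\<lambda>n. Some (h n)) \<subseteq> {Some g} \<union> range (\<lambda>n. Some (h (Suc n)))"
      proof
        fix x assume "x \<in> range (\<lambda>n. Some (h n))"
        then obtain n where "x = Some (h n)" by blast
        then show "x \<in> {Some g} \<union> range (\<lambda>n. Some (h (Suc n)))" by (cases n) (auto simp: h_def)
      qed
      have "Some g = Some (h 0)" by (simp add: h_def)
      then show "{Some g} \<union> range (\<lambda>n. Some (h (Suc n))) \<subseteq> range (\<lambda>n. Some (h n))" by auto
    qed
    moreover have "{Some g} \<inter> range (\<lambda>n. Some (h (Suc n))) = {}"
    proof -
      have "g \<noteq> h (Suc n)" for n using strict_monoD[OF sm, of 0 "Suc n"] by (auto simp: h_def)
      then show ?thesis by auto
    qed
    ultimately show ?thesis unfolding G_def Y by (simp only: indic_disjoint_union)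
  qed
  obtain K where K: "1 \<le> K" "\<And>a. isomorphic K (U (mult_X (osucc a))) (U (mult_X a + mult_X a + mult_line))"
    using successor_expansion by blast
  have inf: "family_total (UNIV :: nat set) (\<lambda>_. mult_line) N"
    unfolding N_def by (rule family_total_infinite) auto
  have tot: "family_total UNIV (\<lambda>n. mult_X (h n)) (G + Y)"
    unfolding GY[symmetric] by (rule family_total_single) (use inj in \<open>auto simp: inj_def\<close>)
  \<comment> \<open>Expanding X_(g+n+1) yields two copies of X_(g+n) and a line. As n runs from 0,
    the copies range over \<open>G\<close> and all of \<open>Y\<close>, and the lines accumulate to
    \<open>N\<close>.\<close>
  have "Y \<sim> (G + Y) + (G + Y) + N"
  proof (rule eqv_family[OF _ family_total_add[OF family_total_add[OF tot tot] inf] _ K(1)])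
    show "family_total UNIV (\<lambda>n. mult_X (h (Suc n))) Y"
      unfolding Y by (rule family_total_single) (use inj in \<open>auto simp: inj_def\<close>)
    show "isomorphic K (U (mult_X (h (Suc n)))) (U (mult_X (h n) + mult_X (h n) + mult_line))" for n
      using K(2)[of "h n"] by (simp add: h_def)
  qed
  also have "(G + Y) + (G + Y) + N = (G + G) + (Y + Y + N)" by (simp only: ac_simps)
  also have "\<dots> \<sim> G + (Y + Y + N)" using g unfolding G_def by (rule eqv_add)
  finally have Y1: "Y \<sim> G + (Y + Y + N)" .
  have "G + Y \<sim> G + (G + (Y + Y + N))" by (rule eqv_add2[OF eqv_refl Y1])
  also have "\<dots> = (G + G) + (Y + Y + N)" by (simp only: ac_simps)
  also have "\<dots> \<sim> G + (Y + Y + N)" using g unfolding G_def by (rule eqv_add)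
  also have "\<dots> \<sim> Y" by (rule eqv_sym[OF Y1])
  finally have gY: "G + Y \<sim> Y" .
  then show "mult_X g + Y \<sim> Y" by (simp only: G_def)
  have NN: "N + N = N" "N + mult_line = N" unfolding N_def by (simp_all add: infinite_copies_absorb)
  have "Y + N \<sim> G + (Y + Y + N) + N" by (rule eqv_add[OF Y1])
  also have "\<dots> = G + (Y + Y + (N + N))" by (simp only: ac_simps)
  also have "\<dots> = G + (Y + Y + N)" by (simp only: NN)
  also have "\<dots> \<sim> Y" by (rule eqv_sym[OF Y1])
  finally have YN: "Y + N \<sim> Y" .
  have "Y + mult_line \<sim> G + (Y + Y + N) + mult_line" by (rule eqv_add[OF Y1])
  also have "\<dots> = G + (Y + Y + (N + mult_line))" by (simp only: ac_simps)
  also have "\<dots> = G + (Y + Y + N)" by (simp only: NN)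
  also have "\<dots> \<sim> Y" by (rule eqv_sym[OF Y1])
  finally have Yo: "Y + mult_line \<sim> Y" .
  \<comment> \<open>Give \<open>G\<close> to one copy of \<open>Y\<close> and \<open>N\<close> to
    the other, both of which are free; the total is exactly the right-hand side of
    \<open>Y1\<close>.\<close>
  have "Y + Y \<sim> (G + Y) + (Y + N)" by (rule eqv_add2[OF eqv_sym[OF gY] eqv_sym[OF YN]])
  also have "\<dots> = G + (Y + Y + N)" by (simp only: ac_simps)
  also have "\<dots> \<sim> Y" by (rule eqv_sym[OF Y1])
  finally show "absorbing Y" unfolding absorbing_def using Yo by blast
qed

text \<open>Transfinite induction. At a successor the space is isomorphic to its predecessor; at a
  limit ordinal the question is whether the limits below it are bounded, and in the bounded case the
  largest one, if any, is covered by the induction hypothesis.\<close>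

lemma absorbing_X:
  assumes "omega \<le> a" shows "absorbing (mult_X a)"
  using assms
proof (induction a rule: less_induct)
  case (less a)
  consider "a = 0" | b where "a = osucc b" | "is_limit a" by (auto simp: is_limit_def)
  then show ?case
  proof cases
    case 1
    then show ?thesis using less.prems is_limit_pos[OF is_limit_omega] by (simp add: leD)
  next
    case 2
    have "omega \<noteq> a" using is_limit_omega 2 by (auto simp: is_limit_def)
    then have "omega < osucc b" using less.prems 2 by (simp add: order_less_le)
    then have "omega \<le> b" by (simp only: less_osucc_iff)
    moreover have "b < a" unfolding 2 by (rule less_osucc)
    ultimately have ab: "absorbing (mult_X b)" by (rule less.IH[rotated])
    show ?thesis unfolding 2 by (rule absorbing_cong[OF X_osucc_absorb[OF ab] ab])
  next
    case 3
    show ?thesis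
    proof (cases "\<forall>d<a. \<exists>c. is_limit c \<and> d < c \<and> c < a")
      case True
      then show ?thesis by (rule absorbing_unbounded_limits[OF 3])
    next
      case False
      obtain g where g: "g < a" "g = 0 \<or> is_limit g" "{c. g < c \<and> c < a} = range (\<lambda>n. (osucc ^^ Suc n) g)"
        by (rule limits_bounded_below[OF 3 False])
      define Y where "Y = (indic (Some ` range (\<lambda>n. (osucc ^^ Suc n) g)) :: countable_ordinal option \<Rightarrow> enat)"
      \<comment> \<open>For g = 0 this holds because X_0 = 0; otherwise g is a limit, hence at least
        \<omega>, and the induction hypothesis applies.\<close>
      have gg: "mult_X g + mult_X g \<sim> mult_X g"
      proof (cases "g = 0")
        case True
        have "mult_X 0 + mult_X 0 \<sim> 0 + mult_X 0" by (rule eqv_add[OF X_zero_eqv])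
        then show ?thesis using True by simp
      next
        case False
        then show ?thesis using less.IH[OF g(1)] g(2) omega_le by (simp add: absorbing_def)
      qed
      note Y = absorbing_successor_tail[OF gg, folded Y_def]
      have "indic (Some ` {c. 0 < c \<and> c < a}) \<sim> Y"
      proof (cases "g = 0")
        case True
        then show ?thesis using g(3) by (simp add: Y_def)
      next
        case False
        then have lim: "is_limit g" using g(2) by blast
        \<comment> \<open>Since g is a limit, the summands below g together form another copy of
          X_g. So X_a is X_g + X_g + Y, and \<open>Y\<close> absorbs X_g twice.\<close>
        have "{c. 0 < c \<and> c < a} = {c. 0 < c \<and> c < g} \<union> ({g} \<union> {c. g < c \<and> c < a})"
          using is_limit_pos[OF lim] g(1) by (auto intro: less_trans)
        then have "Some ` {c. 0 < c \<and> c < a} = Some ` {c. 0 < c \<and> c < g} \<union> ({Some g} \<union> Some ` {c. g < c \<and> c < a})"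
          by auto
        moreover have "indic (Some ` {c. 0 < c \<and> c < g} \<union> ({Some g} \<union> Some ` {c. g < c \<and> c < a}))
            = indic (Some ` {c. 0 < c \<and> c < g}) + indic ({Some g} \<union> Some ` {c. g < c \<and> c < a})"
          by (rule indic_disjoint_union) auto
        moreover have "indic ({Some g} \<union> Some ` {c. g < c \<and> c < a}) = mult_X g + Y"
          unfolding Y_def g(3)[symmetric] by (rule indic_disjoint_union) auto
        ultimately have "indic (Some ` {c. 0 < c \<and> c < a}) = indic (Some ` {c. 0 < c \<and> c < g}) + (mult_X g + Y)"
          by (simp only:)
        also have "\<dots> \<sim> mult_X g + Y"
          by (rule eqv_add2[OF eqv_sym[OF X_limit_eqv[OF lim]] Y(2)])
        also have "\<dots> \<sim> Y" by (rule Y(2))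
        finally show ?thesis .
      qed
      then have "mult_X a \<sim> Y" by (rule eqv_trans[OF X_limit_eqv[OF 3]])
      then show ?thesis using Y(1) by (rule absorbing_cong)
    qed
  qed
qed

lemma X_funpow_osucc_eqv:
  assumes "omega \<le> a"
  shows "mult_X ((osucc ^^ k) a) \<sim> mult_X a"
proof (induction k)
  case (Suc k)
  have "a \<le> (osucc ^^ k) a" using strict_mono_less_eq[OF funpow_osucc_strict_mono[of a], of 0 k] by simp
  then have "absorbing (mult_X ((osucc ^^ k) a))" using assms by (intro absorbing_X) simp
  then show ?case using eqv_trans[OF X_osucc_absorb Suc.IH] by simp
qed simp

end

section \<open>From relations back to (p,2)-isomorphisms\<close>

context exponent
begin

text \<open>Choosing a partner for every function turns the relation into maps in both directions.
  Comparability of \<open>sq\<close> shows that the choice matters only up to null functions, so the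
  maps are linear and mutually inverse almost everywhere.\<close>

lemma p2_isomorphicI:
  assumes M: "prob_space M" and N: "prob_space N" and X: "closed_subspace M X" and Y: "closed_subspace N Y"
    and iso: "isomorphic K (lp_space M X) (lp_space N Y)"
  shows "p2_isomorphic p M X N Y"
proof -
  \<comment> \<open>Formulated for an arbitrary relation so that it applies to \<open>D\<close> and
    to its converse.\<close>
  have half: "\<exists>T. (\<forall>f\<in>X. D f (T f)) \<and> linear_mod_AE M X N Y T \<and> Lp_bounded p M X N T \<and> Lp_bounded 2 M X N T"
    if M: "prob_space M" and N: "prob_space N" and X: "closed_subspace M X" and Y: "closed_subspace N Y"
      and D: "linear_relation K (lp_space M X) (lp_space N Y) D"
      and total: "\<And>f. f \<in> X \<Longrightarrow> \<exists>F. D f F"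
    for M :: "'x measure" and N :: "'y measure" and X Y D
  proof -
    have K: "1 \<le> K" using D by (simp add: linear_relation_def)
    have "\<forall>f\<in>X. \<exists>F. D f F" using total by blast
    from bchoice[OF this] obtain T where T: "\<And>f. f \<in> X \<Longrightarrow> D f (T f)" by blast
    have Dc: "f \<in> X" "F \<in> Y" "comparable K (lp_space M X) (lp_space N Y) f F" if "D f F" for f F
      using D that unfolding linear_relation_def by auto
    have XL: "f \<in> Lp p M" if "f \<in> X" for f using closed_subspaceD(1)[OF X that] .
    have YL: "f \<in> Lp p N" if "f \<in> Y" for f using closed_subspaceD(1)[OF Y that] .
    have TY: "T f \<in> Y" if "f \<in> X" for f using Dc(2)[OF T[OF that]] .
    have Dlc: "D (\<lambda>x. a * f x + b * g x) (\<lambda>x. a * F x + b * G x)" if "D f F" "D g G" for f F g G a b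
      using D that unfolding linear_relation_def by blast
    \<comment> \<open>Differences are related to differences, so inputs that agree almost everywhere
      have an output difference of L_2 norm zero. With two partners of the same function this also
      yields linearity of the chosen map.\<close>
    have AE: "AE y in N. F y = G y" if fF: "D f F" and gG: "D g G" and fg: "AE x in M. f x = g x" for f F g G
    proof -
      have d: "D (\<lambda>x. f x - g x) (\<lambda>x. F x - G x)" using Dlc[OF fF gG, of 1 "-1"] by simp
      have "(\<integral>x. (f x - g x)\<^sup>2 \<partial>M) = 0"
        using square_eq_0_iff[OF M XL[OF Dc(1)[OF d]]] fg by simp
      then have "(\<integral>y. (F y - G y)\<^sup>2 \<partial>N) \<le> 0" using Dc(3)[OF d] by (simp add: comparable_def)
      moreover have "0 \<le> (\<integral>y. (F y - G y)\<^sup>2 \<partial>N)" by (rule Bochner_Integration.integral_nonneg) simp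
      ultimately have "(\<integral>y. (F y - G y)\<^sup>2 \<partial>N) = 0" by linarith
      then show ?thesis using square_eq_0_iff[OF N YL[OF Dc(2)[OF d]]] by simp
    qed
    have "linear_mod_AE M X N Y T"
      unfolding linear_mod_AE_def
    proof (intro conjI ballI allI impI)
      show "T \<in> X \<rightarrow> Y" using TY by blast
      show "AE y in N. T f y = T g y" if "f \<in> X" "g \<in> X" "AE x in M. f x = g x" for f g
        using AE[OF T T] that by blast
      show "AE y in N. T (\<lambda>x. a * f x + b * g x) y = a * T f y + b * T g y" if "f \<in> X" "g \<in> X" for f g a b
        by (rule AE[OF T Dlc[OF T T]]) (use that closed_subspaceD(3)[OF X] in auto)
    qed
    moreover have "Lp_bounded p M X N T"
      unfolding Lp_bounded_def
    proof (intro exI ballI)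
      fix f assume f: "f \<in> X"
      have "pmom N (T f) \<le> wt (lp_space N Y) (T f)" by (rule pmom_le_wt)
      also have "\<dots> \<le> K * wt (lp_space M X) f" using Dc(3)[OF T[OF f]] by (simp add: comparable_def)
      \<comment> \<open>Comparability speaks of \<open>wt\<close>, not of \<open>pw\<close>; on a
        probability space the passage costs a factor 2.\<close>
      also have "\<dots> \<le> K * (2 * pmom M f)" using K wt_lp_le[OF M XL[OF f]] by (intro mult_left_mono) auto
      finally have "pmom N (T f) powr (1 / p) \<le> ((2 * K) * pmom M f) powr (1 / p)"
        using p_gt_2 by (intro powr_mono2) (auto simp: mult_ac)
      also have "\<dots> = (2 * K) powr (1 / p) * pmom M f powr (1 / p)"
        by (rule powr_mult)
      finally show "Lp_norm p N (T f) \<le> (2 * K) powr (1 / p) * Lp_norm p M f" by (simp add: Lp_norm_eq)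
    qed
    moreover have "Lp_bounded 2 M X N T"
      unfolding Lp_bounded_def
    proof (intro exI ballI)
      fix f assume f: "f \<in> X"
      have "(\<integral>y. (T f y)\<^sup>2 \<partial>N) \<le> K * (\<integral>x. (f x)\<^sup>2 \<partial>M)" using Dc(3)[OF T[OF f]] by (simp add: comparable_def)
      then have "(\<integral>y. (T f y)\<^sup>2 \<partial>N) powr (1 / 2) \<le> (K * (\<integral>x. (f x)\<^sup>2 \<partial>M)) powr (1 / 2)"
        by (intro powr_mono2) (auto intro: Bochner_Integration.integral_nonneg)
      also have "\<dots> = K powr (1 / 2) * (\<integral>x. (f x)\<^sup>2 \<partial>M) powr (1 / 2)" by (rule powr_mult)
      finally show "Lp_norm 2 N (T f) \<le> K powr (1 / 2) * Lp_norm 2 M f" by (simp add: Lp_norm_def)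
    qed
    ultimately show ?thesis using T by blast
  qed
  obtain D where D: "linear_relation K (lp_space M X) (lp_space N Y) D"
    "\<And>f. f \<in> car (lp_space M X) \<Longrightarrow> \<exists>F. D f F" "\<And>F. F \<in> car (lp_space N Y) \<Longrightarrow> \<exists>f. D f F"
    using iso by (rule isoE) blast
  obtain T where T: "\<And>f. f \<in> X \<Longrightarrow> D f (T f)" "linear_mod_AE M X N Y T" "Lp_bounded p M X N T" "Lp_bounded 2 M X N T"
    using half[OF M N X Y D(1)] D(2) by auto
  obtain S where S: "\<And>g. g \<in> Y \<Longrightarrow> D (S g) g" "linear_mod_AE N Y M X S" "Lp_bounded p N Y M S" "Lp_bounded 2 N Y M S"
    using half[OF N M Y X linear_relation_converse[OF D(1)]] D(3) by auto
  have Dc: "f \<in> X" "F \<in> Y" "comparable K (lp_space M X) (lp_space N Y) f F" if "D f F" for f F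
    using D(1) that unfolding linear_relation_def by auto
  have sub: "D (\<lambda>x. f x - g x) (\<lambda>x. F x - G x)" if fF: "D f F" and gG: "D g G" for f F g G
  proof -
    have "D (\<lambda>x. 1 * f x + (-1) * g x) (\<lambda>x. 1 * F x + (-1) * G x)"
      using D(1) fF gG unfolding linear_relation_def by blast
    then show ?thesis by simp
  qed
  have left: "AE x in M. S (T f) x = f x" if f: "f \<in> X" for f
  proof -
    \<comment> \<open>Both S(T f) and f are related to T f, so their difference is related to the
      zero function and must be null.\<close>
    have d: "D (\<lambda>x. S (T f) x - f x) (\<lambda>x. T f x - T f x)"
      by (rule sub[OF S(1)[OF Dc(2)[OF T(1)[OF f]]] T(1)[OF f]])
    have "(\<integral>x. (S (T f) x - f x)\<^sup>2 \<partial>M) \<le> 0" using Dc(3)[OF d] by (simp add: comparable_def)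
    moreover have "0 \<le> (\<integral>x. (S (T f) x - f x)\<^sup>2 \<partial>M)" by (rule Bochner_Integration.integral_nonneg) simp
    ultimately have "(\<integral>x. (S (T f) x - f x)\<^sup>2 \<partial>M) = 0" by linarith
    then show ?thesis using square_eq_0_iff[OF M closed_subspaceD(1)[OF X Dc(1)[OF d]]] by simp
  qed
  have right: "AE y in N. T (S g) y = g y" if g: "g \<in> Y" for g
  proof -
    have d: "D (\<lambda>x. S g x - S g x) (\<lambda>x. T (S g) x - g x)"
      by (rule sub[OF T(1)[OF Dc(1)[OF S(1)[OF g]]] S(1)[OF g]])
    have "(\<integral>x. (T (S g) x - g x)\<^sup>2 \<partial>N) \<le> 0" using Dc(3)[OF d] by (simp add: comparable_def)
    moreover have "0 \<le> (\<integral>x. (T (S g) x - g x)\<^sup>2 \<partial>N)" by (rule Bochner_Integration.integral_nonneg) simp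
    ultimately have "(\<integral>x. (T (S g) x - g x)\<^sup>2 \<partial>N) = 0" by linarith
    then show ?thesis using square_eq_0_iff[OF N closed_subspaceD(1)[OF Y Dc(2)[OF d]]] by simp
  qed
  show ?thesis unfolding p2_isomorphic_def using T(2-4) S(2-4) left right by blast
qed

end

theorem corollary2p10:
  fixes p :: real and k :: nat and \<alpha> :: countable_ordinal
    and e :: "countable_ordinal \<Rightarrow> nat \<Rightarrow> countable_ordinal"
  assumes "2 < p"
    and "enumerates_below_limits e"
    and "omega \<le> \<alpha>"
  shows "p2_isomorphic p
           (R_measure e ((osucc ^^ k) \<alpha>)) (R_space p e ((osucc ^^ k) \<alpha>))
           (R_measure e \<alpha>) (R_space p e \<alpha>)"
proof -
  interpret lp_ordinal_scale p e using assms(1,2) by unfold_locales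
  let ?b = "(osucc ^^ k) \<alpha>"
  \<comment> \<open>The absorption argument concerns the mean-zero parts; adding one line to both
    sides restores the constants.\<close>
  have "mult_X ?b + mult_line \<sim> mult_X \<alpha> + mult_line" by (rule eqv_add[OF X_funpow_osucc_eqv[OF assms(3)]])
  then obtain K where K: "isomorphic K (U (mult_X ?b + mult_line)) (U (mult_X \<alpha> + mult_line))"
    unfolding eqv_def by blast
  obtain K1 where K1: "isomorphic K1 (lp_space (RM ?b) (RS ?b)) (U (mult_X ?b + mult_line))"
    by (rule constant_splitting)
  obtain K2 where K2: "isomorphic K2 (lp_space (RM \<alpha>) (RS \<alpha>)) (U (mult_X \<alpha> + mult_line))"
    by (rule constant_splitting)
  show ?thesis
    using closed_subspace_RS
    by (intro p2_isomorphicI[OF prob_RM prob_RM _ _ iso_trans[OF iso_trans[OF K1 K] iso_sym[OF K2]]]) blast+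
qed

end
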